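(* There is an algorithm that, given a strongly orderable graph $G$, lists without repetition all members of $\mathsf{MaxIrr}(G)$ with polynomial delay and using polynomial space.
   Context: All graphs are finite, simple and undirected; $N(v)$ and $N[v]$ denote open and closed neighborhoods. For $I\subseteq V(G)$ and $x\in I$, $\mathsf{priv}_G(x,I)=\{y\in N[x] : N[y]\cap I=\{x\}\}$. A set $I$ is irredundant if $\mathsf{priv}_G(x,I)\neq\emptyset$ for every $x\in I$; $\mathsf{MaxIrr}(G)$ is the family of inclusion-wise maximal irredundant sets. Two vertices $x,y$ are comparable if $N(x)\setminus\{y\}\subseteq N(y)\setminus\{x\}$ or $N(y)\setminus\{x\}\subseteq N(x)\setminus\{y\}$. A vertex $x$ is quasi-simple if the vertices of $N(x)$ are pairwise comparable. A quasi-simple elimination ordering is an ordering $v_1,\dots,v_n$ of $V(G)$ such that for each $i$, $v_i$ is quasi-simple in $G[\{v_1,\dots,v_i\}]$. A graph is strongly orderable if it admits a quasi-simple elimination ordering. An enumeration algorithm has polynomial delay if the time before the first output, between consecutive outputs, and after the last output is bounded by a polynomial in the input size. *)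

theory Defs
  imports
    Complex_Main
    "HOL-Library.Log_Nat"
    "HOL-Computational_Algebra.Polynomial"
begin

section \<open>Graphs and irredundant sets\<close>

definition simple_graph :: "'a set \<Rightarrow> 'a set set \<Rightarrow> bool" where
  "simple_graph V E \<longleftrightarrow>
     finite V \<and> (\<forall>e\<in>E. \<exists>u v. u \<in> V \<and> v \<in> V \<and> u \<noteq> v \<and> e = {u, v})"

definition nbh :: "'a set set \<Rightarrow> 'a \<Rightarrow> 'a set" where
  "nbh E v = {u. {u, v} \<in> E}"

definition cnbh :: "'a set set \<Rightarrow> 'a \<Rightarrow> 'a set" where
  "cnbh E v = insert v (nbh E v)"

definition induced_edges :: "'a set set \<Rightarrow> 'a set \<Rightarrow> 'a set set" where
  "induced_edges E W = {e \<in> E. e \<subseteq> W}"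

definition priv :: "'a set set \<Rightarrow> 'a \<Rightarrow> 'a set \<Rightarrow> 'a set" where
  "priv E x I = {y \<in> cnbh E x. cnbh E y \<inter> I = {x}}"

definition irredundant :: "'a set set \<Rightarrow> 'a set \<Rightarrow> bool" where
  "irredundant E I \<longleftrightarrow> (\<forall>x\<in>I. priv E x I \<noteq> {})"

definition MaxIrr :: "'a set \<Rightarrow> 'a set set \<Rightarrow> 'a set set" where
  "MaxIrr V E = {I. I \<subseteq> V \<and> irredundant E I \<and>
     (\<forall>J. J \<subseteq> V \<and> irredundant E J \<and> I \<subseteq> J \<longrightarrow> J = I)}"

definition comparable :: "'a set set \<Rightarrow> 'a \<Rightarrow> 'a \<Rightarrow> bool" where
  "comparable E x y \<longleftrightarrow>
     nbh E x - {y} \<subseteq> nbh E y - {x} \<or> nbh E y - {x} \<subseteq> nbh E x - {y}"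

definition quasi_simple :: "'a set set \<Rightarrow> 'a \<Rightarrow> bool" where
  "quasi_simple E x \<longleftrightarrow> pairwise (comparable E) (nbh E x)"

definition quasi_simple_elimination_ordering ::
    "'a set \<Rightarrow> 'a set set \<Rightarrow> 'a list \<Rightarrow> bool" where
  "quasi_simple_elimination_ordering V E vs \<longleftrightarrow>
     distinct vs \<and> set vs = V \<and>
     (\<forall>i<length vs. quasi_simple (induced_edges E (set (take (Suc i) vs))) (vs ! i))"

definition strongly_orderable :: "'a set \<Rightarrow> 'a set set \<Rightarrow> bool" where
  "strongly_orderable V E \<longleftrightarrow> (\<exists>vs. quasi_simple_elimination_ordering V E vs)"


section \<open>Model of computation\<close>

text \<open>
  Algorithms are while-programs over a random access memory. The memory consists of named
  arrays of natural numbers (a scalar variable is the entry of index 0 of an array) and a program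
  mentions only finitely many names. The only arithmetic operations are addition and truncated
  subtraction. Solutions are written number by number on a write-only output medium.

  Every step costs one time unit, and space is counted in bits. Since expressions have a size
  fixed by the program, a bound on the space bounds the bit length of all operands of a step, so
  polynomially bounded time and space in this model agree with those notions for Turing machines.
\<close>

type_synonym vname = string
type_synonym state = "vname \<Rightarrow> nat \<Rightarrow> nat"

datatype aexp = Const nat | Elem vname aexp | Add aexp aexp | Sub aexp aexp

fun aval :: "aexp \<Rightarrow> state \<Rightarrow> nat" where
  "aval (Const k) s = k"
| "aval (Elem x a) s = s x (aval a s)"
| "aval (Add a b) s = aval a s + aval b s"
| "aval (Sub a b) s = aval a s - aval b s"

datatype bexp = Less aexp aexp | Neg bexp | Conj bexp bexp

fun bval :: "bexp \<Rightarrow> state \<Rightarrow> bool" where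
  "bval (Less a b) s \<longleftrightarrow> aval a s < aval b s"
| "bval (Neg b) s \<longleftrightarrow> \<not> bval b s"
| "bval (Conj b1 b2) s \<longleftrightarrow> bval b1 s \<and> bval b2 s"

text \<open>\<open>Put a\<close> appends the value of \<open>a\<close> to the solution being written, \<open>Emit\<close> completes that
  solution. \<open>Assign x a b\<close> is \<open>x[a] := b\<close>.\<close>

datatype com =
    Skip
  | Assign vname aexp aexp
  | Put aexp
  | Emit
  | Seq com com
  | Cond bexp com com
  | While bexp com

text \<open>A configuration consists of the program that remains to be executed, the memory, the
  solutions completed so far and the solution being written. It is halted iff the
  remaining program is \<open>Skip\<close>.\<close>

type_synonym config = "com \<times> state \<times> nat list list \<times> nat list"

fun step :: "config \<Rightarrow> config" where
  "step (Skip, s, done, cur) = (Skip, s, done, cur)"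
| "step (Assign x a b, s, done, cur) =
     (Skip, s(x := (s x)(aval a s := aval b s)), done, cur)"
| "step (Put a, s, done, cur) = (Skip, s, done, cur @ [aval a s])"
| "step (Emit, s, done, cur) = (Skip, s, done @ [cur], [])"
| "step (Seq c1 c2, s, done, cur) =
     (if c1 = Skip then (c2, s, done, cur)
      else let (c1', r) = step (c1, s, done, cur) in (Seq c1' c2, r))"
| "step (Cond b c1 c2, s, done, cur) = (if bval b s then c1 else c2, s, done, cur)"
| "step (While b c, s, done, cur) =
     (if bval b s then Seq c (While b c) else Skip, s, done, cur)"

definition run :: "com \<Rightarrow> state \<Rightarrow> nat \<Rightarrow> config" where
  "run c s t = (step ^^ t) (c, s, [], [])"

definition remaining :: "config \<Rightarrow> com" where
  "remaining cf = fst cf"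

definition memory :: "config \<Rightarrow> state" where
  "memory cf = fst (snd cf)"

definition solutions :: "config \<Rightarrow> nat list list" where
  "solutions cf = fst (snd (snd cf))"

definition unfinished :: "config \<Rightarrow> nat list" where
  "unfinished cf = snd (snd (snd cf))"

definition halts_at :: "com \<Rightarrow> state \<Rightarrow> nat \<Rightarrow> bool" where
  "halts_at c s T \<longleftrightarrow>
     remaining (run c s T) = Skip \<and> (\<forall>t<T. remaining (run c s t) \<noteq> Skip)"

text \<open>A finite set of numbers is output as a list of its elements, each occurring once and in any
  order.\<close>

definition lists_without_repetition :: "com \<Rightarrow> state \<Rightarrow> nat set set \<Rightarrow> bool" where
  "lists_without_repetition c s \<S> \<longleftrightarrow>
     (\<exists>T. halts_at c s T \<and>
        unfinished (run c s T) = [] \<and>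
        (\<forall>xs \<in> set (solutions (run c s T)). distinct xs) \<and>
        distinct (map set (solutions (run c s T))) \<and>
        set ` set (solutions (run c s T)) = \<S>)"

definition output_times :: "com \<Rightarrow> state \<Rightarrow> nat \<Rightarrow> nat list" where
  "output_times c s T =
     sorted_list_of_set {t \<in> {1..T}. solutions (run c s t) \<noteq> solutions (run c s (t - 1))}"

definition delay_at_most :: "com \<Rightarrow> state \<Rightarrow> nat \<Rightarrow> bool" where
  "delay_at_most c s D \<longleftrightarrow>
     (\<exists>T. halts_at c s T \<and>
        (let ts = 0 # output_times c s T @ [T]
         in \<forall>i. Suc i < length ts \<longrightarrow> ts ! Suc i - ts ! i \<le> D))"

text \<open>Each nonzero memory cell is charged the binary lengths of its index and of its content. Only
  finitely many cells are nonzero in a run on a finite input, so the sum does not degenerate.\<close>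

definition memory_bits :: "state \<Rightarrow> nat" where
  "memory_bits s = (\<Sum>(x, i) \<in> {(x, i). s x i \<noteq> 0}. floorlog 2 i + floorlog 2 (s x i))"

definition space_at_most :: "com \<Rightarrow> state \<Rightarrow> nat \<Rightarrow> bool" where
  "space_at_most c s B \<longleftrightarrow> (\<forall>t. memory_bits (memory (run c s t)) \<le> B)"


section \<open>Graphs as inputs\<close>

text \<open>A graph on the vertices \<open>0, \<dots>, n - 1\<close> is given by \<open>n\<close> and its adjacency matrix, stored row by
  row in the array \<open>A\<close>. All other cells are initially 0.\<close>

definition graph_input :: "nat \<Rightarrow> nat set set \<Rightarrow> state" where
  "graph_input n E = (\<lambda>_ _. 0)
     (''n'' := (\<lambda>_. 0)(0 := n),
      ''A'' := (\<lambda>i. if i < n * n \<and> {i div n, i mod n} \<in> E then 1 else 0))"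

definition graph_size :: "nat \<Rightarrow> nat set set \<Rightarrow> nat" where
  "graph_size n E = n + card E"

end

theory Submission
  imports Defs
begin

text \<open>
  Relabel the vertices by a strong ordering: if \<open>i > j\<close>, \<open>k > l\<close> and \<open>ik\<close>, \<open>il\<close>, \<open>jk\<close> are edges, then
  \<open>jl\<close> is an edge or \<open>j = l\<close>. It is found by repeatedly deleting a quasi-simple vertex; one of minimum
  degree is minimal in the vicinal preorder, which leaves room to respect all earlier strict
  comparisons.

  A set \<open>J\<close> is built up by scanning the columns \<open>v = 0, 1, \<dots>\<close>: first the least neighbour of \<open>v\<close> in \<open>J\<close> is
  placed, unless a neighbour of \<open>v\<close> is placed already, then \<open>v\<close> itself if it belongs to \<open>J\<close>. Sets are
  compared lexicographically by the outcome of the scan, and \<open>LB A\<close>, the best irredundant superset of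
  \<open>A\<close>, is found greedily. Reverse search: the parent of \<open>J\<close> is \<open>LB S\<close> for the longest prefix \<open>S\<close> of the
  scan of \<open>J\<close> with \<open>LB S \<noteq> J\<close>. If \<open>u\<close> is the next vertex placed, then \<open>J\<close> can be recovered from its
  parent, \<open>u\<close>, and new private neighbours for \<open>u\<close> and for those elements of \<open>S\<close> all of whose private
  neighbours are seen by \<open>u\<close>. The strong ordering implies that there are at most four of the latter, so
  that the children of a set can be found by trying polynomially many candidates. The tree is traversed
  without a stack, and nodes of even depth are output when they are entered, nodes of odd depth when they
  are left.
\<close>

section \<open>A bounded programming language\<close>

text \<open>Adding \<open>u\<close> to a solution can destroy the private neighbours of many
  elements, and guessing a repair for all of them would be exponential. A candidate need not equal
  the child \<open>J\<close>, however: \<open>J\<close> is the best irredundant superset of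
  \<open>S\<close> with \<open>u\<close> added, so every irredundant superset within the vertex set
  has the same scan prefix, and completing that prefix greedily gives \<open>J\<close> back. Hence
  doomed elements outside \<open>S\<close> are simply dropped. Those inside \<open>S\<close> are few
  because a neighbour slot of column \<open>g\<close> can place only the least neighbour of
  \<open>g\<close> in \<open>J\<close>, and only while no neighbour of \<open>g\<close> is placed;
  together with the strong ordering this leaves at most one doomed element of each of four kinds. So
  a child is described by eleven vertices: a column, a target, four doomed elements and five private
  neighbours. The machine has neither recursion nor multiplication; each move of the traversal
  recomputes the parent and searches all these tuples, and siblings are ordered by a fixed linear
  order so that the next one is determined by the current one alone.\<close>

definition upd :: "state \<Rightarrow> vname \<Rightarrow> nat \<Rightarrow> nat \<Rightarrow> state" where
  "upd s x i k = s(x := (s x)(i := k))"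

lemma upd_apply: "upd s x i k y j = (if y = x \<and> j = i then k else s y j)"
  by (simp add: upd_def)

lemma upd_same [simp]: "upd s x i k x i = k"
  by (simp add: upd_def)

lemma upd_index [simp]: "j \<noteq> i \<Longrightarrow> upd s x i k x j = s x j"
  by (simp add: upd_def)

lemma upd_upd [simp]: "upd (upd s x i k) x i l = upd s x i l"
  by (simp add: upd_def)

lemma upd_id: "s x i = k \<Longrightarrow> upd s x i k = s"
  by (auto simp: upd_def)

lemma upd_other [simp]: "y \<noteq> x \<Longrightarrow> upd s x i k y = s y"
  by (simp add: upd_def)

abbreviation Var :: "vname \<Rightarrow> aexp" where
  "Var x \<equiv> Elem x (Const 0)"

text \<open>\<open>P\<close> is required of every configuration passed, including both ends, which
  later yields the space bound. Excluding \<open>Skip\<close> before the end makes the step count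
  the exact halting time.\<close>

inductive reach :: "(state \<times> nat list list \<times> nat list \<Rightarrow> bool) \<Rightarrow> config \<Rightarrow> nat \<Rightarrow> config \<Rightarrow> bool"
  for P where
  reach_0: "P (snd cf) \<Longrightarrow> reach P cf 0 cf"
| reach_Suc: "P (snd cf) \<Longrightarrow> fst cf \<noteq> Skip \<Longrightarrow> reach P (step cf) k cf' \<Longrightarrow> reach P cf (Suc k) cf'"

lemma reach_trans:
  "reach P cf k cf' \<Longrightarrow> reach P cf' k' cf'' \<Longrightarrow> reach P cf (k + k') cf''"
  by (induction rule: reach.induct) (auto intro: reach.intros)

lemma reach_final: "reach P cf k cf' \<Longrightarrow> (step ^^ k) cf = cf'"
  by (induction rule: reach.induct) (auto simp: funpow_swap1)

lemma reach_mono: "reach P cf k cf' \<Longrightarrow> (\<And>r. P r \<Longrightarrow> Q r) \<Longrightarrow> reach Q cf k cf'"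
  by (induction rule: reach.induct) (auto intro: reach.intros)

lemma reach_between: "reach P cf k cf' \<Longrightarrow> j \<le> k \<Longrightarrow> P (snd ((step ^^ j) cf))"
proof (induction arbitrary: j rule: reach.induct)
  case (reach_Suc cf k cf')
  then show ?case by (cases j) (auto simp: funpow_swap1)
qed simp

lemma reach_not_Skip: "reach P cf k cf' \<Longrightarrow> j < k \<Longrightarrow> fst ((step ^^ j) cf) \<noteq> Skip"
proof (induction arbitrary: j rule: reach.induct)
  case (reach_Suc cf k cf')
  then show ?case by (cases j) (auto simp: funpow_swap1)
qed simp

lemma reach_Seq: "reach P cf k cf' \<Longrightarrow> reach P (Seq (fst cf) c, snd cf) k (Seq (fst cf') c, snd cf')"
proof (induction rule: reach.induct)
  case (reach_Suc cf k cf')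
  have "step (Seq (fst cf) c, snd cf) = (Seq (fst (step cf)) c, snd (step cf))"
    using reach_Suc(2) by (cases cf) (auto simp: Let_def split: prod.splits)
  with reach_Suc show ?case by (auto intro!: reach.intros)
qed (auto intro: reach.intros)

text \<open>Here \<open>K\<close> is only an upper bound on the time, so that branches of different
  length can be given a common cost.\<close>

definition ex where
  "ex P c r K r' \<longleftrightarrow> (\<exists>k\<le>K. reach P (c, r) k (Skip, r'))"

lemma ex_Skip: "P r \<Longrightarrow> ex P Skip r 0 r"
  unfolding ex_def by (auto intro: reach.intros)

lemma ex_Assign:
  "P (s, o1) \<Longrightarrow> P (upd s x (aval a s) (aval b s), o1) \<Longrightarrow>
   ex P (Assign x a b) (s, o1) 1 (upd s x (aval a s) (aval b s), o1)"
  unfolding ex_def by (rule exI[of _ 1], cases o1) (auto intro!: reach.intros simp: upd_def)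

lemma ex_Seq:
  assumes "ex P c1 r k1 r1" "ex P c2 r1 k2 r2"
  shows "ex P (Seq c1 c2) r (k1 + k2 + 1) r2"
proof -
  from assms obtain k k' where k: "k \<le> k1" "reach P (c1, r) k (Skip, r1)"
    "k' \<le> k2" "reach P (c2, r1) k' (Skip, r2)" unfolding ex_def by auto
  have a: "reach P (Seq c1 c2, r) k (Seq Skip c2, r1)"
    using reach_Seq[OF k(2), of c2] by simp
  have P: "P r1" using k(4) by (auto elim: reach.cases)
  have "reach P (Seq Skip c2, r1) (Suc k') (Skip, r2)"
    using k(4) P by (cases r1) (auto intro!: reach.intros)
  from reach_trans[OF a this] k(1,3) show ?thesis unfolding ex_def
    by (intro exI[of _ "k + Suc k'"]) simp
qed

lemma ex_mono: "ex P c r k r' \<Longrightarrow> k \<le> k' \<Longrightarrow> ex P c r k' r'"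
  unfolding ex_def by (meson le_trans)

lemma ex_Pmono: "ex P c r k r' \<Longrightarrow> (\<And>r. P r \<Longrightarrow> Q r) \<Longrightarrow> ex Q c r k r'"
  unfolding ex_def using reach_mono by blast

lemma reach_end: "reach P cf k cf' \<Longrightarrow> P (snd cf')"
  by (induction rule: reach.induct) auto

lemma ex_end: "ex P c r k r' \<Longrightarrow> P r'"
  unfolding ex_def by (auto dest: reach_end)

lemma ex_start: "ex P c r k r' \<Longrightarrow> P r"
  unfolding ex_def by (auto elim: reach.cases)

lemma ex_Cond:
  assumes "ex P (if bval b (fst r) then c1 else c2) r k r'"
  shows "ex P (Cond b c1 c2) r (k + 1) r'"
proof -
  have "P r" using ex_start assms .
  moreover obtain k1 where k1: "k1 \<le> k" "reach P (if bval b (fst r) then c1 else c2, r) k1 (Skip, r')"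
    using assms unfolding ex_def by auto
  ultimately have "reach P (Cond b c1 c2, r) (Suc k1) (Skip, r')"
    by (cases r) (auto intro!: reach.intros split: if_splits)
  then show ?thesis unfolding ex_def using k1(1) by (intro exI[of _ "Suc k1"]) simp
qed

lemma ex_While_False: "P r \<Longrightarrow> \<not> bval b (fst r) \<Longrightarrow> ex P (While b c) r 1 r"
  unfolding ex_def by (rule exI[of _ 1], cases r) (auto intro!: reach.intros)

lemma ex_While_True:
  assumes "bval b (fst r)" "ex P c r k1 r1" "ex P (While b c) r1 k2 r2"
  shows "ex P (While b c) r (k1 + k2 + 2) r2"
proof -
  have P: "P r" using assms(2) ex_start by blast
  from ex_Seq[OF assms(2,3)] obtain k where
    k: "k \<le> k1 + k2 + 1" "reach P (Seq c (While b c), r) k (Skip, r2)" unfolding ex_def by auto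
  have "reach P (While b c, r) (Suc k) (Skip, r2)"
    using P k(2) assms(1) by (cases r) (auto intro!: reach.intros)
  then show ?thesis unfolding ex_def using k(1) by (intro exI[of _ "Suc k"]) simp
qed

text \<open>The run is described by the sequence \<open>f\<close> of states at the loop head. A
  round costs \<open>k\<close> plus two steps, for the test and for passing from the body back to
  the loop; the failing test is the last step.\<close>

lemma ex_counting:
  assumes inv: "\<And>i. i < N \<Longrightarrow> ex P c (f i) k (f (Suc i))"
    and test: "\<And>i. i \<le> N \<Longrightarrow> bval b (fst (f i)) \<longleftrightarrow> i < N"
    and P: "P (f N)" and "i \<le> N"
  shows "ex P (While b c) (f i) ((N - i) * (k + 2) + 1) (f N)"
  using \<open>i \<le> N\<close>
proof (induction rule: inc_induct)
  case base
  show ?case using ex_While_False[of P "f N" b c] P test[of N] by simp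
next
  case (step i)
  have "ex P (While b c) (f i) (k + ((N - Suc i) * (k + 2) + 1) + 2) (f N)"
    by (rule ex_While_True[OF _ inv step.IH]) (use step test in auto)
  moreover have "N - i = Suc (N - Suc i)" using step by simp
  ultimately show ?case by (simp add: algebra_simps)
qed

section \<open>Vertex-quantified tests and for-programs, with their compilation to machine
  code\<close>

datatype fm = FLess aexp aexp | FNot fm | FAnd fm fm | FAll fm

text \<open>Repeating one letter gives an unbounded supply of auxiliary variables. All names used by
  the programs below start with a letter other than q and z, so they never clash with these.\<close>

definition qv :: "nat \<Rightarrow> vname" where "qv d = replicate (Suc d) (CHR ''q'')"
definition zv :: "nat \<Rightarrow> vname" where "zv d = replicate (Suc d) (CHR ''z'')"

definition tmp :: "vname \<Rightarrow> bool" where "tmp x \<longleftrightarrow> x \<in> range qv \<union> range zv"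

lemma qv_inj [simp]: "qv d = qv e \<longleftrightarrow> d = e"
  unfolding qv_def by (metis Suc_inject length_replicate)

lemma zv_inj [simp]: "zv d = zv e \<longleftrightarrow> d = e"
  unfolding zv_def by (metis Suc_inject length_replicate)

lemma qv_zv [simp]: "qv d \<noteq> zv e" "zv e \<noteq> qv d"
  unfolding qv_def zv_def by auto

lemma tmp_qz [simp]: "tmp (qv d)" "tmp (zv d)" "\<not> tmp ''n''"
  unfolding tmp_def by (auto simp: qv_def zv_def)

lemma tmp_neq [simp]: "\<not> tmp x \<Longrightarrow> x \<noteq> qv d" "\<not> tmp x \<Longrightarrow> x \<noteq> zv d"
  by auto

lemma n_neq [simp]: "''n'' \<noteq> qv d" "''n'' \<noteq> zv d" "qv d \<noteq> ''n''" "zv d \<noteq> ''n''"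
  by (auto simp: qv_def zv_def)

text \<open>Quantifiers range over the vertices; the variable bound at depth \<open>d\<close> is \<open>qv d\<close>.\<close>

fun fval :: "nat \<Rightarrow> fm \<Rightarrow> state \<Rightarrow> bool" where
  "fval d (FLess a b) s \<longleftrightarrow> aval a s < aval b s"
| "fval d (FNot f) s \<longleftrightarrow> \<not> fval d f s"
| "fval d (FAnd f g) s \<longleftrightarrow> fval d f s \<and> fval d g s"
| "fval d (FAll f) s \<longleftrightarrow> (\<forall>i<s ''n'' 0. fval (Suc d) f (upd s (qv d) 0 i))"

text \<open>The truth value is left in \<open>zv d\<close>, where the enclosing quantifier reads it.
  That quantifier resets \<open>zv (Suc d)\<close> after each round and its own variable at the end,
  so no other auxiliary cell is changed.\<close>

fun cf :: "nat \<Rightarrow> fm \<Rightarrow> com" where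
  "cf d (FLess a b) =
     Cond (Less a b) (Assign (zv d) (Const 0) (Const 1)) (Assign (zv d) (Const 0) (Const 0))"
| "cf d (FNot f) = Seq (cf d f) (Assign (zv d) (Const 0) (Sub (Const 1) (Var (zv d))))"
| "cf d (FAnd f g) = Seq (cf d f) (Cond (Less (Const 0) (Var (zv d))) (cf d g) Skip)"
| "cf d (FAll f) =
     Seq (Assign (zv d) (Const 0) (Const 1))
    (Seq (Assign (qv d) (Const 0) (Const 0))
    (Seq (While (Less (Var (qv d)) (Var ''n''))
           (Seq (cf (Suc d) f)
           (Seq (Cond (Less (Const 0) (Var (zv (Suc d)))) Skip (Assign (zv d) (Const 0) (Const 0)))
           (Seq (Assign (zv (Suc d)) (Const 0) (Const 0))
                (Assign (qv d) (Const 0) (Add (Var (qv d)) (Const 1)))))))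
         (Assign (qv d) (Const 0) (Const 0))))"

text \<open>Neither general loops nor output occur, so such a program terminates within a polynomial
  in \<open>n\<close> that can be read off its syntax, and its effect is the total function
  \<open>sem\<close>.\<close>

datatype fcom = FSet vname aexp aexp | FSeq fcom fcom | FIf fm fcom fcom | FFor vname fcom

fun sem :: "fcom \<Rightarrow> state \<Rightarrow> state" where
  "sem (FSet x a b) s = upd s x (aval a s) (aval b s)"
| "sem (FSeq c1 c2) s = sem c2 (sem c1 s)"
| "sem (FIf f c1 c2) s = (if fval 0 f s then sem c1 s else sem c2 s)"
| "sem (FFor x c) s = upd (foldl (\<lambda>s i. sem c (upd s x 0 i)) s [0..<s ''n'' 0]) x 0 0"

fun cc :: "fcom \<Rightarrow> com" where
  "cc (FSet x a b) = Assign x a b"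
| "cc (FSeq c1 c2) = Seq (cc c1) (cc c2)"
| "cc (FIf f c1 c2) = Seq (cf 0 f)
     (Cond (Less (Const 0) (Var (zv 0))) (Seq (Assign (zv 0) (Const 0) (Const 0)) (cc c1)) (cc c2))"
| "cc (FFor x c) =
     Seq (Assign x (Const 0) (Const 0))
    (Seq (While (Less (Var x) (Var ''n''))
           (Seq (cc c) (Assign x (Const 0) (Add (Var x) (Const 1)))))
         (Assign x (Const 0) (Const 0)))"

fun fcost :: "fm \<Rightarrow> nat poly" where
  "fcost (FLess a b) = 2"
| "fcost (FNot f) = fcost f + 2"
| "fcost (FAnd f g) = fcost f + fcost g + 2"
| "fcost (FAll f) = [:0, 1:] * (fcost f + 9) + 7"

fun cost :: "fcom \<Rightarrow> nat poly" where
  "cost (FSet x a b) = 1"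
| "cost (FSeq c1 c2) = cost c1 + cost c2 + 1"
| "cost (FIf f c1 c2) = fcost f + cost c1 + cost c2 + 4"
| "cost (FFor x c) = [:0, 1:] * (cost c + 4) + 5"

text \<open>A bound on the value in multiples of a memory bound \<open>M\<close> with
  \<open>1 \<le> M\<close>. Subtraction is truncated and cannot exceed its left argument.\<close>

fun asz :: "aexp \<Rightarrow> nat" where
  "asz (Const k) = k"
| "asz (Elem x a) = 1"
| "asz (Add a b) = asz a + asz b"
| "asz (Sub a b) = asz a"

fun anames :: "aexp \<Rightarrow> vname set" where
  "anames (Const k) = {}"
| "anames (Elem x a) = insert x (anames a)"
| "anames (Add a b) = anames a \<union> anames b"
| "anames (Sub a b) = anames a \<union> anames b"

fun fnames :: "fm \<Rightarrow> vname set" where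
  "fnames (FLess a b) = anames a \<union> anames b"
| "fnames (FNot f) = fnames f"
| "fnames (FAnd f g) = fnames f \<union> fnames g"
| "fnames (FAll f) = fnames f"

fun writes :: "fcom \<Rightarrow> vname set" where
  "writes (FSet x a b) = {x}"
| "writes (FSeq c1 c2) = writes c1 \<union> writes c2"
| "writes (FIf f c1 c2) = writes c1 \<union> writes c2"
| "writes (FFor x c) = insert x (writes c)"

fun cwrites :: "com \<Rightarrow> vname set" where
  "cwrites (Assign x a b) = {x}"
| "cwrites (Seq c1 c2) = cwrites c1 \<union> cwrites c2"
| "cwrites (Cond b c1 c2) = cwrites c1 \<union> cwrites c2"
| "cwrites (While b c) = cwrites c"
| "cwrites c = {}"

lemma finite_cwrites: "finite (cwrites c)"
  by (induction c rule: cwrites.induct) auto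

text \<open>Expressions whose value does not exceed 1 or the largest number in memory.\<close>

fun vsafe :: "aexp \<Rightarrow> bool" where
  "vsafe (Const k) \<longleftrightarrow> k \<le> 1"
| "vsafe (Elem x a) \<longleftrightarrow> True"
| "vsafe (Add a b) \<longleftrightarrow> False"
| "vsafe (Sub a b) \<longleftrightarrow> vsafe a"

text \<open>Index expressions may add two entries, as in a matrix address, but stored values must
  not grow. This keeps all numbers within one fixed bound during runs of any length, which is what
  bounds the space.\<close>

fun wfc :: "fcom \<Rightarrow> bool" where
  "wfc (FSet x a b) \<longleftrightarrow> \<not> tmp x \<and> x \<noteq> ''n'' \<and> asz a \<le> 2 \<and> vsafe b"
| "wfc (FSeq c1 c2) \<longleftrightarrow> wfc c1 \<and> wfc c2"
| "wfc (FIf f c1 c2) \<longleftrightarrow> fnames f \<inter> range zv = {} \<and> wfc c1 \<and> wfc c2"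
| "wfc (FFor x c) \<longleftrightarrow> \<not> tmp x \<and> x \<noteq> ''n'' \<and> x \<notin> writes c \<and> wfc c"

text \<open>Indices may reach \<open>2 * M\<close> because an address is a sum of two stored
  numbers.\<close>

definition bounded :: "vname set \<Rightarrow> nat \<Rightarrow> state \<Rightarrow> bool" where
  "bounded X M s \<longleftrightarrow> (\<forall>x i. s x i \<noteq> 0 \<longrightarrow> x \<in> X \<and> i \<le> 2 * M \<and> s x i \<le> M)"

lemma bounded_le: "bounded X M s \<Longrightarrow> s x i \<le> M"
  unfolding bounded_def by (metis le0)

lemma bounded_upd: "bounded X M s \<Longrightarrow> x \<in> X \<Longrightarrow> i \<le> 2 * M \<Longrightarrow> k \<le> M \<Longrightarrow> bounded X M (upd s x i k)"
  unfolding bounded_def by (auto simp: upd_apply)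

lemma aval_asz: "bounded X M s \<Longrightarrow> 1 \<le> M \<Longrightarrow> aval a s \<le> asz a * M"
  by (induction a) (auto simp: bounded_le algebra_simps)

lemma aval_vsafe: "bounded X M s \<Longrightarrow> 1 \<le> M \<Longrightarrow> vsafe a \<Longrightarrow> aval a s \<le> M"
  by (induction a) (auto simp: bounded_le)

lemma aval_upd: "x \<notin> anames a \<Longrightarrow> aval a (upd s x i k) = aval a s"
  by (induction a) auto

lemma fval_upd: "x \<notin> fnames f \<Longrightarrow> \<not> x \<in> range qv \<Longrightarrow> x \<noteq> ''n'' \<Longrightarrow> fval d f (upd s x i k) = fval d f s"
proof (induction f arbitrary: d s)
  case (FAll f)
  have xq: "x \<noteq> qv d" using FAll.prems by auto
  have *: "upd (upd s x i k) (qv d) 0 j = upd (upd s (qv d) 0 j) x i k" for j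
    using xq by (auto simp: fun_eq_iff upd_apply)
  have "fval (Suc d) f (upd (upd s x i k) (qv d) 0 j) = fval (Suc d) f (upd s (qv d) 0 j)" for j
    unfolding * using FAll.prems by (intro FAll.IH) auto
  moreover have "upd s x i k ''n'' 0 = s ''n'' 0" using FAll.prems by simp
  ultimately show ?case by simp
qed (auto simp: aval_upd)

definition quiet :: "vname set \<Rightarrow> nat \<Rightarrow> nat list list \<times> nat list \<Rightarrow> state \<times> nat list list \<times> nat list \<Rightarrow> bool" where
  "quiet X M w r \<longleftrightarrow> bounded X M (fst r) \<and> snd r = w"

lemma ex_quiet_Assign:
  assumes "bounded X M s" "x \<in> X" "i \<le> 2 * M" "k \<le> M" "aval a s = i" "aval b s = k"
  shows "ex (quiet X M w) (Assign x a b) (s, w) 1 (upd s x i k, w)"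
  using ex_Assign[of "quiet X M w" s w x a b] assms bounded_upd[OF assms(1-4)]
  by (auto simp: quiet_def)

text \<open>The cell \<open>zv d\<close> need not be 0 initially: the second half of a conjunction
  is evaluated into the cell that already holds the first. Deeper cells must be 0, because a
  quantifier sets \<open>zv (Suc d)\<close> to 0 instead of restoring its old value.\<close>

lemma cf_correct:
  assumes "fnames f \<inter> range zv = {}" "\<forall>e\<ge>d. s (qv e) 0 = 0" "\<forall>e>d. s (zv e) 0 = 0"
    "cwrites (cf d f) \<subseteq> X" "bounded X M s" "s ''n'' 0 = N" "N + 1 \<le> M"
  shows "ex (quiet X M w) (cf d f) (s, w) (poly (fcost f) N)
           (upd s (zv d) 0 (if fval d f s then 1 else 0), w)"
  using assms
proof (induction f arbitrary: d s)
  case (FLess a b)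
  have P: "1 \<le> M" "zv d \<in> X" using FLess by auto
  have "ex (quiet X M w) (cf d (FLess a b)) (s, w) (1 + 1)
    (upd s (zv d) 0 (if fval d (FLess a b) s then 1 else 0), w)"
    unfolding cf.simps
  proof (rule ex_Cond)
    show "ex (quiet X M w) (if bval (Less a b) (fst (s, w)) then Assign (zv d) (Const 0) (Const 1)
        else Assign (zv d) (Const 0) (Const 0)) (s, w) 1
        (upd s (zv d) 0 (if fval d (FLess a b) s then 1 else 0), w)"
      using ex_quiet_Assign[OF FLess(5) P(2), of 0 1 "Const 0" "Const 1" w]
        ex_quiet_Assign[OF FLess(5) P(2), of 0 0 "Const 0" "Const 0" w] P
      by (cases "aval a s < aval b s") simp_all
  qed
  then show ?case by (rule ex_mono) simp
next
  case (FNot f)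
  let ?t = "upd s (zv d) 0 (if fval d f s then 1 else 0)"
  let ?u = "upd s (zv d) 0 (if fval d (FNot f) s then 1 else 0)"
  have 1: "ex (quiet X M w) (cf d f) (s, w) (poly (fcost f) N) (?t, w)"
    by (intro FNot.IH) (use FNot.prems in auto)
  have "bounded X M ?t" using ex_end[OF 1] by (simp add: quiet_def)
  from ex_quiet_Assign[OF this, of "zv d" 0 "if fval d (FNot f) s then 1 else 0" "Const 0"
      "Sub (Const 1) (Var (zv d))" w]
  have "ex (quiet X M w) (Assign (zv d) (Const 0) (Sub (Const 1) (Var (zv d)))) (?t, w) 1 (?u, w)"
    using FNot.prems by simp
  from ex_Seq[OF 1 this] show ?case by simp
next
  case (FAnd f g)
  let ?t = "upd s (zv d) 0 (if fval d f s then 1 else 0)"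
  have 1: "ex (quiet X M w) (cf d f) (s, w) (poly (fcost f) N) (?t, w)"
    by (intro FAnd.IH(1)) (use FAnd.prems in auto)
  have b: "bounded X M ?t" using ex_end[OF 1] by (simp add: quiet_def)
  have "zv d \<notin> fnames g" using FAnd.prems(1) by auto
  then have *: "fval d g ?t = fval d g s" by (intro fval_upd) auto
  have "ex (quiet X M w) (cf d g) (?t, w) (poly (fcost g) N)
     (upd ?t (zv d) 0 (if fval d g ?t then 1 else 0), w)"
    using FAnd.prems b by (intro FAnd.IH(2)) auto
  then have 2: "ex (quiet X M w) (cf d g) (?t, w) (poly (fcost g) N)
     (upd s (zv d) 0 (if fval d g s then 1 else 0), w)"
    unfolding * by (simp add: upd_def)
  have "ex (quiet X M w) (Cond (Less (Const 0) (Var (zv d))) (cf d g) Skip) (?t, w)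
    (poly (fcost g) N + 1) (upd s (zv d) 0 (if fval d (FAnd f g) s then 1 else 0), w)"
  proof (rule ex_Cond)
    show "ex (quiet X M w) (if bval (Less (Const 0) (Var (zv d))) (fst (?t, w)) then cf d g else Skip)
       (?t, w) (poly (fcost g) N) (upd s (zv d) 0 (if fval d (FAnd f g) s then 1 else 0), w)"
    proof (cases "fval d f s")
      case False
      have "ex (quiet X M w) Skip (?t, w) (poly (fcost g) N) (?t, w)"
        by (rule ex_mono[OF ex_Skip]) (use b in \<open>auto simp: quiet_def\<close>)
      with False show ?thesis by simp
    qed (use 2 in simp)
  qed
  from ex_Seq[OF 1 this] show ?case by (simp add: algebra_simps)
next
  case (FAll f)
  let ?q = "qv d" let ?z = "zv d" let ?z' = "zv (Suc d)"
  define F where "F i \<longleftrightarrow> fval (Suc d) f (upd s ?q 0 i)" for i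
  \<comment> \<open>After \<open>i\<close> rounds the result cell tells whether all vertices below
    \<open>i\<close> have passed.\<close>
  define b where "b i = (if \<forall>j<i. F j then 1 else 0 :: nat)" for i
  define st where "st i = upd (upd s ?q 0 i) ?z 0 (b i)" for i
  have b1: "b i \<le> M" for i using FAll.prems by (simp add: b_def)
  have bst: "bounded X M (st i)" if "i \<le> N" for i
    unfolding st_def using FAll.prems that b1[of i] by (intro bounded_upd) auto
  have body: "ex (quiet X M w)
     (Seq (cf (Suc d) f)
           (Seq (Cond (Less (Const 0) (Var ?z')) Skip (Assign ?z (Const 0) (Const 0)))
           (Seq (Assign ?z' (Const 0) (Const 0))
                (Assign ?q (Const 0) (Add (Var ?q) (Const 1)))))) (st i, w)
     (poly (fcost f) N + 7) (st (Suc i), w)" if i: "i < N" for i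
  proof -
    let ?v = "if F i then 1 else 0 :: nat"
    let ?s2 = "upd (st i) ?z' 0 ?v"
    let ?s3 = "upd ?s2 ?z 0 (b (Suc i))"
    let ?s4 = "upd ?s3 ?z' 0 0"
    have nz: "?z \<notin> fnames f" using FAll.prems(1) by auto
    have "fval (Suc d) f (st i) = F i"
      unfolding st_def F_def using nz by (intro fval_upd) auto
    moreover have "ex (quiet X M w) (cf (Suc d) f) (st i, w) (poly (fcost f) N)
       (upd (st i) ?z' 0 (if fval (Suc d) f (st i) then 1 else 0), w)"
      using FAll.prems bst[of i] i by (intro FAll.IH) (auto simp: st_def)
    ultimately have 1: "ex (quiet X M w) (cf (Suc d) f) (st i, w) (poly (fcost f) N) (?s2, w)"
      by simp
    have b2: "bounded X M ?s2" using ex_end[OF 1] by (simp add: quiet_def)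
    have 2: "ex (quiet X M w) (Cond (Less (Const 0) (Var ?z')) Skip (Assign ?z (Const 0) (Const 0)))
       (?s2, w) (1 + 1) (?s3, w)"
    proof (rule ex_Cond, cases "F i")
      case True
      then have "b (Suc i) = b i" by (auto simp: b_def less_Suc_eq)
      then have "?s3 = ?s2" by (auto simp: st_def fun_eq_iff upd_apply)
      moreover have "ex (quiet X M w) Skip (?s2, w) 1 (?s2, w)"
        by (rule ex_mono[OF ex_Skip]) (use b2 in \<open>auto simp: quiet_def\<close>)
      ultimately have "ex (quiet X M w) Skip (?s2, w) 1 (?s3, w)" by metis
      with True show "ex (quiet X M w) (if bval (Less (Const 0) (Var ?z')) (fst (?s2, w)) then Skip
         else Assign ?z (Const 0) (Const 0)) (?s2, w) 1 (?s3, w)" by simp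
    next
      case False
      then have "b (Suc i) = 0" by (auto simp: b_def)
      with ex_quiet_Assign[OF b2, of ?z 0 0 "Const 0" "Const 0" w] FAll.prems False
      show "ex (quiet X M w) (if bval (Less (Const 0) (Var ?z')) (fst (?s2, w)) then Skip
         else Assign ?z (Const 0) (Const 0)) (?s2, w) 1 (?s3, w)" by simp
    qed
    have b3: "bounded X M ?s3" using ex_end[OF 2] by (simp add: quiet_def)
    have 3: "ex (quiet X M w) (Assign ?z' (Const 0) (Const 0)) (?s3, w) 1 (?s4, w)"
      by (rule ex_quiet_Assign[OF b3]) (use FAll.prems(4) in auto)
    have b4: "bounded X M ?s4" using ex_end[OF 3] by (simp add: quiet_def)
    have "upd ?s4 ?q 0 (Suc i) = st (Suc i)"
      using FAll.prems(3) by (auto simp: st_def fun_eq_iff upd_apply)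
    then have 4: "ex (quiet X M w) (Assign ?q (Const 0) (Add (Var ?q) (Const 1))) (?s4, w) 1 (st (Suc i), w)"
      using ex_quiet_Assign[OF b4, of ?q 0 "Suc i" "Const 0" "Add (Var ?q) (Const 1)" w] FAll.prems i
      by (simp add: st_def)
    show ?thesis by (rule ex_mono[OF ex_Seq[OF 1 ex_Seq[OF 2 ex_Seq[OF 3 4]]]]) simp
  qed
  have "ex (quiet X M w) (While (Less (Var ?q) (Var ''n''))
     (Seq (cf (Suc d) f)
           (Seq (Cond (Less (Const 0) (Var ?z')) Skip (Assign ?z (Const 0) (Const 0)))
           (Seq (Assign ?z' (Const 0) (Const 0))
                (Assign ?q (Const 0) (Add (Var ?q) (Const 1)))))))
     (st 0, w) ((N - 0) * (poly (fcost f) N + 7 + 2) + 1) (st N, w)"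
    by (rule ex_counting[where f = "\<lambda>i. (st i, w)"])
      (use body bst FAll.prems in \<open>auto simp: quiet_def st_def\<close>)
  note loop = this
  let ?s1 = "upd s ?z 0 1"
  have 1: "ex (quiet X M w) (Assign ?z (Const 0) (Const 1)) (s, w) 1 (?s1, w)"
    using ex_quiet_Assign[of X M s ?z 0 1 "Const 0" "Const 1" w] FAll.prems by simp
  have b1: "bounded X M ?s1" using ex_end[OF 1] by (simp add: quiet_def)
  have "upd ?s1 ?q 0 0 = st 0" by (auto simp: st_def b_def fun_eq_iff upd_apply)
  then have 2: "ex (quiet X M w) (Assign ?q (Const 0) (Const 0)) (?s1, w) 1 (st 0, w)"
    using ex_quiet_Assign[OF b1, of ?q 0 0 "Const 0" "Const 0" w] FAll.prems by simp
  have "upd (st N) ?q 0 0 = upd s ?z 0 (if fval d (FAll f) s then 1 else 0)"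
    using FAll.prems(2,6) by (auto simp: st_def b_def F_def fun_eq_iff upd_apply)
  then have 3: "ex (quiet X M w) (Assign ?q (Const 0) (Const 0)) (st N, w) 1
     (upd s ?z 0 (if fval d (FAll f) s then 1 else 0), w)"
    using ex_quiet_Assign[OF bst[of N], of ?q 0 0 "Const 0" "Const 0" w] FAll.prems by simp
  show ?case unfolding cf.simps
    by (rule ex_mono[OF ex_Seq[OF 1 ex_Seq[OF 2 ex_Seq[OF loop 3]]]])
      (simp add: algebra_simps)
qed

text \<open>Compiled formulas leave their auxiliary variables at 0, so \<open>sem\<close> need not mention them.\<close>

definition clean :: "state \<Rightarrow> bool" where
  "clean s \<longleftrightarrow> (\<forall>x i. tmp x \<longrightarrow> s x i = 0)"

lemma clean_upd: "clean s \<Longrightarrow> \<not> tmp x \<Longrightarrow> clean (upd s x i k)"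
  unfolding clean_def by (auto simp: upd_apply)

lemma foldl_inv:
  "P s \<Longrightarrow> (\<And>s i. P s \<Longrightarrow> P (f s i)) \<Longrightarrow> P (foldl f s xs)"
  by (induction xs arbitrary: s) auto

lemma clean_sem: "wfc c \<Longrightarrow> clean s \<Longrightarrow> clean (sem c s)"
proof (induction c arbitrary: s)
  case (FFor x c)
  have "clean (foldl (\<lambda>s i. sem c (upd s x 0 i)) s [0..<s ''n'' 0])"
  proof (rule foldl_inv[where P = clean, OF FFor.prems(2)])
    show "clean (sem c (upd s x 0 i))" if "clean s" for s i
      using FFor.prems(1) that by (intro FFor.IH clean_upd) auto
  qed
  then show ?case unfolding sem.simps by (rule clean_upd) (use FFor.prems(1) in simp)
next
  case (FSet x a b)
  then show ?case unfolding sem.simps by (intro clean_upd) auto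
qed auto

lemma sem_other: "x \<notin> writes c \<Longrightarrow> sem c s x = s x"
proof (induction c arbitrary: s)
  case (FFor y c)
  have "foldl (\<lambda>s i. sem c (upd s y 0 i)) s [0..<s ''n'' 0] x = s x"
    by (rule foldl_inv[where P = "\<lambda>t. t x = s x"]) (use FFor in auto)
  with FFor.prems show ?case by simp
qed auto

lemma wfc_n: "wfc c \<Longrightarrow> ''n'' \<notin> writes c"
  by (induction c) auto

lemma sem_n: "wfc c \<Longrightarrow> sem c s ''n'' = s ''n''"
  by (simp add: sem_other wfc_n)

text \<open>The same bound \<open>M\<close> holds throughout: by \<open>wfc\<close> assignments
  store nothing larger, and loop counters never exceed \<open>N\<close>.\<close>

lemma cc_correct:
  assumes "wfc c" "clean s" "cwrites (cc c) \<subseteq> X" "bounded X M s" "s ''n'' 0 = N" "N + 1 \<le> M"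
  shows "ex (quiet X M w) (cc c) (s, w) (poly (cost c) N) (sem c s, w)"
  using assms
proof (induction c arbitrary: s)
  case (FSet x a b)
  have "aval a s \<le> 2 * M" using aval_asz[OF FSet(4), of a] FSet(1,6) 
    by (auto intro: order_trans)
  moreover have "aval b s \<le> M" using aval_vsafe[OF FSet(4), of b] FSet(1,6) by auto
  ultimately show ?case
    unfolding cc.simps sem.simps cost.simps poly_1
    by (intro ex_quiet_Assign[OF FSet(4)]) (use FSet(3) in auto)
next
  case (FSeq c1 c2)
  have 1: "ex (quiet X M w) (cc c1) (s, w) (poly (cost c1) N) (sem c1 s, w)" using FSeq by auto
  have "bounded X M (sem c1 s)" using ex_end[OF 1] by (simp add: quiet_def)
  then have "ex (quiet X M w) (cc c2) (sem c1 s, w) (poly (cost c2) N) (sem c2 (sem c1 s), w)"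
    using FSeq.prems by (intro FSeq.IH) (auto simp: clean_sem sem_n)
  from ex_Seq[OF 1 this] show ?case by simp
next
  case (FIf f c1 c2)
  let ?t = "upd s (zv 0) 0 (if fval 0 f s then 1 else 0)"
  have 1: "ex (quiet X M w) (cf 0 f) (s, w) (poly (fcost f) N) (?t, w)"
    using FIf.prems by (intro cf_correct) (auto simp: clean_def)
  have bt: "bounded X M ?t" using ex_end[OF 1] by (simp add: quiet_def)
  have s0: "upd ?t (zv 0) 0 0 = s" using FIf.prems(2) by (auto simp: clean_def fun_eq_iff upd_apply)
  have z: "zv 0 \<in> X"
  proof -
    have "zv d \<in> cwrites (cf d f)" for d by (induction f arbitrary: d) auto
    then show ?thesis using FIf.prems(3) by auto
  qed
  have "ex (quiet X M w) (Assign (zv 0) (Const 0) (Const 0)) (?t, w) 1 (s, w)"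
    using ex_quiet_Assign[OF bt z, of 0 0 "Const 0" "Const 0" w] unfolding s0
    by (simp del: One_nat_def split del: if_split)
  note 2 = ex_Seq[OF this]
  have "ex (quiet X M w) (Cond (Less (Const 0) (Var (zv 0))) (Seq (Assign (zv 0) (Const 0) (Const 0)) (cc c1)) (cc c2))
     (?t, w) (poly (cost c1) N + poly (cost c2) N + 2 + 1) (sem (FIf f c1 c2) s, w)"
  proof (rule ex_Cond, cases "fval 0 f s")
    case True
    have "ex (quiet X M w) (cc c1) (s, w) (poly (cost c1) N) (sem c1 s, w)" using FIf by auto
    from 2[OF this] True
    show "ex (quiet X M w) (if bval (Less (Const 0) (Var (zv 0))) (fst (?t, w)) 
      then Seq (Assign (zv 0) (Const 0) (Const 0)) (cc c1) else cc c2)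
      (?t, w) (poly (cost c1) N + poly (cost c2) N + 2) (sem (FIf f c1 c2) s, w)"
      by (auto intro: ex_mono)
  next
    case False
    then have "?t = s" using s0 by auto
    moreover have "ex (quiet X M w) (cc c2) (s, w) (poly (cost c2) N) (sem c2 s, w)" using FIf by auto
    then have "ex (quiet X M w) (cc c2) (s, w) (poly (cost c1) N + poly (cost c2) N + 2) (sem c2 s, w)"
      by (rule ex_mono) simp
    ultimately show "ex (quiet X M w) (if bval (Less (Const 0) (Var (zv 0))) (fst (?t, w)) 
      then Seq (Assign (zv 0) (Const 0) (Const 0)) (cc c1) else cc c2)
      (?t, w) (poly (cost c1) N + poly (cost c2) N + 2) (sem (FIf f c1 c2) s, w)"
      using False FIf.prems(2) by (simp add: clean_def)
  qed
  from ex_Seq[OF 1 this] show ?case unfolding cc.simps by (rule ex_mono) simp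
next
  case (FFor x c)
  define g where "g i = foldl (\<lambda>s i. sem c (upd s x 0 i)) s [0..<i]" for i
  define st where "st i = upd (g i) x 0 i" for i
  have xX: "x \<in> X" using FFor.prems by auto
  have wf: "\<not> tmp x" "x \<noteq> ''n''" "wfc c" "x \<notin> writes c" using FFor.prems(1) by auto
  have g: "clean (g i) \<and> g i ''n'' = s ''n''" for i unfolding g_def
  proof (rule foldl_inv[where P = "\<lambda>t. clean t \<and> t ''n'' = s ''n''"])
    fix t i assume "clean t \<and> t ''n'' = s ''n''"
    then show "clean (sem c (upd t x 0 i)) \<and> sem c (upd t x 0 i) ''n'' = s ''n''"
      using wf clean_sem[OF wf(3) clean_upd[of t x 0 i]] by (simp add: sem_n)
  qed (use FFor.prems(2) in simp)
  have cst: "clean (st i)" "st i ''n'' 0 = N" for i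
    using g[of i] wf clean_upd[of "g i" x 0 i] FFor.prems(5) by (auto simp: st_def)
  have gS: "g (Suc i) = sem c (st i)" for i unfolding g_def st_def by simp
  have bst: "bounded X M (st i)" if "i \<le> N" for i using that
  proof (induction i)
    case 0
    have "bounded X M (upd s x 0 0)" using FFor.prems xX by (intro bounded_upd) auto
    then show ?case by (simp add: st_def g_def)
  next
    case (Suc i)
    have "ex (quiet X M w) (cc c) (st i, w) (poly (cost c) N) (sem c (st i), w)"
      using FFor.prems Suc cst by (intro FFor.IH) auto
    then have "bounded X M (g (Suc i))" unfolding gS by (auto dest: ex_end simp: quiet_def)
    then show ?case unfolding st_def using Suc.prems FFor.prems xX by (intro bounded_upd) auto
  qed
  have body: "ex (quiet X M w) (Seq (cc c) (Assign x (Const 0) (Add (Var x) (Const 1)))) (st i, w)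
     (poly (cost c) N + 2) (st (Suc i), w)" if i: "i < N" for i
  proof -
    have 1: "ex (quiet X M w) (cc c) (st i, w) (poly (cost c) N) (g (Suc i), w)"
      unfolding gS using FFor.prems cst bst[of i] i by (intro FFor.IH) auto
    have b: "bounded X M (g (Suc i))" using ex_end[OF 1] by (simp add: quiet_def)
    have "g (Suc i) x = st i x" unfolding gS by (rule sem_other) (use FFor.prems in auto)
    then have "ex (quiet X M w) (Assign x (Const 0) (Add (Var x) (Const 1))) (g (Suc i), w) 1 (st (Suc i), w)"
      using ex_quiet_Assign[OF b xX, of 0 "Suc i" "Const 0" "Add (Var x) (Const 1)" w] FFor.prems i
      by (simp add: st_def)
    from ex_Seq[OF 1 this] show ?thesis by simp
  qed
  have loop: "ex (quiet X M w) (While (Less (Var x) (Var ''n''))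
     (Seq (cc c) (Assign x (Const 0) (Add (Var x) (Const 1)))))
     (st 0, w) ((N - 0) * (poly (cost c) N + 2 + 2) + 1) (st N, w)"
    by (rule ex_counting[where f = "\<lambda>i. (st i, w)"])
      (use body bst cst FFor.prems in \<open>auto simp: quiet_def\<close>, auto simp: st_def)
  have 1: "ex (quiet X M w) (Assign x (Const 0) (Const 0)) (s, w) 1 (st 0, w)"
    using ex_quiet_Assign[OF FFor.prems(4) xX, of 0 0 "Const 0" "Const 0" w] by (simp add: st_def g_def)
  have 2: "ex (quiet X M w) (Assign x (Const 0) (Const 0)) (st N, w) 1 (sem (FFor x c) s, w)"
    using ex_quiet_Assign[OF bst[of N] xX, of 0 0 "Const 0" "Const 0" w] FFor.prems(5)
    by (simp add: st_def g_def)
  show ?case unfolding cc.simps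
    by (rule ex_mono[OF ex_Seq[OF 1 ex_Seq[OF loop 2]]]) (simp add: algebra_simps)
qed

section \<open>Canonical orders of independent systems\<close>

text \<open>Of \<open>irr\<close> it is assumed only that it is hereditary and holds of the empty
  set. A guard looks only at what has been placed so far, and every vertex has one unguarded slot,
  so that the scan of \<open>J\<close> ends with exactly \<open>J\<close>.\<close>

locale scanning =
  fixes n T :: nat and tgt :: "nat \<Rightarrow> nat" and grd :: "nat \<Rightarrow> nat set \<Rightarrow> bool"
    and irr :: "nat set \<Rightarrow> bool"
  assumes irr_mono: "irr J \<Longrightarrow> I \<subseteq> J \<Longrightarrow> irr I"
    and irr_empty: "irr {}"
    and own: "u < n \<Longrightarrow> \<exists>k<T. tgt k = u \<and> (\<forall>S. grd k S)"
    and tgt_less: "k < T \<Longrightarrow> tgt k < n"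
begin

primrec scan :: "(nat set \<Rightarrow> nat \<Rightarrow> bool) \<Rightarrow> nat \<Rightarrow> nat set" where
  "scan C 0 = {}"
| "scan C (Suc k) =
     (let S = scan C k in if grd k S \<and> C S (tgt k) then insert (tgt k) S else S)"

definition pre :: "nat set \<Rightarrow> nat \<Rightarrow> nat set" where
  "pre J = scan (\<lambda>S u. u \<in> J)"

definition lb :: "nat set \<Rightarrow> nat \<Rightarrow> nat set" where
  "lb A = scan (\<lambda>S u. irr (insert u (S \<union> A)))"

abbreviation LB :: "nat set \<Rightarrow> nat set" where
  "LB A \<equiv> lb A T"

definition maxirr :: "nat set \<Rightarrow> bool" where
  "maxirr J \<longleftrightarrow> J \<subseteq> {..<n} \<and> irr J \<and> (\<forall>u<n. irr (insert u J) \<longrightarrow> u \<in> J)"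

text \<open>A lexicographic comparison at the first difference of the two scans: equal prefixes give
  equal guards, so only membership of the offered vertex can decide.\<close>

definition better :: "nat set \<Rightarrow> nat set \<Rightarrow> bool" where
  "better I J \<longleftrightarrow> (\<exists>k<T. pre I k = pre J k \<and> grd k (pre I k) \<and> tgt k \<in> I \<and> tgt k \<notin> J)"

definition has_parent :: "nat set \<Rightarrow> bool" where
  "has_parent J \<longleftrightarrow> (\<exists>k<T. LB (pre J k) \<noteq> J)"

text \<open>The last prefix whose completion is not yet \<open>J\<close>; the value is meaningful
  only under \<open>has_parent\<close>.\<close>

definition branch :: "nat set \<Rightarrow> nat" where
  "branch J = (GREATEST k. k < T \<and> LB (pre J k) \<noteq> J)"

definition parent :: "nat set \<Rightarrow> nat set" where
  "parent J = LB (pre J (branch J))"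

lemma scan_mono: "j \<le> k \<Longrightarrow> scan C j \<subseteq> scan C k"
  by (induction k) (auto simp: le_Suc_eq Let_def)

lemma scan_less: "k \<le> T \<Longrightarrow> scan C k \<subseteq> {..<n}"
  by (induction k) (auto simp: Let_def tgt_less)

lemmas pre_mono = scan_mono[of _ _ "\<lambda>S u. u \<in> J" for J, folded pre_def]
lemmas lb_mono = scan_mono[of _ _ "\<lambda>S u. irr (insert u (S \<union> A))" for A, folded lb_def]
lemmas lb_less = scan_less[of _ "\<lambda>S u. irr (insert u (S \<union> A))" for A, folded lb_def]

lemma pre_0 [simp]: "pre J 0 = {}"
  by (simp add: pre_def)

lemma pre_Suc: "pre J (Suc k) = (if grd k (pre J k) \<and> tgt k \<in> J then insert (tgt k) (pre J k) else pre J k)"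
  by (simp add: pre_def Let_def)

lemma lb_0 [simp]: "lb A 0 = {}"
  by (simp add: lb_def)

lemma lb_Suc: "lb A (Suc k) =
  (if grd k (lb A k) \<and> irr (insert (tgt k) (lb A k \<union> A)) then insert (tgt k) (lb A k) else lb A k)"
  by (simp add: lb_def Let_def)

lemma pre_subset: "pre J k \<subseteq> J"
  by (induction k) (auto simp: pre_Suc)

lemma pre_all: "J \<subseteq> {..<n} \<Longrightarrow> pre J T = J"
proof (intro equalityI subsetI)
  fix u assume "J \<subseteq> {..<n}" "u \<in> J"
  then obtain k where k: "k < T" "tgt k = u" "\<forall>S. grd k S" using own by blast
  then have "u \<in> pre J (Suc k)" using \<open>u \<in> J\<close> by (simp add: pre_Suc)
  then show "u \<in> pre J T" using pre_mono[of "Suc k" T J] k(1) by auto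
qed (use pre_subset in blast)

lemma irr_lb: "irr A \<Longrightarrow> irr (lb A k \<union> A)"
  by (induction k) (auto simp: lb_Suc)

text \<open>At the unguarded slot of \<open>u\<close> the placed set was smaller, so by heredity
  \<open>u\<close> passed the greedy test there.\<close>

lemma lb_addable: "u < n \<Longrightarrow> irr (insert u (LB A \<union> A)) \<Longrightarrow> u \<in> LB A"
proof -
  assume u: "u < n" and i: "irr (insert u (LB A \<union> A))"
  then obtain k where k: "k < T" "tgt k = u" "\<forall>S. grd k S" using own by blast
  have "irr (insert u (lb A k \<union> A))"
    by (rule irr_mono[OF i]) (use lb_mono[of k T A] k(1) in auto)
  then have "u \<in> lb A (Suc k)" using k by (simp add: lb_Suc)
  then show "u \<in> LB A" using lb_mono[of "Suc k" T A] k(1) by auto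
qed

lemma LB_superset: "irr A \<Longrightarrow> A \<subseteq> {..<n} \<Longrightarrow> A \<subseteq> LB A"
  using lb_addable irr_lb[of A T] by (metis Un_insert_right insert_absorb lessThan_iff subsetD subsetI)

lemma maxirr_LB: "irr A \<Longrightarrow> A \<subseteq> {..<n} \<Longrightarrow> maxirr (LB A)"
  using LB_superset[of A] irr_lb[of A T] lb_addable[of _ A] lb_less[of T A] unfolding maxirr_def
  by (simp add: sup.absorb1)

text \<open>Replaying the scan with the finished set repeats the greedy decisions: by heredity, a
  vertex that ends up in \<open>LB A\<close> passes the test whenever it is offered.\<close>

lemma pre_LB: "irr A \<Longrightarrow> A \<subseteq> {..<n} \<Longrightarrow> k \<le> T \<Longrightarrow> pre (LB A) k = lb A k"
proof (induction k)
  case (Suc k)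
  have *: "irr (insert (tgt k) (lb A k \<union> A))" if "tgt k \<in> LB A"
  proof (rule irr_mono)
    show "irr (LB A)" using maxirr_LB Suc.prems by (simp add: maxirr_def)
    show "insert (tgt k) (lb A k \<union> A) \<subseteq> LB A"
      using that LB_superset[of A] lb_mono[of k T A] Suc.prems by auto
  qed
  have "tgt k \<in> LB A" if "grd k (lb A k)" "irr (insert (tgt k) (lb A k \<union> A))"
    using lb_mono[of "Suc k" T A] that Suc.prems by (auto simp: lb_Suc)
  with * Suc show ?case by (auto simp: pre_Suc lb_Suc)
qed simp

text \<open>At the first slot where the scan of \<open>J\<close> departs from the greedy one, the
  target is not in \<open>J\<close>; otherwise heredity from \<open>J\<close> would make the greedy
  scan place it as well.\<close>

lemma LB_best:
  assumes "irr J" "A \<subseteq> J" "J \<subseteq> {..<n}" "J \<noteq> LB A"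
  shows "better (LB A) J"
proof -
  have irrA: "irr A" "A \<subseteq> {..<n}" using assms irr_mono by auto
  define k where "k = (LEAST k. pre J k \<noteq> lb A k)"
  have ne: "pre J T \<noteq> lb A T" using pre_all[OF assms(3)] assms(4) by simp
  have k: "pre J k \<noteq> lb A k" "\<And>j. j < k \<Longrightarrow> pre J j = lb A j"
    unfolding k_def using ne by (rule LeastI) (use not_less_Least in blast)
  moreover have "k \<le> T"
  proof (rule ccontr)
    assume "\<not> k \<le> T"
    then have "pre J T = lb A T" using k(2)[of T] by simp
    then show False using pre_all[OF assms(3)] assms(4) by simp
  qed
  ultimately obtain j where j: "k = Suc j" "j < T" "pre J j = lb A j"
    by (metis Suc_le_eq lessI lb_0 not0_implies_Suc pre_0)
  let ?u = "tgt j"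
  have g: "grd j (lb A j)" using j k(1) by (auto simp: pre_Suc lb_Suc)
  have a: "irr (insert ?u (lb A j \<union> A))" if "?u \<in> J"
    by (rule irr_mono[OF assms(1)]) (use that assms j(3) pre_subset[of J j] in auto)
  have u: "?u \<notin> J" using a g j k(1) by (auto simp: pre_Suc lb_Suc)
  with g j k(1) have "?u \<in> lb A (Suc j)" by (auto simp: pre_Suc lb_Suc split: if_splits)
  then have "?u \<in> LB A" using lb_mono[of "Suc j" T A] j by auto
  with u g j show ?thesis unfolding better_def using pre_LB[OF irrA, of j] by auto
qed

lemma LB_maxirr: "maxirr J \<Longrightarrow> LB J = J"
proof -
  assume J: "maxirr J"
  then have "J \<subseteq> LB J" "maxirr (LB J)" using LB_superset maxirr_LB by (auto simp: maxirr_def)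
  moreover have "u \<in> J" if "u \<in> LB J" for u
  proof -
    have "irr (insert u J)" by (rule irr_mono[of "LB J"]) (use calculation that in \<open>auto simp: maxirr_def\<close>)
    then show ?thesis using J that calculation by (auto simp: maxirr_def)
  qed
  ultimately show ?thesis by blast
qed

text \<open>A first difference is permanent. Prefixes, and hence guards, agree before it, so one
  scan places a vertex that the other set does not contain at all.\<close>

lemma pre_agree: "pre I k = pre J k \<Longrightarrow> j \<le> k \<Longrightarrow> pre I j = pre J j"
proof (induction k)
  case (Suc k)
  have "pre I k = pre J k"
  proof (rule ccontr)
    assume ne: "pre I k \<noteq> pre J k"
    define j where "j = (LEAST j. pre I j \<noteq> pre J j)"
    have j: "pre I j \<noteq> pre J j" "\<And>i. i < j \<Longrightarrow> pre I i = pre J i"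
      unfolding j_def using ne by (rule LeastI) (use not_less_Least in blast)
    then obtain i where i: "j = Suc i" "pre I i = pre J i" by (cases j) auto
    have "Suc i \<le> Suc k" using j(2)[of k] ne i by (metis Suc_leI le_SucI not_less)
    then have "pre I (Suc i) \<subseteq> J" "pre J (Suc i) \<subseteq> I"
      using pre_mono[of "Suc i" "Suc k"] Suc.prems pre_subset by (metis order_trans)+
    then show False using j(1) i by (auto simp: pre_Suc split: if_splits)
  qed
  with Suc show ?case by (auto simp: le_Suc_eq)
qed simp

lemma better_irrefl: "\<not> better J J"
  by (auto simp: better_def)

lemma better_trans:
  assumes "better I J" "better J K" shows "better I K"
proof -
  from assms(1) obtain i where i: "i < T" "pre I i = pre J i" "grd i (pre I i)" "tgt i \<in> I" "tgt i \<notin> J"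
    by (auto simp: better_def)
  from assms(2) obtain j where j: "j < T" "pre J j = pre K j" "grd j (pre J j)" "tgt j \<in> J" "tgt j \<notin> K"
    by (auto simp: better_def)
  consider "i < j" | "j < i" | "i = j" by linarith
  then show ?thesis
  proof cases
    case 1
    have "pre J (Suc i) = pre K (Suc i)" "pre J i = pre K i" using pre_agree[OF j(2)] 1 by auto
    then have "tgt i \<notin> K" using i pre_subset[of J "Suc i"] by (auto simp: pre_Suc split: if_splits)
    then show ?thesis using i \<open>pre J i = pre K i\<close> by (auto simp: better_def)
  next
    case 2
    have "pre I (Suc j) = pre J (Suc j)" "pre I j = pre J j" using pre_agree[OF i(2)] 2 by auto
    then have "tgt j \<in> I" using j pre_subset[of I "Suc j"] by (auto simp: pre_Suc split: if_splits)
    then show ?thesis using j \<open>pre I j = pre J j\<close> by (auto simp: better_def)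
  qed (use i j in auto)
qed

text \<open>The last conclusion makes children recoverable. By maximality of \<open>k\<close>,
  \<open>J\<close> completes the prefix with the target of slot \<open>k\<close> added, so it is the
  best irredundant superset of that set. A rival \<open>R\<close> first differs from
  \<open>J\<close> at a slot where \<open>J\<close> places a vertex missing from \<open>R\<close>,
  and such a slot lies after \<open>k\<close>.\<close>

lemma branch:
  assumes "maxirr J" "has_parent J"
  defines "k \<equiv> branch J"
  shows "k < T" "parent J \<noteq> J" "grd k (pre J k)" "tgt k \<in> J" "tgt k \<notin> pre J k"
    "maxirr (parent J)" "better (parent J) J" "pre J k \<subseteq> parent J"
    "\<And>R. irr R \<Longrightarrow> insert (tgt k) (pre J k) \<subseteq> R \<Longrightarrow> R \<subseteq> {..<n} \<Longrightarrow>
       pre R (Suc k) = insert (tgt k) (pre J k) \<and> LB (insert (tgt k) (pre J k)) = J"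
proof -
  let ?Q = "\<lambda>k. k < T \<and> LB (pre J k) \<noteq> J"
  have "\<exists>k. ?Q k" using assms(2) by (auto simp: has_parent_def)
  then have k: "?Q k" unfolding k_def branch_def by (rule GreatestI_ex_nat[where b = T]) auto
  have after: "LB (pre J (Suc k)) = J"
  proof (cases "Suc k < T")
    case True
    show ?thesis
    proof (rule ccontr)
      assume "LB (pre J (Suc k)) \<noteq> J"
      then have "Suc k \<le> k" unfolding k_def branch_def using True
        by (intro Greatest_le_nat[where b = T]) (auto simp: k_def branch_def)
      then show False by simp
    qed
  next
    case False
    then have "Suc k = T" using k by simp
    then show ?thesis using pre_all LB_maxirr assms(1) by (simp add: maxirr_def)
  qed
  show kT: "k < T" and ne: "parent J \<noteq> J" using k by (auto simp: parent_def k_def)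
  show g: "grd k (pre J k)" "tgt k \<in> J" "tgt k \<notin> pre J k"
  proof -
    have ne: "pre J (Suc k) \<noteq> pre J k" using k after by metis
    then show "grd k (pre J k)" "tgt k \<in> J" by (auto simp: pre_Suc split: if_splits)
    then show "tgt k \<notin> pre J k" using ne by (auto simp: pre_Suc insert_absorb)
  qed
  have J: "irr J" "J \<subseteq> {..<n}" using assms(1) by (auto simp: maxirr_def)
  have p: "irr (pre J k)" "pre J k \<subseteq> {..<n}"
    using irr_mono[OF J(1) pre_subset] pre_subset[of J k] J(2) by auto
  show "maxirr (parent J)" unfolding parent_def k_def[symmetric] using maxirr_LB p .
  show "better (parent J) J" unfolding parent_def k_def[symmetric]
    using LB_best[OF J(1) pre_subset J(2)] k by auto
  show "pre J k \<subseteq> parent J" unfolding parent_def k_def[symmetric] using LB_superset p .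
  fix R assume R: "irr R" "insert (tgt k) (pre J k) \<subseteq> R" "R \<subseteq> {..<n}"
  have e: "pre J (Suc k) = insert (tgt k) (pre J k)" using g by (simp add: pre_Suc)
  have "pre R (Suc k) = pre J (Suc k)"
  proof (cases "R = J")
    case False
    have "better J R" using LB_best[OF R(1) _ R(3), of "pre J (Suc k)"] R(2) e after False by simp
    then obtain j where j: "j < T" "pre J j = pre R j" "grd j (pre J j)" "tgt j \<in> J" "tgt j \<notin> R"
      by (auto simp: better_def)
    have "\<not> j \<le> k"
    proof
      assume "j \<le> k"
      then have "pre J (Suc j) \<subseteq> R" using pre_mono[of "Suc j" "Suc k" J] e R(2) by auto
      then show False using j by (auto simp: pre_Suc)
    qed
    then show ?thesis using pre_agree[OF j(2), of "Suc k"] by simp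
  qed simp
  then show "pre R (Suc k) = insert (tgt k) (pre J k) \<and> LB (insert (tgt k) (pre J k)) = J"
    using e after by simp
qed

text \<open>\<open>LB {}\<close> is the best irredundant set, so it cannot have a parent, which
  would be better still. For any other maximal set the empty prefix at slot 0 already witnesses a
  parent.\<close>

lemma has_parent_iff: "maxirr J \<Longrightarrow> has_parent J \<longleftrightarrow> J \<noteq> LB {}"
proof
  assume J: "maxirr J" "has_parent J"
  have "better (LB {}) (parent J)" if "parent J \<noteq> LB {}"
    using LB_best[of "parent J" "{}"] branch(6)[OF J] that by (auto simp: maxirr_def)
  then have "better (LB {}) J"
    using branch(7)[OF J] better_trans by metis
  then show "J \<noteq> LB {}" using better_irrefl by auto
next
  assume J: "maxirr J" "J \<noteq> LB {}"
  have "0 < T"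
  proof (rule ccontr)
    assume "\<not> 0 < T"
    then have "n = 0" using own by (metis gr0I less_zeroE)
    moreover have "J \<subseteq> {..<n}" using J(1) by (simp add: maxirr_def)
    ultimately have "J = {}" "LB {} = {}" using lb_less[of T "{}"] by auto
    then show False using J(2) by simp
  qed
  then show "has_parent J" using J by (auto simp: has_parent_def)
qed

end

section \<open>Graphs with a strong ordering\<close>

locale graph =
  fixes n :: nat and adj :: "nat \<Rightarrow> nat \<Rightarrow> bool"
  assumes adj_sym: "adj a b \<Longrightarrow> adj b a"
    and adj_irrefl: "\<not> adj a a"
    and adj_less: "adj a b \<Longrightarrow> a < n"
begin

definition cadj :: "nat \<Rightarrow> nat \<Rightarrow> bool" where
  "cadj a b \<longleftrightarrow> a = b \<or> adj a b"

lemma cadj_sym: "cadj a b \<Longrightarrow> cadj b a"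
  by (auto simp: cadj_def adj_sym)

lemma cadj_refl [simp]: "cadj a a"
  by (simp add: cadj_def)

definition pvt :: "nat \<Rightarrow> nat set \<Rightarrow> nat \<Rightarrow> bool" where
  "pvt x I y \<longleftrightarrow> cadj x y \<and> (\<forall>z\<in>I. cadj y z \<longrightarrow> z = x)"

definition irr :: "nat set \<Rightarrow> bool" where
  "irr I \<longleftrightarrow> (\<forall>x\<in>I. \<exists>y. pvt x I y)"

lemma irr_mono: "irr J \<Longrightarrow> I \<subseteq> J \<Longrightarrow> irr I"
  unfolding irr_def pvt_def by blast

text \<open>Adding \<open>u\<close> to \<open>I\<close> would destroy every private neighbour of
  \<open>z\<close>, so \<open>z\<close> can stay only if other elements are dropped to free a new
  one.\<close>

definition doomed :: "nat set \<Rightarrow> nat \<Rightarrow> nat \<Rightarrow> bool" where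
  "doomed I u z \<longleftrightarrow> (\<forall>y. pvt z I y \<longrightarrow> cadj u y)"

text \<open>The pairs in \<open>L\<close> consist of an element of the solution and a private neighbour that it keeps
  when \<open>u\<close> is added.\<close>

definition cand :: "nat set \<Rightarrow> nat \<Rightarrow> (nat \<times> nat) set \<Rightarrow> nat set" where
  "cand I u L = {z \<in> insert u I. (\<forall>(t, f) \<in> L. cadj f z \<longrightarrow> z = t) \<and> (z \<in> fst ` L \<or> \<not> doomed I u z)}"

text \<open>An element listed in \<open>L\<close> keeps its partner as private neighbour, because
  everything else that the partner sees is removed. An unlisted one has a private neighbour in
  \<open>I\<close> that \<open>u\<close> does not see, and removing elements cannot spoil it. The
  elements of \<open>S\<close> pass the filter since the partners are private with respect to
  \<open>insert u S\<close>.\<close>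

lemma cand:
  assumes "S \<subseteq> I" "irr I"
    and L: "fst ` L = insert u {z \<in> S. doomed I u z}" "\<And>t f. (t, f) \<in> L \<Longrightarrow> pvt t (insert u S) f"
  shows "insert u S \<subseteq> cand I u L" "irr (cand I u L)"
proof -
  show sub: "insert u S \<subseteq> cand I u L"
    using assms by (fastforce simp: cand_def pvt_def)
  show "irr (cand I u L)" unfolding irr_def
  proof
    fix z assume z: "z \<in> cand I u L"
    show "\<exists>y. pvt z (cand I u L) y"
    proof (cases "z \<in> fst ` L")
      case True
      then obtain f where f: "(z, f) \<in> L" by auto
      have "pvt z (cand I u L) f" unfolding pvt_def
        using L(2)[OF f] f by (auto simp: cand_def pvt_def)
      then show ?thesis by blast
    next
      case False
      then have "z \<in> I" "\<not> doomed I u z" "z \<noteq> u" using z L(1) by (auto simp: cand_def)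
      then obtain y where "pvt z I y" "\<not> cadj u y" by (auto simp: doomed_def)
      then have "pvt z (cand I u L) y" 
        by (auto simp: pvt_def cand_def dest: cadj_sym)
      then show ?thesis by blast
    qed
  qed
qed

text \<open>In the slot \<open>slot v r\<close> the neighbour \<open>r\<close> of \<open>v\<close> may be placed if \<open>r < n\<close>, and \<open>v\<close> itself if \<open>r = n\<close>.\<close>

definition slot :: "nat \<Rightarrow> nat \<Rightarrow> nat" where
  "slot v r = v * Suc n + r"

definition tgt :: "nat \<Rightarrow> nat" where
  "tgt k = (if k mod Suc n < n then k mod Suc n else k div Suc n)"

definition grd :: "nat \<Rightarrow> nat set \<Rightarrow> bool" where
  "grd k S \<longleftrightarrow> (k mod Suc n < n \<longrightarrow>
     adj (k div Suc n) (k mod Suc n) \<and> (\<forall>w\<in>S. \<not> adj (k div Suc n) w))"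

lemma slot_div_mod: "r \<le> n \<Longrightarrow> slot v r div Suc n = v" "r \<le> n \<Longrightarrow> slot v r mod Suc n = r"
  by (auto simp: slot_def simp del: mult_Suc_right)

lemma slot_less: "r \<le> n \<Longrightarrow> r' \<le> n \<Longrightarrow> slot v r < slot v' r' \<longleftrightarrow> v < v' \<or> (v = v' \<and> r < r')"
proof -
  assume r: "r \<le> n" "r' \<le> n"
  have *: "slot v r < slot v' r'" if "v < v'" "r \<le> n" for v v' r r'
  proof -
    have "v * Suc n + r < Suc v * Suc n" using that by simp
    also have "\<dots> \<le> v' * Suc n" using that by (intro mult_le_mono1) simp
    finally show ?thesis by (simp add: slot_def)
  qed
  consider "v < v'" | "v' < v" | "v = v'" by linarith
  then show ?thesis by cases (use *[of v v' r r'] *[of v' v r' r] r in \<open>auto simp: slot_def\<close>)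
qed

lemma slot_bound: "v < n \<Longrightarrow> r \<le> n \<Longrightarrow> slot v r < n * Suc n"
  using slot_less[of r 0 v n] by (simp add: slot_def)

lemma slot_exists: "\<exists>v r. k = slot v r \<and> r \<le> n"
  by (rule exI[of _ "k div Suc n"], rule exI[of _ "k mod Suc n"])
    (simp add: slot_def less_Suc_eq_le[symmetric] del: mult_Suc_right)

lemma tgt_slot: "r < n \<Longrightarrow> tgt (slot v r) = r" "tgt (slot v n) = v"
  by (auto simp: tgt_def slot_div_mod)

lemma grd_slot: "r < n \<Longrightarrow> grd (slot v r) S \<longleftrightarrow> adj v r \<and> (\<forall>w\<in>S. \<not> adj v w)" "grd (slot v n) S"
  by (auto simp: grd_def slot_div_mod)

sublocale scanning n "n * Suc n" tgt grd irr
proof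
  show "irr {}" by (simp add: irr_def)
  show "\<exists>k<n * Suc n. tgt k = u \<and> (\<forall>S. grd k S)" if "u < n" for u
    using that slot_bound[of u n] tgt_slot grd_slot by (intro exI[of _ "slot u n"]) simp
  show "tgt k < n" if "k < n * Suc n" for k
    using that by (auto simp: tgt_def div_less_iff_less_mult)
qed (rule irr_mono)

lemma placed:
  assumes "z \<in> pre J k"
  obtains g where "g < k" "tgt g = z" "z \<notin> pre J g" "grd g (pre J g)"
proof -
  from assms have "\<exists>g<k. tgt g = z \<and> z \<notin> pre J g \<and> grd g (pre J g)"
  proof (induction k)
    case (Suc k)
    then show ?case
      by (cases "z \<in> pre J k") (auto simp: pre_Suc intro: less_SucI split: if_splits)
  qed simp
  then show thesis using that by blast
qed

lemma placed_cases:
  assumes "z \<in> pre J k" "J \<subseteq> {..<n}"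
  obtains (own) "slot z n < k" "z \<notin> pre J (slot z n)"
  | (col) g where "slot g z < k" "adj g z" "\<forall>w\<in>pre J (slot g z). \<not> adj g w" "z \<notin> pre J (slot g z)"
proof -
  obtain g where g: "g < k" "tgt g = z" "z \<notin> pre J g" "grd g (pre J g)" using placed assms by blast
  obtain v r where v: "g = slot v r" "r \<le> n" using slot_exists by blast
  show thesis
  proof (cases "r = n")
    case True
    then show ?thesis using own g v by (simp add: tgt_slot)
  next
    case False
    then show ?thesis using col[of v] g v by (simp add: tgt_slot grd_slot)
  qed
qed

lemma own_done: "slot v n < k \<Longrightarrow> v \<in> J \<Longrightarrow> v \<in> pre J k"
  using pre_mono[of "Suc (slot v n)" k J] by (auto simp: pre_Suc tgt_slot grd_slot)

text \<open>Either the slot places \<open>w\<close>, or its guard fails because a neighbour of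
  \<open>g\<close> has been placed before.\<close>

lemma col_done:
  assumes "slot g w < k" "adj g w" "w \<in> J"
  shows "\<exists>x\<in>pre J k. adj g x"
proof -
  have w: "w < n" using assms adj_sym adj_less by blast
  have "\<exists>x\<in>pre J (Suc (slot g w)). adj g x"
    using assms w by (cases "grd (slot g w) (pre J (slot g w))") (auto simp: pre_Suc tgt_slot grd_slot)
  then show ?thesis using pre_mono[of "Suc (slot g w)" k J] assms by auto
qed

text \<open>A smaller neighbour of \<open>g\<close> in \<open>J\<close> would have been offered
  earlier in the same column and, by \<open>col_done\<close>, would have closed the column for
  \<open>z\<close>.\<close>

lemma col_min:
  assumes "\<forall>x\<in>pre J (slot g z). \<not> adj g x" "adj g w" "w \<in> J" "z \<le> n"
  shows "z \<le> w"
proof (rule ccontr)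
  assume "\<not> z \<le> w"
  then have "slot g w < slot g z" using assms by (simp add: slot_less)
  then show False using col_done[of g w "slot g z" J] assms by blast
qed

end

locale strong_graph = graph +
  assumes strong: "adj i k \<Longrightarrow> adj i l \<Longrightarrow> adj j k \<Longrightarrow> j < i \<Longrightarrow> l < k \<Longrightarrow> cadj j l"
begin

lemma card_le_1I: "(\<And>x y. x \<in> A \<Longrightarrow> y \<in> A \<Longrightarrow> x = y) \<Longrightarrow> card A \<le> 1"
  by (metis One_nat_def card.empty card.infinite is_singletonI' is_singleton_altdef le_SucI le_refl less_nat_zero_code
      nle_le not_less_eq_eq)

text \<open>In the application \<open>k\<close> is the branching slot of \<open>J\<close> and
  \<open>I\<close> its parent. A doomed element has a private neighbour with respect to
  \<open>I\<close>, which \<open>u\<close> sees and which is also private with respect to the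
  prefix. Its position and the slot where the element was placed leave four classes, each with at
  most one member.\<close>

lemma few_doomed:
  assumes "k < n * Suc n" "J \<subseteq> {..<n}" "tgt k \<in> J" "tgt k \<notin> pre J k" "grd k (pre J k)"
    "pre J k \<subseteq> I" "irr I"
  shows "card {z \<in> pre J k. doomed I (tgt k) z} \<le> 4"
proof -
  define S u where "S = pre J k" and "u = tgt k"
  note defs = S_def u_def
  obtain v r where k: "k = slot v r" "r \<le> n" using slot_exists by blast
  have u: "u \<in> J" "u \<notin> S" "u < n" and SJ: "S \<subseteq> J" and SV: "S \<subseteq> {..<n}"
    using assms pre_subset[of J k] by (auto simp: defs)
  define leg where "leg z p \<longleftrightarrow> cadj u p \<and> cadj p z \<and> (\<forall>w\<in>S. cadj p w \<longrightarrow> w = z)" for z p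
  txt \<open>A private neighbour \<open>p\<close> of a doomed \<open>z\<close> is \<open>u\<close> itself (\<open>C\<close>), or distinct from \<open>z\<close>, in which case \<open>z < u\<close> (\<open>A\<close>)
    or \<open>z\<close> was placed in the column \<open>u\<close> (\<open>G\<close>), or \<open>p = z\<close>, in which case \<open>z\<close> was placed in the column \<open>u\<close> or
    in a column outside \<open>J\<close> (\<open>B\<close>).\<close>
  define A where "A = {z \<in> S. z < u \<and> (\<exists>p. leg z p \<and> adj p u \<and> adj p z)}"
  define G where "G = {z \<in> S. adj u z \<and> slot u z < k \<and> (\<forall>w\<in>pre J (slot u z). \<not> adj u w) \<and> z \<notin> pre J (slot u z)}"
  define B where "B = {z \<in> S. adj z u \<and> (\<exists>g. g \<notin> J \<and> g < u \<and> slot g z < k \<and> adj g z \<and>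
     (\<forall>w\<in>pre J (slot g z). \<not> adj g w) \<and> z \<notin> pre J (slot g z))}"
  define C where "C = {z \<in> S. leg z u}"
  have early: "z \<notin> pre J (slot g z) \<Longrightarrow> z \<in> pre J j \<Longrightarrow> slot g z < j" for z g j
    using pre_mono[of j "slot g z" J] by (meson not_less subsetD)
  \<comment> \<open>The vertex placed by a neighbour slot is the least neighbour of that column in
    \<open>J\<close>, hence unique.\<close>
  have once: "z = z'" if "adj g z" "adj g z'" "\<forall>w\<in>pre J (slot g z). \<not> adj g w"
    "\<forall>w\<in>pre J (slot g z'). \<not> adj g w" "z \<in> S" "z' \<in> S" for g z z'
    using col_min[of J g z z'] col_min[of J g z' z] that SJ SV by (metis antisym lessThan_iff less_imp_le subsetD)
  \<comment> \<open>Of two private neighbours let \<open>p\<close> be the larger: the edges from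
    \<open>p\<close> to \<open>u\<close> and \<open>z\<close> and from \<open>p'\<close> to
    \<open>u\<close>, with \<open>p' < p\<close> and \<open>z < u\<close>, force \<open>p'\<close>
    to see \<open>z\<close>, although \<open>p'\<close> is private to \<open>z'\<close>.\<close>
  have cA: "card A \<le> 1"
  proof (rule card_le_1I)
    have *: "z = z'" if z: "z \<in> S" "z < u" "leg z p" "adj p u" "adj p z"
      and z': "leg z' p'" "adj p' u" and "p' \<le> p" for z p z' p'
    proof (cases "p = p'")
      case False
      then have "p' < p" using \<open>p' \<le> p\<close> by simp
      from strong[OF z(4,5) z'(2) this z(2)] have "cadj p' z" .
      then show ?thesis using z(1) z'(1) unfolding leg_def by blast
    next
      case True
      then show ?thesis using z(1,3) z'(1) unfolding leg_def by blast
    qed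
    fix z z' assume "z \<in> A" "z' \<in> A"
    then obtain p p' where a: "z \<in> S" "z < u" "leg z p" "adj p u" "adj p z"
        and b: "z' \<in> S" "z' < u" "leg z' p'" "adj p' u" "adj p' z'" unfolding A_def by blast
    show "z = z'"
    proof (cases "p' \<le> p")
      case True
      show ?thesis by (rule *[OF a b(3,4) True])
    next
      case False
      then have "p \<le> p'" by simp
      from *[OF b a(3,4) this] show ?thesis by simp
    qed
  qed
  have cG: "card G \<le> 1"
  proof (rule card_le_1I)
    fix z z' assume "z \<in> G" "z' \<in> G"
    then show "z = z'" unfolding G_def using once[of u z z'] by blast
  qed
  \<comment> \<open>Both elements are neighbours of \<open>u\<close>, and their columns lie below
    \<open>u\<close>. Let \<open>g < g'\<close>. If \<open>z' < z\<close>, the strong ordering makes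
    \<open>z'\<close> a neighbour of \<open>g\<close>, so \<open>z\<close> was not the least one. If
    \<open>z < z'\<close>, it makes \<open>z\<close> a neighbour of \<open>g'\<close>; but
    \<open>z\<close> was placed earlier and closes the column \<open>g'\<close>.\<close>
  have cB: "card B \<le> 1"
  proof (rule card_le_1I)
    have *: "z = z'" if z: "z \<in> S" "adj z u" "g \<notin> J" "g < u" "slot g z < k" "adj g z"
        "\<forall>w\<in>pre J (slot g z). \<not> adj g w" "z \<notin> pre J (slot g z)"
      and z': "z' \<in> S" "adj z' u" "g' \<notin> J" "g' < u" "slot g' z' < k" "adj g' z'"
        "\<forall>w\<in>pre J (slot g' z'). \<not> adj g' w" "z' \<notin> pre J (slot g' z')" and "g \<le> g'" for z z' g g'
    proof (cases "g = g'")
      case True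
      show ?thesis by (rule once[of g]) (use z(1,6,7) z'(1,6,7) True in blast)+
    next
      case False
      have less: "z < n" "z' < n" "z \<in> J" "z' \<in> J" using z(1) z'(1) SV SJ by auto
      show ?thesis
      proof (rule ccontr)
        assume ne: "z \<noteq> z'"
        show False
        proof (cases "z' < z")
          case True
          have "cadj g z'" by (rule strong[OF adj_sym[OF z(2)] adj_sym[OF z'(2)] z(6,4) True])
          then have "adj g z'" using less z(3) by (auto simp: cadj_def)
          then have "z \<le> z'" using col_min[OF z(7) _ less(4)] less(1) by simp
          then show False using True by simp
        next
          case f: False
          have lt: "z < z'" using f ne by simp
          have "cadj g' z" by (rule strong[OF adj_sym[OF z'(2)] adj_sym[OF z(2)] z'(6,4) lt])
          then have "adj g' z" using less z'(3) by (auto simp: cadj_def)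
          moreover have "slot g z < slot g' z'" using False \<open>g \<le> g'\<close> less by (simp add: slot_less)
          moreover have "z \<in> pre J (Suc (slot g z))"
            using z(6,7) less by (simp add: pre_Suc tgt_slot grd_slot)
          ultimately show False using z'(7) pre_mono[of "Suc (slot g z)" "slot g' z'" J]
            \<open>slot g z < slot g' z'\<close> by (meson Suc_leI subsetD)
        qed
      qed
    qed
    fix z z' assume a: "z \<in> B" "z' \<in> B"
    then obtain g g' where a: "z \<in> S" "adj z u" "g \<notin> J" "g < u" "slot g z < k" "adj g z"
        "\<forall>w\<in>pre J (slot g z). \<not> adj g w" "z \<notin> pre J (slot g z)"
        and b: "z' \<in> S" "adj z' u" "g' \<notin> J" "g' < u" "slot g' z' < k" "adj g' z'"
        "\<forall>w\<in>pre J (slot g' z'). \<not> adj g' w" "z' \<notin> pre J (slot g' z')"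
      unfolding B_def by blast
    show "z = z'"
    proof (cases "g \<le> g'")
      case True
      show ?thesis by (rule *[OF a b True])
    next
      case False
      then have "g' \<le> g" by simp
      from *[OF b a this] show ?thesis by simp
    qed
  qed
  \<comment> \<open>Here \<open>u\<close> itself serves as private neighbour and so determines the
    element.\<close>
  have cC: "card C \<le> 1"
    by (rule card_le_1I) (auto simp: C_def leg_def)
  have cover: "{z \<in> S. doomed I u z} \<subseteq> A \<union> G \<union> B \<union> C"
  proof safe
    fix z assume z: "z \<in> S" "doomed I u z" "z \<notin> G" "z \<notin> B" "z \<notin> C"
    have zI: "z \<in> I" using z(1) assms by (auto simp: defs)
    obtain p where p: "pvt z I p" using \<open>irr I\<close> zI by (auto simp: irr_def)
    have leg: "leg z p" using p z(2) assms(6) unfolding leg_def pvt_def doomed_def S_def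
      by (auto intro: cadj_sym)
    have pu: "p \<noteq> u" using leg z(1,5) by (auto simp: C_def)
    have zu: "z \<noteq> u" using z(1) u(2) by auto
    have apu: "adj p u" using leg pu by (auto simp: leg_def cadj_def intro: adj_sym)
    have zn: "z < n" "z \<in> J" using z(1) SV SJ by auto
    show "z \<in> A"
    proof (cases "p = z")
      case False
      then have apz: "adj p z" using leg by (auto simp: leg_def cadj_def)
      show ?thesis
      proof (cases "z < u")
        case True
        then show ?thesis using z(1) leg apu apz by (auto simp: A_def)
      next
        case f: False
        then have uz: "u < z" using zu by simp
        from z(1) have "z \<in> pre J k" by (simp add: defs)
        then show ?thesis using assms(2)
        proof (cases rule: placed_cases)
          case own
          have "slot u n < k" using own(1) uz slot_less[of n n u z] by simp
          then have "u \<in> S" using own_done u by (simp add: S_def)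
          then show ?thesis using u by simp
        next
          case (col g)
          \<comment> \<open>Otherwise the column \<open>p\<close> would have offered
            \<open>u\<close> before the slot of \<open>z\<close>, so a neighbour of \<open>p\<close>
            would already be placed. Lying in \<open>S\<close>, it must be \<open>z\<close>, which
            is not yet placed.\<close>
          have "g < p"
          proof (rule ccontr)
            assume "\<not> g < p"
            then have "slot p u < slot g z" using uz u zn slot_less[of u z p g] by auto
            then obtain x where x: "x \<in> pre J (slot g z)" "adj p x" using col_done apu u by blast
            then have "x \<in> S" using pre_mono[of "slot g z" k J] col by (auto simp: S_def)
            then have "x = z" using leg x by (auto simp: leg_def cadj_def)
            then show False using x col by simp
          qed
          \<comment> \<open>The strong ordering is applied to the edges from \<open>p\<close> to
            \<open>z\<close> and \<open>u\<close> and from \<open>g\<close> to \<open>z\<close>. As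
            \<open>u < z\<close>, a proper adjacency of \<open>g\<close> and \<open>u\<close>
            contradicts \<open>col_min\<close>, so only \<open>g = u\<close> remains.\<close>
          then have "cadj g u" using strong[OF apz apu col(2) _ uz] by simp
          moreover have "\<not> adj g u" using col_min[OF col(3) _ u(1)] uz zn by auto
          ultimately have "g = u" by (simp add: cadj_def)
          then have "z \<in> G" using z(1) col by (auto simp: G_def)
          then show ?thesis using z by simp
        qed
      qed
    next
      case True
      have azu: "adj z u" using apu True by simp
      \<comment> \<open>Being its own private neighbour, \<open>z\<close> is isolated in
        \<open>S\<close>.\<close>
      have iso: "\<not> adj z w" if "w \<in> S" for w
        using leg True that adj_irrefl by (auto simp: leg_def cadj_def)
      from z(1) have "z \<in> pre J k" by (simp add: defs)
      then show ?thesis using assms(2)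
      proof (cases rule: placed_cases)
        case own
        have "slot z u < k" using own(1) u slot_less[of u n z z] by simp
        then show ?thesis using col_done[of z u k J] azu u iso by (auto simp: S_def)
      next
        case (col g)
        have gu: "g \<noteq> u" using col z by (auto simp: G_def)
        show ?thesis
        proof (cases "g \<in> J")
          case True
          \<comment> \<open>A column vertex in \<open>J\<close> is placed by the end of its column
            at the latest, but this one is missing from \<open>S\<close>; so slot \<open>k\<close>
            lies in the same column. It is the last slot there, because \<open>z\<close> has closed
            the column to neighbours. Then \<open>u = g\<close>.\<close>
          have "g \<notin> S" using iso col adj_sym by blast
          then have "\<not> slot g n < k" using own_done True by (auto simp: S_def)
          then have "v = g" using col(1) k zn slot_less[of z r g v] slot_less[of n r g v] by auto
          have "r = n"
          proof (rule ccontr)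
            assume "r \<noteq> n"
            then have "\<forall>w\<in>S. \<not> adj g w" using assms(5) k \<open>v = g\<close> by (auto simp: S_def grd_slot)
            then show False using z(1) col by blast
          qed
          then show ?thesis using gu \<open>v = g\<close> k by (auto simp: u_def tgt_slot)
        next
          case False
          have "g < u"
          proof (rule ccontr)
            assume "\<not> g < u"
            then have "slot u n < k" using col(1) gu zn slot_less[of n z u g] by auto
            then show False using own_done[of u k J] u by (simp add: S_def)
          qed
          then have "z \<in> B" using z(1) col False azu by (auto simp: B_def)
          then show ?thesis using z by simp
        qed
      qed
    qed
  qed
  have "finite S" using SV finite_subset by blast
  then have "finite (A \<union> G \<union> B \<union> C)" by (auto simp: A_def G_def B_def C_def)
  then have "card {z \<in> S. doomed I u z} \<le> card (A \<union> G \<union> B \<union> C)" by (rule card_mono[OF _ cover])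
  also have "\<dots> \<le> card A + card G + card B + card C"
    by (intro order_trans[OF card_Un_le] add_right_mono order_refl)
  also have "\<dots> \<le> 4" using cA cG cB cC by simp
  finally show ?thesis by (simp add: defs)
qed

end

section \<open>Existence of a strong ordering\<close>

context graph
begin

text \<open>The vicinal preorder of the subgraph induced by \<open>W\<close>.\<close>

definition vic :: "nat set \<Rightarrow> nat \<Rightarrow> nat \<Rightarrow> bool" where
  "vic W a b \<longleftrightarrow> (\<forall>z\<in>W. adj a z \<longrightarrow> z \<noteq> b \<longrightarrow> adj b z)"

definition qs :: "nat set \<Rightarrow> nat \<Rightarrow> bool" where
  "qs W v \<longleftrightarrow> (\<forall>a\<in>W. \<forall>b\<in>W. adj v a \<longrightarrow> adj v b \<longrightarrow> a \<noteq> b \<longrightarrow> vic W a b \<or> vic W b a)"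

lemma vic_antimono: "vic W a b \<Longrightarrow> U \<subseteq> W \<Longrightarrow> vic U a b"
  by (auto simp: vic_def)

text \<open>The exempted vertex \<open>b\<close> is the only delicate case: symmetry of adjacency
  carries the edge from \<open>a\<close> and \<open>b\<close> to \<open>c\<close> and
  \<open>a\<close>, and then to \<open>b\<close> and \<open>c\<close>.\<close>

lemma vic_trans:
  assumes "vic W a b" "vic W b c" "a \<in> W" "b \<in> W" "c \<in> W"
  shows "vic W a c"
  unfolding vic_def
proof (intro ballI impI)
  fix z assume z: "z \<in> W" "adj a z" "z \<noteq> c"
  show "adj c z"
  proof (cases "z = b")
    case False
    then show ?thesis using assms z by (auto simp: vic_def)
  next
    case True
    show ?thesis
    proof (cases "a = c")
      case False
      have "adj c a" using assms(2,3) z True False adj_sym[of a b] by (auto simp: vic_def)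
      then have "adj a c" by (rule adj_sym)
      then have "adj b c" using assms(1,5) z True by (auto simp: vic_def)
      then show ?thesis using True adj_sym by auto
    qed (use z in simp)
  qed
qed

definition deg :: "nat set \<Rightarrow> nat \<Rightarrow> nat" where
  "deg U a = card {z \<in> U. adj a z}"

lemma deg_split:
  assumes "finite U" "a \<in> U" "b \<in> U"
  shows "deg U a = card {z \<in> U. adj a z \<and> z \<noteq> b} + (if adj a b then 1 else 0)"
proof (cases "adj a b")
  case True
  then have "{z \<in> U. adj a z} = insert b {z \<in> U. adj a z \<and> z \<noteq> b}" using assms by auto
  then show ?thesis using True assms by (simp add: deg_def)
next
  case False
  then have "{z \<in> U. adj a z} = {z \<in> U. adj a z \<and> z \<noteq> b}" by auto
  then show ?thesis using False by (simp add: deg_def)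
qed

lemma vic_subset: "vic U a b \<Longrightarrow> {z \<in> U. adj a z \<and> z \<noteq> b} \<subseteq> {z \<in> U. adj b z \<and> z \<noteq> a}"
  using adj_irrefl by (auto simp: vic_def)

lemma vic_deg_le:
  assumes "finite U" "a \<in> U" "b \<in> U" "vic U a b"
  shows "deg U a \<le> deg U b"
  using card_mono[OF _ vic_subset[OF assms(4)]] assms(1) deg_split[OF assms(1-3)] deg_split[OF assms(1,3,2)]
    adj_sym by (auto split: if_splits)

lemma vic_deg_less:
  assumes "finite U" "a \<in> U" "b \<in> U" "vic U a b" "\<not> vic U b a"
  shows "deg U a < deg U b"
proof -
  obtain z where "z \<in> U" "adj b z" "z \<noteq> a" "\<not> adj a z" using assms(5) by (auto simp: vic_def)
  then have "{z \<in> U. adj a z \<and> z \<noteq> b} \<subset> {z \<in> U. adj b z \<and> z \<noteq> a}"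
    using vic_subset[OF assms(4)] by blast
  then have "card {z \<in> U. adj a z \<and> z \<noteq> b} < card {z \<in> U. adj b z \<and> z \<noteq> a}"
    by (intro psubset_card_mono) (use assms in auto)
  then show ?thesis using deg_split[OF assms(1-3)] deg_split[OF assms(1,3,2)] adj_sym
    by (auto split: if_splits)
qed

text \<open>Suppose that \<open>a\<close> lies strictly below \<open>v\<close>, so its degree is
  smaller. If they are not adjacent, the neighbours of \<open>a\<close> are neighbours of
  \<open>v\<close>, so \<open>a\<close> is quasi-simple, against the choice of \<open>v\<close>. If
  they are adjacent, the least neighbour \<open>c\<close> of \<open>v\<close> gives the same
  contradiction.\<close>

lemma qs_minimal:
  assumes U: "finite U" and v: "v \<in> U" "qs U v" "\<And>w. w \<in> U \<Longrightarrow> qs U w \<Longrightarrow> deg U v \<le> deg U w"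
    and a: "a \<in> U" "vic U a v"
  shows "vic U v a"
proof (rule ccontr)
  assume strict: "\<not> vic U v a"
  have less: "deg U a < deg U v" using vic_deg_less U v a strict by blast
  show False
  proof (cases "adj a v")
    case False
    then have "adj v z" if "z \<in> U" "adj a z" for z using that a(2) by (auto simp: vic_def)
    then have "qs U a" using v(2) by (auto simp: qs_def)
    then show False using v(3)[OF a(1)] less by simp
  next
    case True
    define N where "N = {z \<in> U. adj v z}"
    have N: "finite N" "a \<in> N" using U a True adj_sym by (auto simp: N_def)
    obtain c where c: "c \<in> N" "\<And>x. x \<in> N \<Longrightarrow> deg U c \<le> deg U x"
      using ex_min_if_finite[of "deg U ` N"] N by (auto simp: not_less)
    have least: "vic U c x" if "x \<in> N" for x
    proof (rule ccontr)
      assume n: "\<not> vic U c x"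
      then have "c \<noteq> x" by (auto simp: vic_def)
      then have "vic U x c" using v(2) n c(1) that by (auto simp: qs_def N_def)
      then have "deg U x < deg U c" using vic_deg_less[of U x c] U c(1) that n by (auto simp: N_def)
      then show False using c(2)[OF that] by simp
    qed
    have cU: "c \<in> U" using c by (simp add: N_def)
    have cv: "vic U c v" using vic_trans[OF least[OF N(2)] a(2)] cU a v by blast
    \<comment> \<open>Every neighbour \<open>i\<close> of \<open>v\<close> lies above
      \<open>c\<close>, so it sees \<open>y\<close>; thus \<open>y\<close> lies above
      \<open>v\<close>. This settles the pairs of neighbours of \<open>c\<close> that contain
      \<open>v\<close>; all others are neighbours of \<open>v\<close>.\<close>
    have top: "vic U v y" if y: "y \<in> U" "adj c y" "y \<noteq> v" for y
      unfolding vic_def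
    proof (intro ballI impI)
      fix i assume i: "i \<in> U" "adj v i" "i \<noteq> y"
      then have "vic U c i" using least by (simp add: N_def)
      then have "adj i y" using y i by (auto simp: vic_def)
      then show "adj y i" by (rule adj_sym)
    qed
    have "qs U c" unfolding qs_def
    proof (intro ballI impI)
      fix x y assume xy: "x \<in> U" "y \<in> U" "adj c x" "adj c y" "x \<noteq> y"
      show "vic U x y \<or> vic U y x"
      proof (cases "x = v \<or> y = v")
        case True
        then show ?thesis using top[of x] top[of y] xy by blast
      next
        case False
        then have "adj v x" "adj v y" using cv xy by (auto simp: vic_def)
        then show ?thesis using v(2) xy by (auto simp: qs_def)
      qed
    qed
    then have "deg U v \<le> deg U c" using v(3) cU by blast
    then show False using c(2)[OF N(2)] less by simp
  qed
qed

text \<open>Neighbours of \<open>a\<close> other than \<open>v\<close> are neighbours of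
  \<open>v\<close>, so only pairs containing \<open>v\<close> need work; there \<open>a\<close>
  stands in for \<open>v\<close> by transitivity.\<close>

lemma qs_twin:
  assumes v: "qs U v" "v \<in> U" "a \<in> U" and t: "vic U a v" "vic U v a"
  shows "qs U a"
  unfolding qs_def
proof (intro ballI impI)
  have *: "vic U v y \<or> vic U y v" if y: "y \<in> U" "adj a v" "adj a y" "y \<noteq> v" for y
  proof -
    have "adj v a" using y(2) by (rule adj_sym)
    moreover have "adj v y" using t(1) y by (auto simp: vic_def)
    moreover have "a \<noteq> y" using y adj_irrefl by auto
    ultimately have "vic U a y \<or> vic U y a" using v y by (auto simp: qs_def)
    then show ?thesis using vic_trans[of U v a y] vic_trans[of U y a v] t v y by blast
  qed
  fix x y assume xy: "x \<in> U" "y \<in> U" "adj a x" "adj a y" "x \<noteq> y"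
  show "vic U x y \<or> vic U y x"
  proof (cases "x = v \<or> y = v")
    case True
    then show ?thesis using *[of x] *[of y] xy by blast
  next
    case False
    then have "adj v x" "adj v y" using t xy by (auto simp: vic_def)
    then show ?thesis using v xy by (auto simp: qs_def)
  qed
qed

text \<open>The family will consist of the vertex sets present at earlier eliminations. Along a
  chain the strict comparisons of all members together form a strict order \<open>P\<close>, and a
  \<open>P\<close>-minimal vertex is taken among the quasi-simple ones of least degree. By
  \<open>qs_minimal\<close> any \<open>a\<close> below it is its twin in \<open>U\<close>, hence
  again such a vertex, and \<open>P\<close>-minimality applies.\<close>

lemma qs_minimal_exists:
  assumes U: "finite U" and ex: "v0 \<in> U" "qs U v0"
    and chain: "\<And>W. W \<in> \<W> \<Longrightarrow> U \<subseteq> W" "\<And>W W'. W \<in> \<W> \<Longrightarrow> W' \<in> \<W> \<Longrightarrow> W \<subseteq> W' \<or> W' \<subseteq> W"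
  obtains v where "v \<in> U" "qs U v" "\<And>a W. a \<in> U \<Longrightarrow> W \<in> \<W> \<Longrightarrow> vic W a v \<Longrightarrow> vic W v a"
proof -
  define P where "P a b \<longleftrightarrow> (\<exists>W\<in>\<W>. vic W a b \<and> \<not> vic W b a)" for a b
  define m where "m = (LEAST d. \<exists>w\<in>U. qs U w \<and> deg U w = d)"
  define Q where "Q = {w \<in> U. qs U w \<and> deg U w = m}"
  have "\<exists>d. \<exists>w\<in>U. qs U w \<and> deg U w = d" using ex by blast
  then have "\<exists>w\<in>U. qs U w \<and> deg U w = m" unfolding m_def by (rule LeastI_ex)
  then have Q: "Q \<noteq> {}" "finite Q" using U by (auto simp: Q_def)
  have m: "m \<le> deg U w" if "w \<in> U" "qs U w" for w
    unfolding m_def by (rule Least_le) (use that in blast)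
  have trans: "P a c" if "P a b" "P b c" "a \<in> U" "b \<in> U" "c \<in> U" for a b c
  proof -
    from that obtain W W' where W: "W \<in> \<W>" "vic W a b" "\<not> vic W b a"
        "W' \<in> \<W>" "vic W' b c" "\<not> vic W' c b" by (auto simp: P_def)
    have abc: "a \<in> W" "b \<in> W" "c \<in> W" "a \<in> W'" "b \<in> W'" "c \<in> W'" using chain(1) W that by auto
    show "P a c"
    \<comment> \<open>In the smaller of the two sets both comparisons hold, and the one that was
      strict there makes the composition strict.\<close>
    proof (cases "W \<subseteq> W'")
      case True
      then have bc: "vic W b c" using W vic_antimono by blast
      then have "vic W a c" using vic_trans W abc by blast
      moreover have "\<not> vic W c a" using vic_trans[OF bc] W abc by blast
      ultimately show ?thesis using W by (auto simp: P_def)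
    next
      case False
      then have "W' \<subseteq> W" using chain(2) W by blast
      then have ab: "vic W' a b" using W vic_antimono by blast
      then have "vic W' a c" using vic_trans W abc by blast
      moreover have "\<not> vic W' c a" using vic_trans[OF _ ab] W abc by blast
      ultimately show ?thesis using W by (auto simp: P_def)
    qed
  qed
  have irrefl: "\<not> P a a" for a by (auto simp: P_def)
  have QU: "Q \<subseteq> U" by (auto simp: Q_def)
  have "\<exists>v\<in>Q. \<forall>x\<in>Q. x \<noteq> v \<longrightarrow> \<not> P x v"
  proof (rule Finite_Set.bex_min_element[OF Q(2) _ _ Q(1)])
    show "asymp_on Q P"
    proof (rule asymp_onI)
      fix a b assume "a \<in> Q" "b \<in> Q" "P a b"
      then show "\<not> P b a" using trans[of a b a] irrefl[of a] QU by blast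
    qed
    show "transp_on Q P"
    proof (rule transp_onI)
      fix a b c assume "a \<in> Q" "b \<in> Q" "c \<in> Q" "P a b" "P b c"
      then show "P a c" using trans[of a b c] QU by blast
    qed
  qed
  then obtain v where v: "v \<in> Q" "\<And>x. x \<in> Q \<Longrightarrow> \<not> P x v" using irrefl by metis
  show thesis
  proof (rule that)
    show vU: "v \<in> U" "qs U v" using v by (auto simp: Q_def)
    fix a W assume a: "a \<in> U" "W \<in> \<W>" "vic W a v"
    have av: "vic U a v" using vic_antimono a chain(1) by blast
    have "vic U v a"
      by (rule qs_minimal[OF U vU _ a(1) av]) (use m v in \<open>auto simp: Q_def\<close>)
    then have "qs U a" using qs_twin vU a(1) av by blast
    moreover have "deg U a \<le> m" using vic_deg_le[OF U a(1) vU(1) av] v by (simp add: Q_def)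
    ultimately have "a \<in> Q" using m[of a] a(1) by (simp add: Q_def)
    then have "\<not> P a v" using v by blast
    then show "vic W v a" using a by (auto simp: P_def)
  qed
qed

text \<open>The vertices of \<open>R\<close> have been eliminated in the order of decreasing labels \<open>pos\<close>.\<close>

definition labelling :: "nat set \<Rightarrow> (nat \<Rightarrow> nat) \<Rightarrow> bool" where
  "labelling R pos \<longleftrightarrow> R \<subseteq> {..<n} \<and> bij_betw pos R {n - card R..<n} \<and> (\<forall>b. b \<notin> R \<longrightarrow> pos b = 0) \<and>
     (\<forall>j\<in>R. qs {b. b < n \<and> pos b \<le> pos j} j) \<and>
     (\<forall>j\<in>R. \<forall>k\<in>R. \<forall>a<n. \<forall>b<n. adj j k \<longrightarrow> adj j a \<longrightarrow> adj k b \<longrightarrow> pos k < pos j \<longrightarrow>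
        (a \<in> R \<longrightarrow> pos a < pos k) \<longrightarrow> pos b \<le> pos j \<longrightarrow> cadj a b)"

text \<open>The exchange condition of \<open>labelling\<close> with \<open>v\<close> as the vertex
  labelled next. Vertices without a label have \<open>pos\<close> 0, so
  \<open>pos b \<le> pos j\<close> says that \<open>b\<close> was still present when
  \<open>j\<close> was eliminated.\<close>

definition eligible :: "nat set \<Rightarrow> (nat \<Rightarrow> nat) \<Rightarrow> nat \<Rightarrow> bool" where
  "eligible R pos v \<longleftrightarrow> v \<notin> R \<and> qs ({..<n} - R) v \<and>
     (\<forall>j<n. \<forall>a<n. \<forall>b<n. j \<in> R \<longrightarrow> a \<notin> R \<longrightarrow> a \<noteq> v \<longrightarrow> adj j v \<longrightarrow> adj j a \<longrightarrow> adj v b \<longrightarrow>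
        pos b \<le> pos j \<longrightarrow> cadj a b)"

lemma labelling_pos:
  assumes "labelling R pos" "j \<in> R" shows "n - card R \<le> pos j" "pos j < n"
proof -
  have "bij_betw pos R {n - card R..<n}" using assms(1) by (simp add: labelling_def)
  then have "pos j \<in> {n - card R..<n}" using assms(2) bij_betwE by blast
  then show "n - card R \<le> pos j" "pos j < n" by auto
qed

lemma labelling_card: "labelling R pos \<Longrightarrow> R \<subset> {..<n} \<Longrightarrow> card R < n"
  using psubset_card_mono[of "{..<n}" R] by simp

text \<open>When \<open>j\<close> was eliminated, its neighbours \<open>a\<close> and
  \<open>v\<close> were comparable. Since \<open>v\<close> respects all earlier strict comparisons,
  \<open>a\<close> dominates \<open>v\<close> in either case, so it sees \<open>b\<close> or equals
  it.\<close>

lemma eligible_exists: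
  assumes L: "labelling R pos" and R: "R \<subset> {..<n}"
    and qs: "\<And>W. W \<subseteq> {..<n} \<Longrightarrow> W \<noteq> {} \<Longrightarrow> \<exists>v\<in>W. qs W v"
  shows "\<exists>v<n. eligible R pos v"
proof -
  define U W where "U = {..<n} - R" and "W j = {b. b < n \<and> pos b \<le> pos j}" for j
  obtain v0 where v0: "v0 \<in> U" "qs U v0" using qs[of U] R by (auto simp: U_def)
  have pos0: "pos b = 0" if "b \<notin> R" for b using L that by (auto simp: labelling_def)
  have UW: "U \<subseteq> W j" for j by (auto simp: U_def W_def pos0)
  have fin: "finite U" by (simp add: U_def)
  obtain v where v: "v \<in> U" "qs U v" and v3: "\<And>a X. a \<in> U \<Longrightarrow> X \<in> W ` R \<Longrightarrow> vic X a v \<Longrightarrow> vic X v a"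
  proof (rule qs_minimal_exists[OF fin v0, of "W ` R"])
    show "U \<subseteq> X" if "X \<in> W ` R" for X using that UW by auto
    show "X \<subseteq> Y \<or> Y \<subseteq> X" if X: "X \<in> W ` R" and Y: "Y \<in> W ` R" for X Y
    proof -
      obtain i j where "X = W i" "Y = W j" using X Y by auto
      then show ?thesis by (cases "pos i \<le> pos j") (auto simp: W_def)
    qed
  qed blast
  have "cadj a b" if "j \<in> R" "a < n" "a \<notin> R" "a \<noteq> v" "adj j v" "adj j a" "adj v b" "b < n" "pos b \<le> pos j" for j a b
  proof -
    have "qs (W j) j" using L that(1) by (auto simp: labelling_def W_def)
    moreover have "a \<in> U" "v \<in> W j" "a \<in> W j" "b \<in> W j" using that v UW by (auto simp: U_def W_def)
    ultimately have "vic (W j) a v \<or> vic (W j) v a" using that by (auto simp: qs_def)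
    then have "vic (W j) v a" using v3[of a "W j"] \<open>a \<in> U\<close> that(1) by blast
    then show ?thesis using that \<open>b \<in> W j\<close> by (auto simp: vic_def cadj_def)
  qed
  then have "eligible R pos v" using v by (auto simp: eligible_def U_def)
  then show ?thesis using v by (auto simp: U_def)
qed

lemma labelling_step:
  assumes L: "labelling R pos" and v: "eligible R pos v" "v < n"
  defines "pos' \<equiv> pos(v := n - 1 - card R)"
  shows "labelling (insert v R) pos'"
proof -
  have vR: "v \<notin> R" using v by (simp add: eligible_def)
  have RV: "R \<subseteq> {..<n}" "finite R" using L finite_subset by (auto simp: labelling_def)
  then have "R \<subset> {..<n}" using vR v by auto
  then have cR: "card R < n" using labelling_card L by blast
  have bij: "bij_betw pos R {n - card R..<n}" and pos0: "\<And>b. b \<notin> R \<Longrightarrow> pos b = 0"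
    using L by (auto simp: labelling_def)
  have lt: "n - 1 - card R < pos j" "pos j < n" if "j \<in> R" for j
    using labelling_pos[OF L that] cR by auto
  \<comment> \<open>The new label is still smaller than all earlier ones, just like the default 0
    that it replaces.\<close>
  have same: "pos' b \<le> pos' j \<longleftrightarrow> pos b \<le> pos j" if "j \<in> R" for j b
    using that vR lt[OF that] pos0[OF vR] by (auto simp: pos'_def)
  have "bij_betw pos' (insert v R) (insert (n - 1 - card R) {n - card R..<n})"
  proof -
    have "bij_betw pos' R {n - card R..<n}"
      using bij vR by (subst bij_betw_cong[of R pos' pos]) (auto simp: pos'_def)
    then have "inj_on pos' R" "pos' ` R = {n - card R..<n}" by (auto simp: bij_betw_def)
    moreover have "pos' v = n - 1 - card R" "pos' v \<notin> {n - card R..<n}"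
      using cR by (auto simp: pos'_def)
    ultimately show ?thesis using vR by (auto simp: bij_betw_def)
  qed
  moreover have "insert (n - 1 - card R) {n - card R..<n} = {n - card (insert v R)..<n}"
    using vR RV cR by auto
  ultimately have 1: "bij_betw pos' (insert v R) {n - card (insert v R)..<n}" by simp
  have 2: "qs {b. b < n \<and> pos' b \<le> pos' j} j" if "j \<in> insert v R" for j
  proof (cases "j = v")
    case True
    have "{b. b < n \<and> pos' b \<le> pos' v} = {..<n} - R"
      using lt pos0 vR by (force simp: pos'_def not_le dest: leD)
    then show ?thesis using v True by (simp add: eligible_def)
  next
    case False
    then have "{b. b < n \<and> pos' b \<le> pos' j} = {b. b < n \<and> pos b \<le> pos j}" using same that by auto
    then show ?thesis using L False that by (simp add: labelling_def)
  qed
  have 3: "cadj a b" if h: "j \<in> insert v R" "k \<in> insert v R" "a < n" "b < n" "adj j k" "adj j a" "adj k b"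
    "pos' k < pos' j" "a \<in> insert v R \<longrightarrow> pos' a < pos' k" "pos' b \<le> pos' j" for j k a b
  proof -
    have "j \<noteq> v" using h(2,8) lt(1)[of k] by (auto simp: pos'_def split: if_splits)
    then have j: "j \<in> R" using h(1) by simp
    have b: "pos b \<le> pos j" using same[OF j] h(10) by simp
    show ?thesis
    proof (cases "k = v")
      case True
      have "a \<notin> R" using h(9) lt(1)[of a] vR True by (auto simp: pos'_def)
      moreover have "a \<noteq> v" using h(9) True by auto
      ultimately show ?thesis using v(1) h True j b RV(1)
        unfolding eligible_def by blast
    next
      case False
      then have k: "k \<in> R" using h(2) by simp
      have "pos k < pos j" using h(8) False \<open>j \<noteq> v\<close> by (simp add: pos'_def)
      moreover have "a \<in> R \<longrightarrow> pos a < pos k" using h(9) False vR by (auto simp: pos'_def split: if_splits)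
      ultimately show ?thesis using L j k h b unfolding labelling_def by blast
    qed
  qed
  show ?thesis unfolding labelling_def
    using 1 2 3 RV v pos0 by (auto simp: pos'_def)
qed

definition relabel :: "(nat \<Rightarrow> nat) \<Rightarrow> nat \<Rightarrow> nat \<Rightarrow> bool" where
  "relabel pos i j \<longleftrightarrow> (\<exists>a<n. \<exists>b<n. pos a = i \<and> pos b = j \<and> adj a b)"

end

section \<open>Transport of irredundance along the labels\<close>

locale labelled_graph = graph +
  fixes pos :: "nat \<Rightarrow> nat"
  assumes labels: "labelling {..<n} pos"
begin

lemma pos_bij: "bij_betw pos {..<n} {..<n}"
  using labels by (simp add: labelling_def atLeast0LessThan)

lemma pos_inj: "a < n \<Longrightarrow> b < n \<Longrightarrow> pos a = pos b \<longleftrightarrow> a = b"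
  using pos_bij by (auto simp: bij_betw_def inj_on_def)

lemma pos_less: "a < n \<Longrightarrow> pos a < n"
  using pos_bij bij_betwE by blast

lemma relabel_pos: "a < n \<Longrightarrow> b < n \<Longrightarrow> relabel pos (pos a) (pos b) \<longleftrightarrow> adj a b"
  unfolding relabel_def using pos_inj by blast

lemma graph_relabel: "graph n (relabel pos)"
proof
  show "relabel pos b a" if "relabel pos a b" for a b using that adj_sym by (auto simp: relabel_def)
  show "\<not> relabel pos a a" for a unfolding relabel_def using pos_inj adj_irrefl by metis
  show "a < n" if "relabel pos a b" for a b using that pos_less by (auto simp: relabel_def)
qed

sublocale H: strong_graph n "relabel pos"
proof (rule strong_graph.intro[OF graph_relabel], unfold_locales)
  have lab: "cadj a b" if "j < n" "k < n" "a < n" "b < n" "adj j k" "adj j a" "adj k b" "pos k < pos j"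
    "pos a < pos k" "pos b \<le> pos j" for j k a b
    using labels that unfolding labelling_def by blast
  fix i k l j assume h: "relabel pos i k" "relabel pos i l" "relabel pos j k" "j < i" "l < k"
  obtain a b where ab: "a < n" "b < n" "pos a = i" "pos b = k" "adj a b" using h(1) by (auto simp: relabel_def)
  obtain a' c where c: "a' < n" "c < n" "pos a' = i" "pos c = l" "adj a' c" using h(2) by (auto simp: relabel_def)
  obtain d b' where d: "d < n" "b' < n" "pos d = j" "pos b' = k" "adj d b'" using h(3) by (auto simp: relabel_def)
  have e: "a' = a" "b' = b" using pos_inj ab c d by metis+
  have "cadj c d"
  \<comment> \<open>\<open>labelling\<close> states the exchange property only for the larger end of
    an edge. The property is symmetric, so \<open>i\<close> and \<open>k\<close> swap roles when
    \<open>k\<close> is the larger.\<close>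
  proof (cases "k < i")
    case True
    show ?thesis by (rule lab[of a b]) (use ab c d e h True adj_sym in auto)
  next
    case False
    have "i \<noteq> k" using ab pos_inj adj_irrefl by metis
    then have "cadj d c" by (intro lab[of b a]) (use ab c d e h False adj_sym in auto)
    then show ?thesis by (rule cadj_sym)
  qed
  then have "j = l \<or> relabel pos j l" using c d relabel_pos[of d c] adj_sym[of c d] by (auto simp: cadj_def)
  then show "graph.cadj (relabel pos) j l"
    by (auto simp: graph.cadj_def[OF graph_relabel])
qed

lemma H_cadj: "a < n \<Longrightarrow> b < n \<Longrightarrow> H.cadj (pos a) (pos b) \<longleftrightarrow> cadj a b"
  by (simp add: H.cadj_def cadj_def relabel_pos pos_inj)

lemma cadj_less: "cadj a b \<Longrightarrow> a < n \<Longrightarrow> b < n"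
  using adj_less adj_sym by (auto simp: cadj_def)

lemma irr_pos: "I \<subseteq> {..<n} \<Longrightarrow> H.irr (pos ` I) \<longleftrightarrow> irr I"
proof -
  assume I: "I \<subseteq> {..<n}"
  have "(\<exists>y. H.pvt (pos x) (pos ` I) y) \<longleftrightarrow> (\<exists>y. pvt x I y)" if "x \<in> I" for x
  proof -
    have x: "x < n" using that I by auto
    have *: "H.pvt (pos x) (pos ` I) (pos y) \<longleftrightarrow> pvt x I y" if "y < n" for y
      unfolding H.pvt_def pvt_def using I x that by (auto simp: H_cadj pos_inj subset_iff)
    have "\<exists>y'<n. y = pos y'" if "H.pvt (pos x) (pos ` I) y" for y
    proof -
      have "y < n" using that pos_less[OF x] H.adj_less[of y] H.adj_sym[of "pos x" y] unfolding H.pvt_def H.cadj_def by blast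
      then show ?thesis using pos_bij by (auto simp: bij_betw_def)
    qed
    then show ?thesis using * x cadj_less by (metis pvt_def)
  qed
  then show ?thesis by (auto simp: H.irr_def irr_def)
qed

lemma maxirr_pos: "I \<subseteq> {..<n} \<Longrightarrow> H.maxirr (pos ` I) \<longleftrightarrow> maxirr I"
proof -
  assume I: "I \<subseteq> {..<n}"
  have "H.irr (insert (pos u) (pos ` I)) \<longleftrightarrow> irr (insert u I)" if "u < n" for u
    using irr_pos[of "insert u I"] I that by simp
  moreover have "pos u \<in> pos ` I \<longleftrightarrow> u \<in> I" if "u < n" for u
    using pos_inj I that by (auto simp: image_iff subset_iff)
  moreover have "(\<forall>u<n. Q u) \<longleftrightarrow> (\<forall>u<n. Q (pos u))" for Q
    using pos_bij by (auto simp: bij_betw_def) (metis imageE lessThan_iff)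
  note this[of "\<lambda>u. H.irr (insert u (pos ` I)) \<longrightarrow> u \<in> pos ` I"]
  ultimately have "(\<forall>u<n. H.irr (insert u (pos ` I)) \<longrightarrow> u \<in> pos ` I) \<longleftrightarrow> (\<forall>u<n. irr (insert u I) \<longrightarrow> u \<in> I)"
    by simp
  moreover have "pos ` I \<subseteq> {..<n}" using I pos_less by auto
  ultimately show ?thesis unfolding H.maxirr_def maxirr_def
    using I irr_pos[OF I] by simp
qed

end

section \<open>Irredundance and elimination orderings in terms of adjacency\<close>

locale input_graph =
  fixes n :: nat and E :: "nat set set"
  assumes simple: "simple_graph {..<n} E"
begin

lemma edge: "{a, b} \<in> E \<Longrightarrow> a < n \<and> b < n \<and> a \<noteq> b"
proof -
  assume "{a, b} \<in> E"
  then obtain u v where "u < n" "v < n" "u \<noteq> v" "{a, b} = {u, v}"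
    using simple by (force simp: simple_graph_def)
  then show ?thesis by (auto simp: doubleton_eq_iff)
qed

sublocale graph n "\<lambda>a b. {a, b} \<in> E"
proof
  show "{b, a} \<in> E" if "{a, b} \<in> E" for a b using that by (simp add: insert_commute)
  show "{a, a} \<notin> E" "{a, b} \<in> E \<Longrightarrow> a < n" for a b using edge[of a a] edge[of a b] by auto
qed

lemma cnbh_iff: "y \<in> cnbh E x \<longleftrightarrow> cadj x y"
  by (auto simp: cnbh_def nbh_def cadj_def insert_commute)

lemma irredundant_iff: "irredundant E I \<longleftrightarrow> irr I"
proof -
  have "priv E x I = {y. pvt x I y}" if "x \<in> I" for x
    unfolding priv_def pvt_def using that cadj_sym by (auto simp: cnbh_iff)
  then show ?thesis by (auto simp: irredundant_def irr_def)
qed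

lemma MaxIrr_iff: "I \<in> MaxIrr {..<n} E \<longleftrightarrow> maxirr I"
proof
  assume "I \<in> MaxIrr {..<n} E"
  then have I: "I \<subseteq> {..<n}" "irr I" "\<And>J. J \<subseteq> {..<n} \<Longrightarrow> irr J \<Longrightarrow> I \<subseteq> J \<Longrightarrow> J = I"
    by (auto simp: MaxIrr_def irredundant_iff)
  have "u \<in> I" if "u < n" "irr (insert u I)" for u
    using I(3)[of "insert u I"] I(1) that by auto
  then show "maxirr I" using I by (auto simp: maxirr_def)
next
  assume I: "maxirr I"
  have "J = I" if J: "J \<subseteq> {..<n}" "irr J" "I \<subseteq> J" for J
  proof
    show "J \<subseteq> I"
    proof
      fix u assume u: "u \<in> J"
      have "irr (insert u I)" by (rule irr_mono[OF J(2)]) (use u J in auto)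
      then show "u \<in> I" using I u J by (auto simp: maxirr_def)
    qed
  qed (rule J)
  then show "I \<in> MaxIrr {..<n} E" using I by (auto simp: MaxIrr_def maxirr_def irredundant_iff)
qed

text \<open>Take the vertex of \<open>W\<close> that comes last in the ordering: it is quasi-simple
  in a subgraph containing all of \<open>W\<close>, and comparability passes to smaller vertex
  sets.\<close>

lemma quasi_simple_exists:
  assumes "strongly_orderable {..<n} E" "W \<subseteq> {..<n}" "W \<noteq> {}"
  shows "\<exists>v\<in>W. qs W v"
proof -
  obtain vs where vs: "set vs = {..<n}"
    "\<And>i. i < length vs \<Longrightarrow> quasi_simple (induced_edges E (set (take (Suc i) vs))) (vs ! i)"
    using assms(1) by (auto simp: strongly_orderable_def quasi_simple_elimination_ordering_def)
  define Q where "Q i \<longleftrightarrow> i < length vs \<and> vs ! i \<in> W" for i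
  have "\<exists>i. Q i" using assms vs(1) by (metis Q_def ex_in_conv in_set_conv_nth subsetD)
  then have i: "Q (GREATEST i. Q i)" by (rule GreatestI_ex_nat[where b = "length vs"]) (auto simp: Q_def)
  define i where "i = (GREATEST i. Q i)"
  define X where "X = set (take (Suc i) vs)"
  have WX: "W \<subseteq> X"
  proof
    fix w assume "w \<in> W"
    then obtain j where j: "j < length vs" "vs ! j = w" using vs(1) assms(2) by (metis in_set_conv_nth subsetD)
    then have "Q j" using \<open>w \<in> W\<close> by (simp add: Q_def)
    then have "j \<le> i" unfolding i_def by (rule Greatest_le_nat[where b = "length vs"]) (auto simp: Q_def)
    then show "w \<in> X" unfolding X_def using j by (auto simp: in_set_conv_nth intro!: exI[of _ j])
  qed
  let ?v = "vs ! i"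
  have v: "?v \<in> W" "i < length vs" using i by (auto simp: Q_def i_def)
  have nb: "a \<in> nbh (induced_edges E X) b \<longleftrightarrow> {b, a} \<in> E \<and> a \<in> X \<and> b \<in> X" for a b
    by (auto simp: nbh_def induced_edges_def insert_commute)
  have "quasi_simple (induced_edges E X) ?v" using vs(2) v by (simp add: X_def)
  have *: "comparable (induced_edges E X) a b" if "a \<in> W" "b \<in> W" "{?v, a} \<in> E" "{?v, b} \<in> E" "a \<noteq> b" for a b
  proof -
    have "a \<in> nbh (induced_edges E X) ?v" "b \<in> nbh (induced_edges E X) ?v"
      unfolding nb using that WX v by blast+
    then show ?thesis using \<open>quasi_simple (induced_edges E X) ?v\<close> that(5)
      unfolding quasi_simple_def pairwise_def by blast
  qed
  have "qs W ?v" unfolding qs_def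
  proof (intro ballI impI)
    fix a b assume ab: "a \<in> W" "b \<in> W" "{?v, a} \<in> E" "{?v, b} \<in> E" "a \<noteq> b"
    have "vic W a b" if "nbh (induced_edges E X) a - {b} \<subseteq> nbh (induced_edges E X) b - {a}" "a \<in> W" "b \<in> W" for a b
      unfolding vic_def
    proof (intro ballI impI)
      fix z assume z: "z \<in> W" "{a, z} \<in> E" "z \<noteq> b"
      have "z \<in> nbh (induced_edges E X) a - {b}" using z that WX by (auto simp: nb)
      then show "{b, z} \<in> E" using that(1) nb by blast
    qed
    then show "vic W a b \<or> vic W b a" using *[OF ab] ab unfolding comparable_def by blast
  qed
  then show ?thesis using v by blast
qed

end

section \<open>Derived tests and invariants for loops\<close>

lemma tmp_neq_Cons [simp]:
  "c \<noteq> CHR ''q'' \<Longrightarrow> c # xs \<noteq> qv d" "c \<noteq> CHR ''q'' \<Longrightarrow> qv d \<noteq> c # xs"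
  "c \<noteq> CHR ''z'' \<Longrightarrow> c # xs \<noteq> zv d" "c \<noteq> CHR ''z'' \<Longrightarrow> zv d \<noteq> c # xs"
  by (auto simp: qv_def zv_def)

lemma tmp_Cons [simp]: "c \<noteq> CHR ''q'' \<Longrightarrow> c \<noteq> CHR ''z'' \<Longrightarrow> \<not> tmp (c # xs)"
  unfolding tmp_def by auto

declare sem.simps(4) [simp del]

definition "FOr f g = FNot (FAnd (FNot f) (FNot g))"
definition "FImp f g = FNot (FAnd f (FNot g))"
definition "FEx f = FNot (FAll (FNot f))"
definition "FEq a b = FAnd (FNot (FLess a b)) (FNot (FLess b a))"
definition "memF X a = FLess (Const 0) (Elem X a)"
definition "adjF X a b = FLess (Const 0) (Elem X (Add (Elem ''rows'' a) b))"
definition "cadjF a b = FOr (FEq a b) (adjF ''B'' a b)"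
definition "FSkip = FSet ''sk'' (Const 0) (Const 0)"
abbreviation "Q d \<equiv> Var (qv d)"

lemma fval_derived [simp]:
  "fval d (FOr f g) s \<longleftrightarrow> fval d f s \<or> fval d g s"
  "fval d (FImp f g) s \<longleftrightarrow> (fval d f s \<longrightarrow> fval d g s)"
  "fval d (FEx f) s \<longleftrightarrow> (\<exists>i<s ''n'' 0. fval (Suc d) f (upd s (qv d) 0 i))"
  "fval d (FEq a b) s \<longleftrightarrow> aval a s = aval b s"
  "fval d (memF X a) s \<longleftrightarrow> 0 < s X (aval a s)"
  "fval d (adjF X a b) s \<longleftrightarrow> 0 < s X (s ''rows'' (aval a s) + aval b s)"
  by (auto simp: FOr_def FImp_def FEx_def FEq_def memF_def adjF_def)

lemma fnames_derived [simp]: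
  "fnames (FOr f g) = fnames f \<union> fnames g" "fnames (FImp f g) = fnames f \<union> fnames g"
  "fnames (FEx f) = fnames f" "fnames (FEq a b) = anames a \<union> anames b"
  "fnames (memF X a) = insert X (anames a)"
  "fnames (adjF X a b) = insert X (insert ''rows'' (anames a \<union> anames b))"
  "fnames (cadjF a b) = insert ''B'' (insert ''rows'' (anames a \<union> anames b))"
  by (auto simp: FOr_def FImp_def FEx_def FEq_def memF_def adjF_def cadjF_def)

lemma writes_FSkip [simp]: "writes FSkip = {''sk''}"
  by (simp add: FSkip_def)

lemma wfc_FSkip [simp]: "wfc FSkip"
  by (simp add: FSkip_def)

lemma sem_FSkip [simp]: "sem FSkip s = upd s ''sk'' 0 0"
  by (simp add: FSkip_def)

text \<open>The step may assume that names not written by the loop still have their initial values;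
  \<open>I'\<close> is what remains once the counter has been reset.\<close>

lemma sem_For:
  assumes n: "s ''n'' 0 = n" "''n'' \<notin> insert x (writes c)"
    and "I 0 s"
    and step: "\<And>i t. i < n \<Longrightarrow> I i t \<Longrightarrow> (\<forall>y. y \<notin> insert x (writes c) \<longrightarrow> t y = s y) \<Longrightarrow>
       I (Suc i) (sem c (upd t x 0 i))"
    and "\<And>t. I n t \<Longrightarrow> I' (upd t x 0 0)"
  shows "I' (sem (FFor x c) s)"
proof -
  let ?g = "\<lambda>i. foldl (\<lambda>s i. sem c (upd s x 0 i)) s [0..<i]"
  have "I i (?g i) \<and> (\<forall>y. y \<notin> insert x (writes c) \<longrightarrow> ?g i y = s y)" if "i \<le> n" for i
    using that
  proof (induction i)
    case (Suc i)
    then have *: "i < n" "I i (?g i)" "\<forall>y. y \<notin> insert x (writes c) \<longrightarrow> ?g i y = s y" by auto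
    have "I (Suc i) (?g (Suc i))" using step[OF *] by simp
    moreover have "?g (Suc i) y = s y" if "y \<notin> insert x (writes c)" for y
      using *(3) that by (simp add: sem_other)
    ultimately show ?case by blast
  qed (use assms(3) in simp)
  from this[of n] show ?thesis using assms(1,5) by (simp add: sem.simps(4))
qed

definition "clear X = FFor ''i'' (FSet X (Var ''i'') (Const 0))"
definition "copy X Y = FFor ''i'' (FSet Y (Var ''i'') (Elem X (Var ''i'')))"

lemma writes_clear_copy [simp]:
  "writes (clear X) = {''i'', X}" "writes (copy X Y) = {''i'', Y}"
  by (auto simp: clear_def copy_def)

context graph
begin

definition has_graph :: "state \<Rightarrow> bool" where
  "has_graph s \<longleftrightarrow> s ''n'' 0 = n \<and> (\<forall>a<n. \<forall>b<n. 0 < s ''B'' (s ''rows'' a + b) \<longleftrightarrow> adj a b)"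

definition set_of :: "state \<Rightarrow> vname \<Rightarrow> nat set" where
  "set_of s X = {i. i < n \<and> 0 < s X i}"

lemma has_graph_n [simp]: "has_graph s \<Longrightarrow> s ''n'' 0 = n"
  by (simp add: has_graph_def)

lemma has_graph_adj [simp]:
  "has_graph s \<Longrightarrow> a < n \<Longrightarrow> b < n \<Longrightarrow> 0 < s ''B'' (s ''rows'' a + b) \<longleftrightarrow> adj a b"
  by (simp add: has_graph_def)

lemma has_graph_cong: "has_graph s \<Longrightarrow> t ''n'' = s ''n'' \<Longrightarrow> t ''B'' = s ''B'' \<Longrightarrow> t ''rows'' = s ''rows'' \<Longrightarrow> has_graph t"
  by (metis has_graph_def)

lemma has_graph_frame: "has_graph s \<Longrightarrow> \<forall>y. y \<notin> W \<longrightarrow> t y = s y \<Longrightarrow> {''n'', ''B'', ''rows''} \<inter> W = {} \<Longrightarrow> has_graph t"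
  by (rule has_graph_cong) blast+

lemma has_graph_sem: "has_graph s \<Longrightarrow> {''n'', ''B'', ''rows''} \<inter> writes c = {} \<Longrightarrow> has_graph (sem c s)"
  by (rule has_graph_frame) (auto simp: sem_other)

lemma has_graph_upd [simp]: "x \<notin> {''n'', ''B'', ''rows''} \<Longrightarrow> has_graph (upd s x i k) \<longleftrightarrow> has_graph s"
proof -
  assume "x \<notin> {''n'', ''B'', ''rows''}"
  then have "upd s x i k ''n'' = s ''n''" "upd s x i k ''B'' = s ''B''" "upd s x i k ''rows'' = s ''rows''"
    by auto
  then show ?thesis unfolding has_graph_def by (simp only:)
qed

lemma set_of_upd [simp]: "X \<noteq> Y \<Longrightarrow> set_of (upd s Y i k) X = set_of s X"
  by (simp add: set_of_def)

lemma set_of_insert [simp]: "i < n \<Longrightarrow> 0 < k \<Longrightarrow> set_of (upd s X i k) X = insert i (set_of s X)"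
  by (auto simp: set_of_def upd_apply)

lemma set_of_cong: "t X = s X \<Longrightarrow> set_of t X = set_of s X"
  by (simp add: set_of_def)

lemma set_of_frame: "\<forall>y. y \<notin> W \<longrightarrow> t y = s y \<Longrightarrow> X \<notin> W \<Longrightarrow> set_of t X = set_of s X"
  by (simp add: set_of_def)

lemma set_of_sem: "X \<notin> writes c \<Longrightarrow> set_of (sem c s) X = set_of s X"
  by (simp add: set_of_def sem_other)

lemma set_of_less: "set_of s X \<subseteq> {..<n}"
  by (auto simp: set_of_def)

lemma set_of_iff: "i < n \<Longrightarrow> 0 < s X i \<longleftrightarrow> i \<in> set_of s X"
  by (simp add: set_of_def)

lemma fval_cadjF [simp]:
  "has_graph s \<Longrightarrow> aval a s < n \<Longrightarrow> aval b s < n \<Longrightarrow> fval d (cadjF a b) s \<longleftrightarrow> cadj (aval a s) (aval b s)"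
  by (simp add: cadjF_def cadj_def)

lemma sem_clear: "s ''n'' 0 = n \<Longrightarrow> X \<noteq> ''n'' \<Longrightarrow> X \<noteq> ''i'' \<Longrightarrow> set_of (sem (clear X) s) X = {}"
  unfolding clear_def
  by (rule sem_For[where I = "\<lambda>i t. \<forall>j<i. t X j = 0" and I' = "\<lambda>t. set_of t X = {}" and n = n])
    (simp_all add: set_of_def less_Suc_eq upd_apply)

lemma sem_copy: "s ''n'' 0 = n \<Longrightarrow> Y \<noteq> ''n'' \<Longrightarrow> Y \<noteq> ''i'' \<Longrightarrow> X \<noteq> ''i'' \<Longrightarrow> X \<noteq> Y \<Longrightarrow>
  set_of (sem (copy X Y) s) Y = set_of s X"
  unfolding copy_def
  by (rule sem_For[where I = "\<lambda>i t. \<forall>j<i. t Y j = s X j" and I' = "\<lambda>t. set_of t Y = set_of s X" and n = n])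
    (auto simp: set_of_def less_Suc_eq upd_apply)

text \<open>Slots are visited in increasing order: the inner loop runs through the neighbour slots
  of a column, and \<open>c2\<close> serves its last slot. The invariant must be insensitive to the
  two counters, which are advanced and reset between slots.\<close>

lemma sem_slots:
  assumes s: "s ''n'' 0 = n" "''n'' \<notin> W" and W: "W = insert v (insert u (writes c1 \<union> writes c2))"
    and vu: "v \<noteq> u" "v \<notin> writes c1" "u \<notin> writes c1"
    and upd: "\<And>k t i. I k (upd t v 0 i) \<longleftrightarrow> I k t" "\<And>k t i. I k (upd t u 0 i) \<longleftrightarrow> I k t"
    and init: "I 0 s"
    and col: "\<And>a b t. a < n \<Longrightarrow> b < n \<Longrightarrow> I (slot a b) t \<Longrightarrow> t v 0 = a \<Longrightarrow> t u 0 = b \<Longrightarrow>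
      (\<forall>y. y \<notin> W \<longrightarrow> t y = s y) \<Longrightarrow> I (Suc (slot a b)) (sem c1 t)"
    and own: "\<And>a t. a < n \<Longrightarrow> I (slot a n) t \<Longrightarrow> t v 0 = a \<Longrightarrow>
      (\<forall>y. y \<notin> W \<longrightarrow> t y = s y) \<Longrightarrow> I (Suc (slot a n)) (sem c2 t)"
  shows "I (n * Suc n) (sem (FFor v (FSeq (FFor u c1) c2)) s)"
proof (rule sem_For[where I = "\<lambda>a. I (slot a 0)" and n = n])
  fix a t assume a: "a < n" "I (slot a 0) t" "\<forall>y. y \<notin> insert v (writes (FSeq (FFor u c1) c2)) \<longrightarrow> t y = s y"
  have W': "insert v (writes (FSeq (FFor u c1) c2)) = W" by (auto simp: W)
  let ?t = "upd t v 0 a"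
  have tn: "?t ''n'' 0 = n" using a s unfolding W' W by auto
  have "I (slot a n) (sem (FFor u c1) ?t) \<and> sem (FFor u c1) ?t v 0 = a"
  proof (rule sem_For[where I = "\<lambda>b r. I (slot a b) r \<and> r v 0 = a"
      and I' = "\<lambda>r. I (slot a n) r \<and> r v 0 = a" and n = n])
    show "?t ''n'' 0 = n" by (rule tn)
    show "''n'' \<notin> insert u (writes c1)" using s W by auto
    show "I (slot a 0) ?t \<and> ?t v 0 = a" using a upd by simp
    fix b r assume b: "b < n" "I (slot a b) r \<and> r v 0 = a" "\<forall>y. y \<notin> insert u (writes c1) \<longrightarrow> r y = ?t y"
    have fr: "\<forall>y. y \<notin> W \<longrightarrow> upd r u 0 b y = s y"
      using a(3) b(3) unfolding W' unfolding W by auto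
    have "I (Suc (slot a b)) (sem c1 (upd r u 0 b))"
      by (rule col) (use a b fr upd vu in auto)
    then show "I (slot a (Suc b)) (sem c1 (upd r u 0 b)) \<and> sem c1 (upd r u 0 b) v 0 = a"
      using b vu by (simp add: slot_def sem_other)
  next
    fix r assume "I (slot a n) r \<and> r v 0 = a"
    then show "I (slot a n) (upd r u 0 0) \<and> upd r u 0 0 v 0 = a" using upd vu by simp
  qed
  then have "I (Suc (slot a n)) (sem c2 (sem (FFor u c1) ?t))"
  proof (intro own)
    have "sem (FFor u c1) ?t y = s y" if "y \<notin> W" for y
    proof -
      have "sem (FFor u c1) ?t y = ?t y" using that W by (intro sem_other) auto
      also have "\<dots> = s y" using that a(3) unfolding W' by (auto simp: W)
      finally show ?thesis .
    qed
    then show "\<forall>y. y \<notin> W \<longrightarrow> sem (FFor u c1) ?t y = s y" by blast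
  qed (use a in auto)
  moreover have "Suc (slot a n) = slot (Suc a) 0" by (simp add: slot_def)
  ultimately show "I (slot (Suc a) 0) (sem (FSeq (FFor u c1) c2) ?t)" by (simp only: sem.simps)
next
  show "I (n * Suc n) (upd t v 0 0)" if "I (slot n 0) t" for t using that upd by (simp add: slot_def)
  show "''n'' \<notin> insert v (writes (FSeq (FFor u c1) c2))" using s W by auto
qed (use s init in \<open>simp_all add: slot_def\<close>)

end

section \<open>Greedy completion, scan prefixes and parents as programs\<close>

definition irrF :: "vname \<Rightarrow> vname \<Rightarrow> vname \<Rightarrow> fm" where
  "irrF S A w = (let M = (\<lambda>a. FOr (memF S a) (FOr (memF A a) (FEq a (Var w)))) in
     FAll (FImp (M (Q 0)) (FEx (FAnd (cadjF (Q 0) (Q (Suc 0)))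
       (FAll (FImp (FAnd (M (Q (Suc (Suc 0)))) (cadjF (Q (Suc 0)) (Q (Suc (Suc 0))))) (FEq (Q (Suc (Suc 0))) (Q 0))))))))"

definition colF :: "vname \<Rightarrow> vname \<Rightarrow> vname \<Rightarrow> fm" where
  "colF S v u = FAnd (adjF ''B'' (Var v) (Var u)) (FAll (FImp (memF S (Q 0)) (FNot (adjF ''B'' (Var v) (Q 0)))))"

definition eqF :: "vname \<Rightarrow> vname \<Rightarrow> fm" where
  "eqF X Y = FAll (FAnd (FImp (memF X (Q 0)) (memF Y (Q 0))) (FImp (memF Y (Q 0)) (memF X (Q 0))))"

definition LBp :: "vname \<Rightarrow> vname \<Rightarrow> fcom" where
  "LBp A S = FSeq (clear S)
     (FFor ''v'' (FSeq
       (FFor ''u'' (FIf (FAnd (colF S ''v'' ''u'') (irrF S A ''u'')) (FSet S (Var ''u'') (Const 1)) FSkip))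
       (FIf (irrF S A ''v'') (FSet S (Var ''v'') (Const 1)) FSkip)))"

lemma writes_LBp [simp]: "writes (LBp A S) = {''i'', ''v'', ''u'', ''sk'', S}"
  by (auto simp: LBp_def)

text \<open>The prefix of \<open>R\<close> up to the slot given by \<open>cv\<close> and \<open>cu\<close>, inclusively; \<open>cu = cv\<close> denotes the
  last slot of the column \<open>cv\<close>.\<close>

definition PREp :: "vname \<Rightarrow> vname \<Rightarrow> fcom" where
  "PREp R S = FSeq (clear S) (FSeq (FSet ''stop'' (Const 0) (Const 0))
     (FFor ''v'' (FSeq
       (FFor ''u'' (FSeq
         (FIf (FAnd (FEq (Var ''stop'') (Const 0)) (FAnd (memF R (Var ''u'')) (colF S ''v'' ''u'')))
            (FSet S (Var ''u'') (Const 1)) FSkip)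
         (FIf (FAnd (FNot (FEq (Var ''cv'') (Var ''cu''))) (FAnd (FEq (Var ''v'') (Var ''cv'')) (FEq (Var ''u'') (Var ''cu''))))
            (FSet ''stop'' (Const 0) (Const 1)) FSkip)))
       (FSeq
         (FIf (FAnd (FEq (Var ''stop'') (Const 0)) (memF R (Var ''v'')))
            (FSet S (Var ''v'') (Const 1)) FSkip)
         (FIf (FAnd (FEq (Var ''cv'') (Var ''cu'')) (FEq (Var ''v'') (Var ''cv'')))
            (FSet ''stop'' (Const 0) (Const 1)) FSkip)))))"

lemma writes_PREp [simp]: "writes (PREp R S) = {''i'', ''v'', ''u'', ''sk'', ''stop'', S}"
  by (auto simp: PREp_def)

definition tryp :: "vname \<Rightarrow> fcom" where
  "tryp J = FSeq (LBp ''ps'' ''pl'')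
     (FIf (eqF ''pl'' J) FSkip (FSeq (copy ''pl'' ''par'') (FSet ''root'' (Const 0) (Const 0))))"

text \<open>Each prefix is tested before its slot is processed, and a prefix whose completion
  differs from \<open>J\<close> overwrites the earlier result; so the last one survives, as
  \<open>branch\<close> demands. If there is none, \<open>root\<close> stays 1.\<close>

definition PARp :: "vname \<Rightarrow> fcom" where
  "PARp J = FSeq (clear ''ps'') (FSeq (FSet ''root'' (Const 0) (Const 1))
     (FFor ''pv'' (FSeq
       (FFor ''pu'' (FSeq (tryp J)
         (FIf (FAnd (memF J (Var ''pu'')) (colF ''ps'' ''pv'' ''pu'')) (FSet ''ps'' (Var ''pu'') (Const 1)) FSkip)))
       (FSeq (tryp J)
         (FIf (memF J (Var ''pv'')) (FSet ''ps'' (Var ''pv'') (Const 1)) FSkip)))))"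

lemma writes_tryp [simp]: "writes (tryp J) = {''i'', ''v'', ''u'', ''sk'', ''pl'', ''par'', ''root''}"
  by (auto simp: tryp_def)

lemma writes_PARp [simp]:
  "writes (PARp J) = {''i'', ''v'', ''u'', ''sk'', ''pl'', ''par'', ''root'', ''pv'', ''pu'', ''ps''}"
  by (auto simp: PARp_def)

context graph
begin

lemma fval_irrF:
  assumes "has_graph s" "\<not> tmp S" "\<not> tmp A" "\<not> tmp w" "s w 0 < n"
  shows "fval 0 (irrF S A w) s \<longleftrightarrow> irr (insert (s w 0) (set_of s S \<union> set_of s A))"
proof -
  have "fval 0 (irrF S A w) s \<longleftrightarrow> (\<forall>x<n. (0 < s S x \<or> 0 < s A x \<or> x = s w 0) \<longrightarrow>
    (\<exists>y<n. cadj x y \<and> (\<forall>z<n. (0 < s S z \<or> 0 < s A z \<or> z = s w 0) \<and> cadj y z \<longrightarrow> z = x)))"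
    using assms by (simp add: irrF_def Let_def cong: conj_cong)
  also have "\<dots> \<longleftrightarrow> irr (insert (s w 0) (set_of s S \<union> set_of s A))" (is "?l \<longleftrightarrow> ?r")
  proof
    assume ?l
    show ?r unfolding irr_def pvt_def
    proof
      fix x assume "x \<in> insert (s w 0) (set_of s S \<union> set_of s A)"
      then have "x < n" "0 < s S x \<or> 0 < s A x \<or> x = s w 0" using assms(5) by (auto simp: set_of_def)
      with \<open>?l\<close> obtain y where "cadj x y" "\<forall>z<n. (0 < s S z \<or> 0 < s A z \<or> z = s w 0) \<and> cadj y z \<longrightarrow> z = x"
        by blast
      then show "\<exists>y. cadj x y \<and> (\<forall>z\<in>insert (s w 0) (set_of s S \<union> set_of s A). cadj y z \<longrightarrow> z = x)"
        using assms(5) by (intro exI[of _ y]) (auto simp: set_of_def)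
    qed
  next
    assume r: ?r
    show ?l
    proof (intro allI impI)
      fix x assume x: "x < n" "0 < s S x \<or> 0 < s A x \<or> x = s w 0"
      then have "x \<in> insert (s w 0) (set_of s S \<union> set_of s A)" by (auto simp: set_of_def)
      with r obtain y where y: "cadj x y" "\<forall>z\<in>insert (s w 0) (set_of s S \<union> set_of s A). cadj y z \<longrightarrow> z = x"
        unfolding irr_def pvt_def by blast
      have "y < n" using y(1) x adj_less adj_sym by (auto simp: cadj_def)
      then show "\<exists>y<n. cadj x y \<and> (\<forall>z<n. (0 < s S z \<or> 0 < s A z \<or> z = s w 0) \<and> cadj y z \<longrightarrow> z = x)"
        using y by (intro exI[of _ y]) (auto simp: set_of_def)
    qed
  qed
  finally show ?thesis .
qed

lemma fval_colF:
  assumes "has_graph s" "\<not> tmp S" "\<not> tmp v" "\<not> tmp u" "s v 0 < n" "s u 0 < n"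
  shows "fval 0 (colF S v u) s \<longleftrightarrow> grd (slot (s v 0) (s u 0)) (set_of s S)"
  using assms adj_less adj_sym by (auto simp: colF_def grd_slot set_of_def)

lemma fval_eqF:
  assumes "s ''n'' 0 = n" "\<not> tmp X" "\<not> tmp Y"
  shows "fval 0 (eqF X Y) s \<longleftrightarrow> set_of s X = set_of s Y"
  using assms by (auto simp: eqF_def set_of_def)

lemma sem_LBp:
  assumes s: "has_graph s" and A: "\<not> tmp A" "A \<notin> {''i'', ''v'', ''u'', ''sk''}"
    and S: "\<not> tmp S" "S \<notin> {''i'', ''v'', ''u'', ''sk'', ''n'', ''B'', ''rows'', A}"
  shows "set_of (sem (LBp A S) s) S = LB (set_of s A)"
proof -
  let ?s = "sem (clear S) s"
  let ?A = "set_of s A"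
  have fr: "?s y = s y" if "y \<noteq> ''i''" "y \<noteq> S" for y using that by (intro sem_other) auto
  have G: "has_graph ?s" by (rule has_graph_sem[OF s]) (use S in auto)
  have "set_of (sem (FFor ''v'' (FSeq
       (FFor ''u'' (FIf (FAnd (colF S ''v'' ''u'') (irrF S A ''u'')) (FSet S (Var ''u'') (Const 1)) FSkip))
       (FIf (irrF S A ''v'') (FSet S (Var ''v'') (Const 1)) FSkip))) ?s) S = lb ?A (n * Suc n)"
  proof (rule sem_slots[where I = "\<lambda>k t. set_of t S = lb ?A k" and W = "{''v'', ''u'', ''sk'', S}"])
    show "set_of ?s S = lb ?A 0" using sem_clear[of s S] S s by simp
    fix a b t assume h: "a < n" "b < n" "set_of t S = lb ?A (slot a b)" "t ''v'' 0 = a" "t ''u'' 0 = b"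
      "\<forall>y. y \<notin> {''v'', ''u'', ''sk'', S} \<longrightarrow> t y = ?s y"
    have Gt: "has_graph t" by (rule has_graph_frame[OF G h(6)]) (use S in auto)
    have "set_of t A = set_of ?s A" by (rule set_of_frame[OF h(6)]) (use A S in auto)
    also have "\<dots> = ?A" by (rule set_of_sem) (use A S in auto)
    finally have "set_of t A = ?A" .
    then show "set_of (sem (FIf (FAnd (colF S ''v'' ''u'') (irrF S A ''u'')) (FSet S (Var ''u'') (Const 1)) FSkip) t) S
        = lb ?A (Suc (slot a b))"
      using h Gt A S by (simp add: fval_colF fval_irrF lb_Suc tgt_slot)
  next
    fix a t assume h: "a < n" "set_of t S = lb ?A (slot a n)" "t ''v'' 0 = a"
      "\<forall>y. y \<notin> {''v'', ''u'', ''sk'', S} \<longrightarrow> t y = ?s y"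
    have Gt: "has_graph t" by (rule has_graph_frame[OF G h(4)]) (use S in auto)
    have "set_of t A = set_of ?s A" by (rule set_of_frame[OF h(4)]) (use A S in auto)
    also have "\<dots> = ?A" by (rule set_of_sem) (use A S in auto)
    finally have "set_of t A = ?A" .
    then show "set_of (sem (FIf (irrF S A ''v'') (FSet S (Var ''v'') (Const 1)) FSkip) t) S
        = lb ?A (Suc (slot a n))"
      using h Gt A S by (simp add: fval_irrF lb_Suc tgt_slot grd_slot)
  next
    show "?s ''n'' 0 = n" by (rule has_graph_n[OF G])
  qed (use S in auto)
  then show ?thesis by (simp add: LBp_def)
qed

lemma sem_PREp:
  assumes s: "has_graph s"
    and c: "s ''cv'' 0 < n" "s ''cu'' 0 < n"
  defines "K \<equiv> slot (s ''cv'' 0) (if s ''cu'' 0 = s ''cv'' 0 then n else s ''cu'' 0)"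
  shows "set_of (sem (PREp ''R'' ''P'') s) ''P'' = pre (set_of s ''R'') (Suc K)"
proof -
  let ?s = "upd (sem (clear ''P'') s) ''stop'' 0 0"
  let ?R = "set_of s ''R''"
  have fr: "?s y = s y" if "y \<noteq> ''i''" "y \<noteq> ''P''" "y \<noteq> ''stop''" for y using that by (simp add: sem_other)
  have G: "has_graph ?s" using has_graph_sem[OF s, of "clear ''P''"] by simp
  have cvu: "?s ''cv'' = s ''cv''" "?s ''cu'' = s ''cu''"
    using fr[of "''cv''"] fr[of "''cu''"] by simp_all
  have sR: "set_of ?s ''R'' = ?R" by (intro set_of_cong fr) auto
  \<comment> \<open>Once slot \<open>K\<close> is done the flag is set and the prefix stays frozen,
    hence the minimum.\<close>
  define I where "I k t \<longleftrightarrow> set_of t ''P'' = pre ?R (min k (Suc K)) \<and> t ''stop'' 0 = (if k \<le> K then 0 else 1)" for k t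
  let ?c1 = "FSeq
         (FIf (FAnd (FEq (Var ''stop'') (Const 0)) (FAnd (memF ''R'' (Var ''u'')) (colF ''P'' ''v'' ''u'')))
            (FSet ''P'' (Var ''u'') (Const 1)) FSkip)
         (FIf (FAnd (FNot (FEq (Var ''cv'') (Var ''cu''))) (FAnd (FEq (Var ''v'') (Var ''cv'')) (FEq (Var ''u'') (Var ''cu''))))
            (FSet ''stop'' (Const 0) (Const 1)) FSkip)"
  let ?c2 = "FSeq
         (FIf (FAnd (FEq (Var ''stop'') (Const 0)) (memF ''R'' (Var ''v'')))
            (FSet ''P'' (Var ''v'') (Const 1)) FSkip)
         (FIf (FAnd (FEq (Var ''cv'') (Var ''cu'')) (FEq (Var ''v'') (Var ''cv'')))
            (FSet ''stop'' (Const 0) (Const 1)) FSkip)"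
  have "I (n * Suc n) (sem (FFor ''v'' (FSeq (FFor ''u'' ?c1) ?c2)) ?s)"
  proof (rule sem_slots[where I = I and W = "{''v'', ''u'', ''sk'', ''stop'', ''P''}"])
    have "set_of (sem (clear ''P'') s) ''P'' = {}" using sem_clear[of s "''P''"] s by simp
    then show "I 0 ?s" by (simp add: I_def)
    fix a b t assume h: "a < n" "b < n" "I (slot a b) t" "t ''v'' 0 = a" "t ''u'' 0 = b"
      "\<forall>y. y \<notin> {''v'', ''u'', ''sk'', ''stop'', ''P''} \<longrightarrow> t y = ?s y"
    have Gt: "has_graph t" by (rule has_graph_frame[OF G h(6)]) simp
    have Rt: "t ''R'' b > 0 \<longleftrightarrow> b \<in> ?R"
      using set_of_frame[OF h(6), of "''R''"] sR set_of_iff[OF h(2), of t "''R''"] by auto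
    have ct: "t ''cv'' = s ''cv''" "t ''cu'' = s ''cu''"
      using spec[OF h(6), of "''cv''"] spec[OF h(6), of "''cu''"] cvu by simp_all
    \<comment> \<open>No vertex is its own neighbour, so a pair with equal entries is free to denote
      the last slot of the column.\<close>
    have eq: "slot a b = K \<longleftrightarrow> s ''cv'' 0 \<noteq> s ''cu'' 0 \<and> a = s ''cv'' 0 \<and> b = s ''cu'' 0"
      using slot_div_mod[of b a] slot_div_mod[of "if s ''cu'' 0 = s ''cv'' 0 then n else s ''cu'' 0" "s ''cv'' 0"] h(2) c
      unfolding K_def by (auto split: if_splits)
    have tK: "slot a b = K \<longrightarrow> tgt K = b" using tgt_slot(1)[OF h(2), of a] by auto
    show "I (Suc (slot a b)) (sem ?c1 t)"
      using h(1-5) Gt ct Rt eq tK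
      by (cases rule: linorder_cases[of "slot a b" K])
        (simp_all add: I_def fval_colF pre_Suc tgt_slot)
  next
    fix a t assume h: "a < n" "I (slot a n) t" "t ''v'' 0 = a"
      "\<forall>y. y \<notin> {''v'', ''u'', ''sk'', ''stop'', ''P''} \<longrightarrow> t y = ?s y"
    have Rt: "t ''R'' a > 0 \<longleftrightarrow> a \<in> ?R"
      using set_of_frame[OF h(4), of "''R''"] sR set_of_iff[OF h(1), of t "''R''"] by auto
    have ct: "t ''cv'' = s ''cv''" "t ''cu'' = s ''cu''"
      using spec[OF h(4), of "''cv''"] spec[OF h(4), of "''cu''"] cvu by simp_all
    have eq: "slot a n = K \<longleftrightarrow> s ''cv'' 0 = s ''cu'' 0 \<and> a = s ''cv'' 0"
      using slot_div_mod[of n a] slot_div_mod[of "if s ''cu'' 0 = s ''cv'' 0 then n else s ''cu'' 0" "s ''cv'' 0"] c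
      unfolding K_def by (auto split: if_splits)
    have tK: "slot a n = K \<longrightarrow> tgt K = a \<and> (\<forall>S. grd K S)"
      using tgt_slot(2)[of a] grd_slot(2)[of a] by auto
    show "I (Suc (slot a n)) (sem ?c2 t)"
      using h(1-3) ct Rt eq tK
      by (cases rule: linorder_cases[of "slot a n" K])
        (simp_all add: I_def pre_Suc tgt_slot grd_slot)
  next
    show "?s ''n'' 0 = n" by (rule has_graph_n[OF G])
  qed (auto simp: I_def)
  moreover have "K < n * Suc n" unfolding K_def using slot_bound c by simp
  then have "min (n * Suc n) (Suc K) = Suc K" by (simp add: min_def del: mult_Suc_right)
  ultimately show ?thesis unfolding PREp_def I_def by (simp only: sem.simps(1,2) aval.simps)
qed

definition par_inv :: "nat set \<Rightarrow> nat \<Rightarrow> state \<Rightarrow> bool" where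
  "par_inv J k t \<longleftrightarrow> (t ''root'' 0 = (if \<exists>j<k. LB (pre J j) \<noteq> J then 0 else 1)) \<and>
     ((\<exists>j<k. LB (pre J j) \<noteq> J) \<longrightarrow> set_of t ''par'' = LB (pre J (GREATEST j. j < k \<and> LB (pre J j) \<noteq> J)))"

lemma par_inv_upd [simp]: "x \<notin> {''root'', ''par''} \<Longrightarrow> par_inv J k (upd t x i j) \<longleftrightarrow> par_inv J k t"
proof -
  assume "x \<notin> {''root'', ''par''}"
  then have "upd t x i j ''root'' = t ''root''" "upd t x i j ''par'' = t ''par''" by auto
  then show ?thesis unfolding par_inv_def set_of_def by (simp only:)
qed

lemma sem_tryp:
  assumes t: "has_graph t" "set_of t ''ps'' = pre (set_of t J) k" "par_inv (set_of t J) k t"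
    and J: "\<not> tmp J" "J \<notin> {''i'', ''v'', ''u'', ''sk'', ''pl'', ''par'', ''root'', ''ps'', ''pv'', ''pu''}"
  shows "par_inv (set_of t J) (Suc k) (sem (tryp J) t)"
proof -
  let ?J = "set_of t J" let ?l = "LB (pre ?J k)"
  let ?t = "sem (LBp ''ps'' ''pl'') t"
  have fr: "?t y = t y" if "y \<notin> {''i'', ''v'', ''u'', ''sk'', ''pl''}" for y
    using that by (intro sem_other) auto
  have pl: "set_of ?t ''pl'' = ?l" using sem_LBp[of t "''ps''" "''pl''"] t by simp
  have tJ: "set_of ?t J = ?J" using J by (intro set_of_cong fr) auto
  have tn: "?t ''n'' 0 = n" using fr[of "''n''"] t by simp
  have eq: "fval 0 (eqF ''pl'' J) ?t \<longleftrightarrow> ?l = ?J"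
    using fval_eqF[of ?t "''pl''" J] tn J pl tJ by simp
  show ?thesis
  proof (cases "?l = ?J")
    case True
    then have *: "j < Suc k \<and> LB (pre ?J j) \<noteq> ?J \<longleftrightarrow> j < k \<and> LB (pre ?J j) \<noteq> ?J" for j
      by (auto simp: less_Suc_eq)
    have "par_inv ?J k ?t" using t(3) fr[of "''root''"] fr[of "''par''"]
      by (simp add: par_inv_def set_of_def)
    then have "par_inv ?J (Suc k) ?t" unfolding par_inv_def * .
    then show ?thesis using eq True by (simp add: tryp_def)
  next
    case False
    have "(GREATEST j. j < Suc k \<and> LB (pre ?J j) \<noteq> ?J) = k"
      by (rule Greatest_equality) (use False in auto)
    then show ?thesis using eq False sem_copy[of ?t "''par''" "''pl''"] tn pl
      by (auto simp: tryp_def par_inv_def)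
  qed
qed

lemma sem_PARp:
  assumes s: "has_graph s"
    and J: "\<not> tmp J" "J \<notin> {''i'', ''v'', ''u'', ''sk'', ''pl'', ''par'', ''root'', ''ps'', ''pv'', ''pu''}"
  shows "sem (PARp J) s ''root'' 0 = (if has_parent (set_of s J) then 0 else 1)"
    "has_parent (set_of s J) \<Longrightarrow> set_of (sem (PARp J) s) ''par'' = parent (set_of s J)"
proof -
  let ?s = "upd (sem (clear ''ps'') s) ''root'' 0 1"
  let ?J = "set_of s J"
  define W where "W = {''i'', ''v'', ''u'', ''sk'', ''pl'', ''par'', ''root'', ''ps'', ''pv'', ''pu''}"
  have fr: "?s y = s y" if "y \<notin> W" for y using that by (simp add: W_def sem_other)
  have G: "has_graph ?s" using has_graph_sem[OF s, of "clear ''ps''"] by simp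
  define I where "I k t \<longleftrightarrow> set_of t ''ps'' = pre ?J k \<and> par_inv ?J k t" for k t
  let ?c1 = "FSeq (tryp J)
         (FIf (FAnd (memF J (Var ''pu'')) (colF ''ps'' ''pv'' ''pu'')) (FSet ''ps'' (Var ''pu'') (Const 1)) FSkip)"
  let ?c2 = "FSeq (tryp J)
         (FIf (memF J (Var ''pv'')) (FSet ''ps'' (Var ''pv'') (Const 1)) FSkip)"
  have *: "has_graph (sem (tryp J) t) \<and> par_inv ?J (Suc k) (sem (tryp J) t) \<and> 
      set_of (sem (tryp J) t) ''ps'' = pre ?J k \<and> set_of (sem (tryp J) t) J = ?J \<and>
      sem (tryp J) t ''pv'' = t ''pv'' \<and> sem (tryp J) t ''pu'' = t ''pu''"
    if h: "I k t" "\<forall>y. y \<notin> W \<longrightarrow> t y = ?s y" for k t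
  proof -
    have Gt: "has_graph t" by (rule has_graph_frame[OF G h(2)]) (auto simp: W_def)
    have "J \<notin> W" using J by (simp add: W_def)
    then have tJ: "set_of t J = ?J" using h(2) fr by (intro set_of_cong) auto
    have fr2: "sem (tryp J) t y = t y" if "y \<notin> {''i'', ''v'', ''u'', ''sk'', ''pl'', ''par'', ''root''}" for y
      using that by (intro sem_other) auto
    have "has_graph (sem (tryp J) t)" by (rule has_graph_cong[OF Gt]) (auto simp: fr2)
    moreover have "set_of (sem (tryp J) t) ''ps'' = set_of t ''ps''" by (intro set_of_cong fr2) auto
    moreover have "set_of (sem (tryp J) t) J = set_of t J" by (intro set_of_cong fr2) (use J in auto)
    ultimately show ?thesis using sem_tryp[OF Gt _ _ J, of k] h(1) tJ by (simp add: I_def fr2)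
  qed
  have "I (n * Suc n) (sem (FFor ''pv'' (FSeq (FFor ''pu'' ?c1) ?c2)) ?s)"
  proof (rule sem_slots[where I = I and W = W])
    have "set_of (sem (clear ''ps'') s) ''ps'' = {}" using sem_clear[of s "''ps''"] s by simp
    then show "I 0 ?s" by (simp add: I_def par_inv_def)
    fix a b t assume h: "a < n" "b < n" "I (slot a b) t" "t ''pv'' 0 = a" "t ''pu'' 0 = b"
      "\<forall>y. y \<notin> W \<longrightarrow> t y = ?s y"
    show "I (Suc (slot a b)) (sem ?c1 t)"
    proof -
      let ?r = "sem (tryp J) t"
      note r = *[OF h(3,6)]
      have "b \<in> ?J \<longleftrightarrow> 0 < ?r J b" using r h(2) by (metis set_of_iff)
      then show ?thesis using r h(1,2,4,5) J by (simp add: I_def fval_colF pre_Suc tgt_slot)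
    qed
  next
    fix a t assume h: "a < n" "I (slot a n) t" "t ''pv'' 0 = a" "\<forall>y. y \<notin> W \<longrightarrow> t y = ?s y"
    show "I (Suc (slot a n)) (sem ?c2 t)"
    proof -
      let ?r = "sem (tryp J) t"
      note r = *[OF h(2,4)]
      have "a \<in> ?J \<longleftrightarrow> 0 < ?r J a" using r h(1) by (metis set_of_iff)
      then show ?thesis using r h(1,3) J by (simp add: I_def pre_Suc tgt_slot grd_slot)
    qed
  next
    show "?s ''n'' 0 = n" by (rule has_graph_n[OF G])
    show "W = insert ''pv'' (insert ''pu'' (writes ?c1 \<union> writes ?c2))"
      by (simp add: W_def insert_commute)
    show "I k (upd t ''pv'' 0 i) = I k t" "I k (upd t ''pu'' 0 i) = I k t" for k t i
      by (simp_all add: I_def)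
  qed (simp_all add: W_def)
  then have fin: "par_inv ?J (n * Suc n) (sem (PARp J) s)"
    unfolding I_def PARp_def by (simp only: sem.simps(1,2) aval.simps)
  show "sem (PARp J) s ''root'' 0 = (if has_parent ?J then 0 else 1)"
    "has_parent ?J \<Longrightarrow> set_of (sem (PARp J) s) ''par'' = parent ?J"
    using fin unfolding par_inv_def has_parent_def parent_def branch_def by blast+
qed

end

section \<open>Finding the next sibling by exhaustive search\<close>

definition sless :: "nat set \<Rightarrow> nat set \<Rightarrow> bool" where
  "sless A B \<longleftrightarrow> (\<exists>x. x \<in> B \<and> x \<notin> A \<and> (\<forall>y<x. y \<in> A \<longleftrightarrow> y \<in> B))"

lemma sless_irrefl: "\<not> sless A A"
  by (auto simp: sless_def)

lemma sless_trans: "sless A B \<Longrightarrow> sless B C \<Longrightarrow> sless A C"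
proof -
  assume "sless A B" "sless B C"
  then obtain x y where x: "x \<in> B" "x \<notin> A" "\<And>z. z < x \<Longrightarrow> z \<in> A \<longleftrightarrow> z \<in> B"
    and y: "y \<in> C" "y \<notin> B" "\<And>z. z < y \<Longrightarrow> z \<in> B \<longleftrightarrow> z \<in> C" by (auto simp: sless_def)
  have "x \<noteq> y" using x y by auto
  then consider "x < y" | "y < x" by linarith
  then show "sless A C"
  proof cases
    case 1
    then show ?thesis unfolding sless_def using x y by (intro exI[of _ x]) auto
  next
    case 2
    then show ?thesis unfolding sless_def using x y by (intro exI[of _ y]) auto
  qed
qed

lemma sless_linear: "A \<noteq> B \<Longrightarrow> sless A B \<or> sless B A"
proof -
  assume "A \<noteq> B"
  then have ex: "\<exists>x. (x \<in> A) \<noteq> (x \<in> B)" by blast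
  define x where "x = (LEAST x. (x \<in> A) \<noteq> (x \<in> B))"
  have "(x \<in> A) \<noteq> (x \<in> B)" unfolding x_def using ex by (rule LeastI_ex)
  moreover have "(y \<in> A) = (y \<in> B)" if "y < x" for y
    using not_less_Least that unfolding x_def by blast
  ultimately show ?thesis unfolding sless_def by (cases "x \<in> B") auto
qed

text \<open>Lets the empty set serve as lower bound when the first child is sought.\<close>

lemma sless_empty: "B \<noteq> {} \<Longrightarrow> sless {} B"
  using sless_linear[of "{}" B] by (auto simp: sless_def)

primrec fors :: "vname list \<Rightarrow> fcom \<Rightarrow> fcom" where
  "fors [] c = c"
| "fors (x # xs) c = FFor x (fors xs c)"

lemma writes_fors [simp]: "writes (fors xs c) = set xs \<union> writes c"
  by (induction xs) auto

lemma fors_invariant: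
  assumes "distinct xs" "set xs \<inter> writes c = {}" "''n'' \<notin> set xs \<union> writes c"
    and "\<And>s x i. x \<in> set xs \<Longrightarrow> N s \<Longrightarrow> N (upd s x 0 i)"
    and "\<And>s. N s \<Longrightarrow> \<forall>x\<in>set xs. s x 0 < n \<Longrightarrow> N (sem c s)"
    and "N s" "s ''n'' 0 = n"
  shows "N (sem (fors xs c) s)"
  using assms
proof (induction xs arbitrary: N s)
  case (Cons x xs)
  show ?case unfolding fors.simps
  proof (rule sem_For[where I = "\<lambda>_. N" and I' = N and n = n])
    fix i t assume t: "i < n" "N t" "\<forall>y. y \<notin> insert x (writes (fors xs c)) \<longrightarrow> t y = s y"
    have "N (sem (fors xs c) (upd t x 0 i)) \<and> sem (fors xs c) (upd t x 0 i) x 0 = i"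
    proof (rule Cons.IH[where N = "\<lambda>s. N s \<and> s x 0 = i"])
      show "N (upd s y 0 j) \<and> upd s y 0 j x 0 = i" if "y \<in> set xs" "N s \<and> s x 0 = i" for s y j
        proof -
          have "x \<noteq> y" using that Cons.prems(1) by auto
          then show ?thesis using that Cons.prems(1,4) by auto
        qed
      show "N (sem c s) \<and> sem c s x 0 = i" if "N s \<and> s x 0 = i" "\<forall>x\<in>set xs. s x 0 < n" for s
        using that Cons.prems(2,5) t(1) by (auto simp: sem_other)
      have "t ''n'' = s ''n''" using t(3) Cons.prems(3) by simp
      then show "upd t x 0 i ''n'' 0 = n" using Cons.prems(3,7) by auto
    qed (use Cons.prems t in auto)
    then show "N (sem (fors xs c) (upd t x 0 i))" by simp
  qed (use Cons.prems in auto)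
qed simp

text \<open>\<open>N\<close> is preserved by all rounds; \<open>E\<close> is established by the
  round whose counters equal \<open>val\<close> and preserved by later ones. This shows that an
  exhaustive search does not miss a given tuple.\<close>

lemma fors_reach:
  assumes "distinct xs" "set xs \<inter> writes c = {}" "''n'' \<notin> set xs \<union> writes c"
    and "\<And>s x i. x \<in> set xs \<Longrightarrow> N s \<Longrightarrow> N (upd s x 0 i)"
    and "\<And>s x i. x \<in> set xs \<Longrightarrow> E s \<Longrightarrow> E (upd s x 0 i)"
    and "\<And>s. N s \<Longrightarrow> \<forall>x\<in>set xs. s x 0 < n \<Longrightarrow> N (sem c s)"
    and "\<And>s. N s \<Longrightarrow> E s \<Longrightarrow> \<forall>x\<in>set xs. s x 0 < n \<Longrightarrow> E (sem c s)"
    and "\<And>s. N s \<Longrightarrow> \<forall>x\<in>set xs. s x 0 = val x \<Longrightarrow> E (sem c s)"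
    and "\<And>x. x \<in> set xs \<Longrightarrow> val x < n"
    and "N s" "s ''n'' 0 = n"
  shows "E (sem (fors xs c) s)"
  using assms
proof (induction xs arbitrary: N s)
  case (Cons x xs)
  have v: "val x < n" using Cons.prems(9) by simp
  show ?case unfolding fors.simps
  proof (rule sem_For[where I = "\<lambda>i t. N t \<and> (val x < i \<longrightarrow> E t)" and I' = E and n = n])
    fix i t assume t: "i < n" "N t \<and> (val x < i \<longrightarrow> E t)" "\<forall>y. y \<notin> insert x (writes (fors xs c)) \<longrightarrow> t y = s y"
    let ?t = "upd t x 0 i"
    have "t ''n'' = s ''n''" using t(3) Cons.prems(3) by simp
    then have tn: "?t ''n'' 0 = n" using Cons.prems(3,11) by auto
    have N: "N (sem (fors xs c) ?t) \<and> sem (fors xs c) ?t x 0 = i"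
    proof (rule fors_invariant[where N = "\<lambda>s. N s \<and> s x 0 = i"])
      show "N (upd s y 0 j) \<and> upd s y 0 j x 0 = i" if "y \<in> set xs" "N s \<and> s x 0 = i" for s y j
        proof -
          have "x \<noteq> y" using that Cons.prems(1) by auto
          then show ?thesis using that Cons.prems(1,4) by auto
        qed
      show "N (sem c s) \<and> sem c s x 0 = i" if "N s \<and> s x 0 = i" "\<forall>x\<in>set xs. s x 0 < n" for s
        using that Cons.prems(2,6) t(1) by (auto simp: sem_other)
    qed (use Cons.prems t tn in auto)
    moreover have "E (sem (fors xs c) ?t)" if "val x < Suc i"
    proof (cases "val x = i")
      case True
      show ?thesis
      proof (rule Cons.IH[where N = "\<lambda>s. N s \<and> s x 0 = i"])
        show "N (upd s y 0 j) \<and> upd s y 0 j x 0 = i" if "y \<in> set xs" "N s \<and> s x 0 = i" for s y j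
        proof -
          have "x \<noteq> y" using that Cons.prems(1) by auto
          then show ?thesis using that Cons.prems(1,4) by auto
        qed
        show "N (sem c s) \<and> sem c s x 0 = i" if "N s \<and> s x 0 = i" "\<forall>x\<in>set xs. s x 0 < n" for s
          using that Cons.prems(2,6) t(1) by (auto simp: sem_other)
        show "E (sem c s)" if "N s \<and> s x 0 = i" "E s" "\<forall>x\<in>set xs. s x 0 < n" for s
          using that Cons.prems(7) t(1) by auto
        show "E (sem c s)" if "N s \<and> s x 0 = i" "\<forall>x\<in>set xs. s x 0 = val x" for s
          using that Cons.prems(8) True by auto
      qed (use Cons.prems t tn in auto)
    next
      case False
      then have Et: "E t" using that t(2) by simp
      have "(N (sem (fors xs c) ?t) \<and> sem (fors xs c) ?t x 0 = i) \<and> E (sem (fors xs c) ?t)"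
      proof (rule fors_invariant[where N = "\<lambda>s. (N s \<and> s x 0 = i) \<and> E s"])
        show "(N (upd s y 0 j) \<and> upd s y 0 j x 0 = i) \<and> E (upd s y 0 j)" if "y \<in> set xs" "(N s \<and> s x 0 = i) \<and> E s" for s y j
        proof -
          have "x \<noteq> y" using that Cons.prems(1) by auto
          then show ?thesis using that Cons.prems(1,4,5) by auto
        qed
        show "(N (sem c s) \<and> sem c s x 0 = i) \<and> E (sem c s)" if "(N s \<and> s x 0 = i) \<and> E s" "\<forall>x\<in>set xs. s x 0 < n" for s
          using that Cons.prems(2,6,7) t(1) by (auto simp: sem_other)
      qed (use Cons.prems t tn Et in auto)
      then show ?thesis by simp
    qed
    ultimately show "N (sem (fors xs c) ?t) \<and> (val x < Suc i \<longrightarrow> E (sem (fors xs c) ?t))" by simp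
  next
    show "E (upd t x 0 0)" if "N t \<and> (val x < n \<longrightarrow> E t)" for t
      using that v Cons.prems(5) by simp
  qed (use Cons.prems in auto)
qed simp

definition lessF :: "vname \<Rightarrow> vname \<Rightarrow> fm" where
  "lessF X Y = FEx (FAnd (memF Y (Q 0)) (FAnd (FNot (memF X (Q 0)))
     (FAll (FImp (FLess (Q (Suc 0)) (Q 0)) (FAnd (FImp (memF X (Q (Suc 0))) (memF Y (Q (Suc 0))))
        (FImp (memF Y (Q (Suc 0))) (memF X (Q (Suc 0)))))))))"

definition doomedF :: fm where
  "doomedF = FAll (FImp (FAnd (cadjF (Var ''i'') (Q 0))
      (FAll (FImp (FAnd (memF ''I'' (Q (Suc 0))) (cadjF (Q 0) (Q (Suc 0)))) (FEq (Q (Suc 0)) (Var ''i'')))))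
    (cadjF (Var ''cu'') (Q 0)))"

definition keepF :: "vname \<Rightarrow> vname \<Rightarrow> fm" where
  "keepF t f = FImp (cadjF (Var f) (Var ''i'')) (FEq (Var ''i'') (Var t))"

definition isF :: "vname \<Rightarrow> fm" where
  "isF t = FEq (Var ''i'') (Var t)"

definition candF :: fm where
  "candF = FAnd (FOr (memF ''I'' (Var ''i'')) (isF ''cu''))
    (FAnd (FAnd (keepF ''cu'' ''f0'') (FAnd (keepF ''t1'' ''f1'') (FAnd (keepF ''t2'' ''f2'')
       (FAnd (keepF ''t3'' ''f3'') (keepF ''t4'' ''f4'')))))
    (FOr (FOr (isF ''cu'') (FOr (isF ''t1'') (FOr (isF ''t2'') (FOr (isF ''t3'') (isF ''t4''))))) (FNot doomedF)))"

definition CANDp :: fcom where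
  "CANDp = FFor ''i'' (FIf candF (FSet ''R'' (Var ''i'') (Const 1)) (FSet ''R'' (Var ''i'') (Const 0)))"

definition testF :: fm where
  "testF = FAnd (FEq (Var ''root'') (Const 0)) (FAnd (eqF ''par'' ''I'') (FAnd (lessF ''K'' ''C'')
     (FOr (FEq (Var ''found'') (Const 0)) (lessF ''C'' ''best''))))"

definition checkp :: fcom where
  "checkp = FIf testF (FSeq (copy ''C'' ''best'') (FSet ''found'' (Const 0) (Const 1))) FSkip"

text \<open>Wrong guesses are harmless: whatever tuple is tried, the completion counts only if
  recomputing its parent gives \<open>I\<close>. The test before it guarantees that the completion
  is a maximal irredundant set.\<close>

definition innerp :: fcom where
  "innerp = FSeq CANDp (FSeq (PREp ''R'' ''P'')
     (FIf (irrF ''P'' ''P'' ''cu'') (FSeq (LBp ''P'' ''C'') (FSeq (PARp ''C'') checkp)) FSkip))"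

text \<open>Column and target of the branching slot, up to four doomed elements, and a private
  neighbour for \<open>cu\<close> and for each of these.\<close>

definition digits :: "vname list" where
  "digits = [''cv'', ''cu'', ''t1'', ''t2'', ''t3'', ''t4'', ''f0'', ''f1'', ''f2'', ''f3'', ''f4'']"

definition NEXTp :: fcom where
  "NEXTp = FSeq (FSet ''found'' (Const 0) (Const 0)) (fors digits innerp)"

lemma writes_CANDp [simp]: "writes CANDp = {''i'', ''R''}"
  by (auto simp: CANDp_def)

lemma writes_checkp [simp]: "writes checkp = {''i'', ''best'', ''found'', ''sk''}"
  by (auto simp: checkp_def)

definition innerW :: "vname set" where
  "innerW = {''i'', ''R'', ''v'', ''u'', ''sk'', ''stop'', ''P'', ''C'', ''pl'', ''par'', ''root'', ''pv'', ''pu'',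
     ''ps'', ''best'', ''found''}"

lemma writes_innerp [simp]: "writes innerp = innerW"
  by (simp add: innerp_def innerW_def insert_commute)

context graph
begin

lemma fval_lessF:
  assumes "s ''n'' 0 = n" "\<not> tmp X" "\<not> tmp Y"
  shows "fval 0 (lessF X Y) s \<longleftrightarrow> sless (set_of s X) (set_of s Y)"
proof -
  have "fval 0 (lessF X Y) s \<longleftrightarrow> (\<exists>x<n. 0 < s Y x \<and> \<not> 0 < s X x \<and> (\<forall>y<n. y < x \<longrightarrow> (0 < s X y \<longleftrightarrow> 0 < s Y y)))"
    using assms by (simp add: lessF_def iff_conv_conj_imp)
  also have "\<dots> \<longleftrightarrow> sless (set_of s X) (set_of s Y)"
    unfolding sless_def set_of_def by (rule arg_cong[where f = Ex], rule ext) auto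
  finally show ?thesis .
qed

definition pairs :: "state \<Rightarrow> (nat \<times> nat) set" where
  "pairs s = {(s ''cu'' 0, s ''f0'' 0), (s ''t1'' 0, s ''f1'' 0), (s ''t2'' 0, s ''f2'' 0),
     (s ''t3'' 0, s ''f3'' 0), (s ''t4'' 0, s ''f4'' 0)}"

lemma fval_doomedF:
  assumes "has_graph s" "s ''i'' 0 < n" "s ''cu'' 0 < n"
  shows "fval 0 doomedF s \<longleftrightarrow> doomed (set_of s ''I'') (s ''cu'' 0) (s ''i'' 0)"
proof -
  have "fval 0 doomedF s \<longleftrightarrow> (\<forall>y<n. cadj (s ''i'' 0) y \<and> (\<forall>z<n. 0 < s ''I'' z \<and> cadj y z \<longrightarrow> z = s ''i'' 0) \<longrightarrow> cadj (s ''cu'' 0) y)"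
    using assms by (simp add: doomedF_def)
  also have "\<dots> \<longleftrightarrow> doomed (set_of s ''I'') (s ''cu'' 0) (s ''i'' 0)"
  proof -
    have "y < n" if "cadj (s ''i'' 0) y" for y using that assms adj_less adj_sym by (auto simp: cadj_def)
    then show ?thesis unfolding doomed_def pvt_def set_of_def by blast
  qed
  finally show ?thesis .
qed

lemma fval_keepF:
  "has_graph s \<Longrightarrow> s ''i'' 0 < n \<Longrightarrow> s f 0 < n \<Longrightarrow>
   fval 0 (keepF t f) s \<longleftrightarrow> (cadj (s f 0) (s ''i'' 0) \<longrightarrow> s ''i'' 0 = s t 0)"
  by (simp add: keepF_def)

lemma fval_candF:
  assumes "has_graph s" "s ''i'' 0 < n" "\<forall>x\<in>set digits. s x 0 < n"
  shows "fval 0 candF s \<longleftrightarrow> s ''i'' 0 \<in> cand (set_of s ''I'') (s ''cu'' 0) (pairs s)"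
proof -
  have d: "s ''cu'' 0 < n" "s ''f0'' 0 < n" "s ''f1'' 0 < n" "s ''f2'' 0 < n" "s ''f3'' 0 < n" "s ''f4'' 0 < n"
    using assms(3) by (simp_all add: digits_def)
  have m: "0 < s ''I'' (s ''i'' 0) \<longleftrightarrow> s ''i'' 0 \<in> set_of s ''I''" using assms(2) by (rule set_of_iff)
  show ?thesis
    using d by (simp add: candF_def fval_keepF fval_doomedF assms(1,2) isF_def m cand_def pairs_def) blast
qed

lemma sem_CANDp:
  assumes "has_graph s" "\<forall>x\<in>set digits. s x 0 < n"
  shows "set_of (sem CANDp s) ''R'' = cand (set_of s ''I'') (s ''cu'' 0) (pairs s)" (is "_ = ?R")
proof -
  have "set_of (sem CANDp s) ''R'' = {z. z < n \<and> z \<in> ?R}"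
    unfolding CANDp_def
  proof (rule sem_For[where I = "\<lambda>i t. \<forall>z<i. 0 < t ''R'' z \<longleftrightarrow> z \<in> ?R" and n = n
      and I' = "\<lambda>t. set_of t ''R'' = {z. z < n \<and> z \<in> ?R}"])
    fix i t assume t: "i < n" "\<forall>z<i. 0 < t ''R'' z \<longleftrightarrow> z \<in> ?R"
      "\<forall>y. y \<notin> insert ''i'' (writes (FIf candF (FSet ''R'' (Var ''i'') (Const 1)) (FSet ''R'' (Var ''i'') (Const 0)))) \<longrightarrow> t y = s y"
    let ?t = "upd t ''i'' 0 i"
    have fr: "?t y = s y" if "y \<noteq> ''i''" "y \<noteq> ''R''" for y using t(3) that by simp
    have G: "has_graph ?t" by (rule has_graph_cong[OF assms(1)]; rule fr) auto
    have "set_of ?t ''I'' = set_of s ''I''" by (rule set_of_cong, rule fr) auto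
    moreover have "pairs ?t = pairs s" unfolding pairs_def using fr by simp
    moreover have "\<forall>x\<in>set digits. ?t x 0 < n" using assms(2) fr by (simp add: digits_def)
    ultimately have "fval 0 candF ?t \<longleftrightarrow> i \<in> ?R"
      using fval_candF[OF G] t(1) fr[of "''cu''"] by simp
    then show "\<forall>z<Suc i. 0 < sem (FIf candF (FSet ''R'' (Var ''i'') (Const 1)) (FSet ''R'' (Var ''i'') (Const 0))) ?t ''R'' z
       \<longleftrightarrow> z \<in> ?R" using t(2) by (auto simp: less_Suc_eq upd_apply)
  qed (use assms in \<open>auto simp: set_of_def\<close>)
  moreover have "?R \<subseteq> {..<n}" using assms(2) set_of_less by (auto simp: cand_def digits_def set_of_def)
  ultimately show ?thesis by auto
qed

definition kids :: "nat set \<Rightarrow> nat set \<Rightarrow> nat set set" where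
  "kids I K = {c. maxirr c \<and> has_parent c \<and> parent c = I \<and> sless K c}"

definition next_inv :: "nat set \<Rightarrow> nat set \<Rightarrow> state \<Rightarrow> bool" where
  "next_inv I K s \<longleftrightarrow> has_graph s \<and> set_of s ''I'' = I \<and> set_of s ''K'' = K \<and>
     (s ''found'' 0 \<noteq> 0 \<longrightarrow> set_of s ''best'' \<in> kids I K)"

text \<open>The part of minimality that concerns one child \<open>c\<close>: once \<open>c\<close>
  has been met, the stored set never again lies above it.\<close>

definition next_le :: "nat set \<Rightarrow> state \<Rightarrow> bool" where
  "next_le c s \<longleftrightarrow> s ''found'' 0 \<noteq> 0 \<and> \<not> sless c (set_of s ''best'')"

lemma next_upd:
  assumes "x \<in> set digits"
  shows "next_inv I K (upd s x 0 i) = next_inv I K s" "next_le c (upd s x 0 i) = next_le c s"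
proof -
  have "x \<notin> {''n'', ''B'', ''rows'', ''I'', ''K'', ''found'', ''best''}" using assms by (auto simp: digits_def)
  then show "next_inv I K (upd s x 0 i) = next_inv I K s" "next_le c (upd s x 0 i) = next_le c s"
    unfolding next_inv_def next_le_def by auto
qed

lemma sem_checkp:
  assumes s: "next_inv I K s" and C: "maxirr (set_of s ''C'')"
    and root: "s ''root'' 0 = (if has_parent (set_of s ''C'') then 0 else 1)"
    and par: "has_parent (set_of s ''C'') \<Longrightarrow> set_of s ''par'' = parent (set_of s ''C'')"
  shows "next_inv I K (sem checkp s)" "next_le c s \<Longrightarrow> next_le c (sem checkp s)"
    "set_of s ''C'' \<in> kids I K \<Longrightarrow> next_le (set_of s ''C'') (sem checkp s)"
proof -
  let ?C = "set_of s ''C''"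
  have G: "has_graph s" "s ''n'' 0 = n" using s by (auto simp: next_inv_def)
  have *: "fval 0 testF s \<longleftrightarrow> ?C \<in> kids I K \<and> (s ''found'' 0 = 0 \<or> sless ?C (set_of s ''best''))"
    using s C root par G(2) by (auto simp: testF_def fval_eqF fval_lessF kids_def next_inv_def)
  let ?t = "upd (sem (copy ''C'' ''best'') s) ''found'' 0 1"
  have best: "set_of ?t ''best'' = ?C" using sem_copy[of s "''best''" "''C''"] G by simp
  have G': "has_graph ?t" using has_graph_sem[OF G(1), of "copy ''C'' ''best''"] by simp
  have fr: "set_of ?t X = set_of s X" if "X \<notin> {''i'', ''best'', ''found''}" for X
    using that by (simp add: set_of_sem)
  have sem: "sem checkp s = (if fval 0 testF s then ?t else upd s ''sk'' 0 0)"
    by (simp add: checkp_def)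
  show "next_inv I K (sem checkp s)"
    using s * best G' fr[of "''I''"] fr[of "''K''"] unfolding sem next_inv_def by simp
  show "next_le c (sem checkp s)" if "next_le c s"
    using that * best sless_trans unfolding sem next_le_def by auto
  show "next_le ?C (sem checkp s)" if "?C \<in> kids I K"
    using that * best sless_irrefl unfolding sem next_le_def by auto
qed

lemma sem_innerp:
  assumes s: "next_inv I K s" and d: "\<forall>x\<in>set digits. s x 0 < n"
  defines "v \<equiv> s ''cv'' 0" and "u \<equiv> s ''cu'' 0"
  defines "P \<equiv> pre (cand I u (pairs s)) (Suc (slot v (if u = v then n else u)))"
  shows "next_inv I K (sem innerp s)" "next_le c s \<Longrightarrow> next_le c (sem innerp s)"
    "irr (insert u P) \<Longrightarrow> LB P = c \<Longrightarrow> c \<in> kids I K \<Longrightarrow> next_le c (sem innerp s)"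
proof -
  let ?r = "sem CANDp s"
  let ?p = "sem (PREp ''R'' ''P'') ?r"
  let ?c = "sem (LBp ''P'' ''C'') ?p"
  let ?a = "sem (PARp ''C'') ?c"
  have G: "has_graph s" using s by (simp add: next_inv_def)
  have un: "u < n" "v < n" using d by (simp_all add: u_def v_def digits_def)
  have Gr: "has_graph ?r" by (rule has_graph_sem[OF G]) simp
  have Gp: "has_graph ?p" by (rule has_graph_sem[OF Gr]) simp
  have Gc: "has_graph ?c" by (rule has_graph_sem[OF Gp]) simp
  have Ga: "has_graph ?a" by (rule has_graph_sem[OF Gc]) simp
  have I: "set_of s ''I'' = I" using s by (simp add: next_inv_def)
  have R: "set_of ?r ''R'' = cand I u (pairs s)" using sem_CANDp[OF G d] I by (simp add: u_def)
  have cvu: "?r ''cv'' 0 = v" "?r ''cu'' 0 = u" by (simp_all add: sem_other u_def v_def)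
  have P: "set_of ?p ''P'' = P" using sem_PREp[OF Gr] R cvu un by (simp add: P_def)
  have pu: "?p ''cu'' 0 = u" by (simp add: sem_other u_def)
  have irr: "fval 0 (irrF ''P'' ''P'' ''cu'') ?p \<longleftrightarrow> irr (insert u P)"
    using fval_irrF[OF Gp, of "''P''" "''P''" "''cu''"] P pu un by simp
  have C: "set_of ?c ''C'' = LB P" using sem_LBp[OF Gp, of "''P''" "''C''"] P by simp
  have fr: "?p y = s y" if "y \<notin> innerW" for y
    using that unfolding innerW_def by (simp add: sem_other)
  have fr2: "?a y = s y" if "y \<notin> innerW" for y
    using that fr[OF that] unfolding innerW_def by (simp add: sem_other)
  have fr3: "?p y = s y" "?a y = s y" if "y \<in> {''best'', ''found''}" for y
    using that by (auto simp: sem_other)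
  have set: "set_of ?a y = set_of s y" "set_of ?p y = set_of s y" if "y \<in> {''I'', ''K'', ''best''}" for y
  proof -
    have "y = ''best'' \<or> y \<notin> innerW" using that by (auto simp: innerW_def)
    then have "?a y = s y" "?p y = s y" using fr fr2 fr3[of y] that by auto
    then show "set_of ?a y = set_of s y" "set_of ?p y = set_of s y" by (simp_all add: set_of_def)
  qed
  have inva: "next_inv I K ?a" "next_inv I K ?p"
    using s Ga Gp set fr3 unfolding next_inv_def by simp_all
  have lea: "next_le c ?a = next_le c s" "next_le c ?p = next_le c s" for c
    unfolding next_le_def using set fr3 by simp_all
  have aC: "set_of ?a ''C'' = LB P" using C set_of_sem[of "''C''" "PARp ''C''" ?c] by simp
  have P_less: "P \<subseteq> {..<n}"
    using pre_subset set_of_less[of ?r "''R''"] unfolding P_def R by (metis order_trans)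
  have sem: "sem innerp s = (if irr (insert u P) then sem checkp ?a else upd ?p ''sk'' 0 0)"
    using irr by (simp add: innerp_def)
  have chk: "next_inv I K (sem checkp ?a) \<and> (next_le c ?a \<longrightarrow> next_le c (sem checkp ?a)) \<and>
     (LB P = c \<longrightarrow> c \<in> kids I K \<longrightarrow> next_le c (sem checkp ?a))" if "irr (insert u P)"
  proof -
    have "irr P" by (rule irr_mono[OF that]) auto
    then have "maxirr (set_of ?a ''C'')" using maxirr_LB P_less unfolding aC by blast
    moreover have "?a ''root'' 0 = (if has_parent (set_of ?a ''C'') then 0 else 1)"
      "has_parent (set_of ?a ''C'') \<Longrightarrow> set_of ?a ''par'' = parent (set_of ?a ''C'')"
      using sem_PARp[OF Gc, of "''C''"] unfolding C aC by simp_all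
    ultimately show ?thesis using sem_checkp[OF inva(1)] unfolding aC by blast
  qed
  have sk: "next_inv I K (upd ?p ''sk'' 0 0) = next_inv I K ?p" "next_le c (upd ?p ''sk'' 0 0) = next_le c ?p"
    by (simp_all add: next_inv_def next_le_def)
  show "next_inv I K (sem innerp s)" unfolding sem using chk inva sk by simp
  show "next_le c (sem innerp s)" if "next_le c s" unfolding sem using chk lea sk that by simp
  show "next_le c (sem innerp s)" if "irr (insert u P)" "LB P = c" "c \<in> kids I K"
    unfolding sem using chk that by simp
qed

end

context strong_graph
begin

text \<open>The branching slot supplies \<open>v\<close> and \<open>u\<close>, the doomed elements
  of the prefix, at most four by \<open>few_doomed\<close>, are listed by \<open>t\<close>, and
  irredundance of the prefix with \<open>u\<close> added supplies \<open>f\<close>. By the last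
  conclusion of \<open>branch\<close> the candidate then has the right prefix.\<close>

lemma child_candidate:
  assumes c: "maxirr c" "has_parent c"
  obtains v u and t f :: "nat \<Rightarrow> nat" where "v < n" "u < n" "\<And>j. t j < n" "\<And>j. f j < n" "t 0 = u"
    "let P = pre (cand (parent c) u {(t 0, f 0), (t 1, f 1), (t 2, f 2), (t 3, f 3), (t 4, f 4)})
        (Suc (slot v (if u = v then n else u))) in irr (insert u P) \<and> LB P = c"
proof -
  define k where "k = branch c"
  define S u where "S = pre c k" and "u = tgt k"
  let ?I = "parent c"
  note b = branch[OF c, folded k_def]
  have cn: "c \<subseteq> {..<n}" "irr c" using c by (auto simp: maxirr_def)
  have I: "maxirr ?I" "S \<subseteq> ?I" using b by (auto simp: S_def)
  have irrI: "irr ?I" "?I \<subseteq> {..<n}" using I by (auto simp: maxirr_def)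
  have un: "u < n" "u \<in> c" "u \<notin> S" using b cn by (auto simp: u_def S_def)
  have Sc: "insert u S \<subseteq> c" using pre_subset[of c k] un by (auto simp: S_def)
  have irrS: "irr (insert u S)" using irr_mono cn Sc by blast
  obtain v r where k: "k = slot v r" "r \<le> n" using slot_exists by blast
  have vn: "v < n"
  proof -
    have "k div Suc n < n" using b(1) by (simp add: div_less_iff_less_mult)
    then show ?thesis using k slot_div_mod by simp
  qed
  have kk: "k = slot v (if u = v then n else u)"
  proof (cases "r = n")
    case True
    then show ?thesis using k by (simp add: u_def tgt_slot)
  next
    case False
    then have "u = r" "adj v u" using k b(3) by (auto simp: u_def tgt_slot grd_slot)
    then show ?thesis using k adj_irrefl by auto
  qed
  define D where "D = {z \<in> S. doomed ?I u z}"
  have "card D \<le> 4" unfolding D_def S_def u_def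
    by (rule few_doomed) (use b cn irrI I in \<open>auto simp: S_def u_def\<close>)
  moreover have finD: "finite D" using Sc cn finite_subset[of D "{..<n}"] by (auto simp: D_def)
  ultimately obtain t :: "nat \<Rightarrow> nat" where t: "t 0 = u" "t ` {0..4} = insert u D"
  proof -
    obtain h where h: "bij_betw h {0..<card D} D" using ex_bij_betw_nat_finite[OF finD] by blast
    define t where "t j = (if 0 < j \<and> j \<le> card D then h (j - 1) else u)" for j
    have "t ` {0..4} = insert u D"
    proof
      show "t ` {0..4} \<subseteq> insert u D" using bij_betwE[OF h] by (auto simp: t_def)
      have "z \<in> t ` {0..4}" if "z \<in> D" for z
      proof -
        have "z \<in> h ` {0..<card D}" using h that by (simp add: bij_betw_def)
        then obtain i where i: "i < card D" "h i = z" by auto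
        then have "t (Suc i) = z" by (simp add: t_def)
        then show ?thesis using i \<open>card D \<le> 4\<close> by (intro image_eqI[of _ _ "Suc i"]) auto
      qed
      moreover have "u \<in> t ` {0..4}" by (intro image_eqI[of _ _ 0]) (auto simp: t_def)
      ultimately show "insert u D \<subseteq> t ` {0..4}" by blast
    qed
    then show thesis using that[of t] by (simp add: t_def)
  qed
  \<comment> \<open>Beyond index 4 any member of \<open>insert u S\<close> will do; the bounds are
    then available for all indices.\<close>
  define t' where "t' j = (if j \<le> 4 then t j else u)" for j
  have tS: "t' j \<in> insert u S" for j using t(2) by (auto simp: t'_def D_def)
  have "\<forall>j. \<exists>y. pvt (t' j) (insert u S) y" using irrS tS unfolding irr_def by blast
  then obtain f where f: "\<And>j. pvt (t' j) (insert u S) (f j)" by metis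
  have tn: "t' j < n" for j using tS Sc cn by blast
  have fn: "f j < n" for j using f[of j] tn[of j] adj_less adj_sym by (auto simp: pvt_def cadj_def)
  define L where "L = {(t' 0, f 0), (t' 1, f 1), (t' 2, f 2), (t' 3, f 3), (t' 4, f 4)}"
  have "{0..4::nat} = {0, 1, 2, 3, 4}" by auto
  then have L: "fst ` L = insert u {z \<in> S. doomed ?I u z}"
    using t(2) by (simp add: L_def t'_def D_def)
  have Lf: "pvt t (insert u S) g" if "(t, g) \<in> L" for t g
    using that f by (auto simp: L_def)
  define R where "R = cand ?I u L"
  have R: "insert u S \<subseteq> R" "irr R" unfolding R_def using cand[OF I(2) irrI(1) L Lf] by auto
  have Rn: "R \<subseteq> {..<n}" using irrI un by (auto simp: R_def cand_def)
  have "pre R (Suc k) = insert u S" "LB (insert u S) = c"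
    using b(9)[OF R(2) _ Rn] R(1) by (auto simp: S_def u_def)
  then have "let P = pre R (Suc (slot v (if u = v then n else u))) in irr (insert u P) \<and> LB P = c"
    using irrS kk by (simp add: Let_def)
  then show thesis using that[of v u t' f] vn un tn fn t(1) by (simp add: R_def L_def t'_def)
qed

lemma sem_NEXTp:
  assumes s: "has_graph s"
  defines "I \<equiv> set_of s ''I''" and "K \<equiv> set_of s ''K''" and "s' \<equiv> sem NEXTp s"
  shows "has_graph s'" "s' ''found'' 0 = 0 \<longleftrightarrow> kids I K = {}"
    "kids I K \<noteq> {} \<Longrightarrow> set_of s' ''best'' \<in> kids I K \<and> (\<forall>c\<in>kids I K. \<not> sless c (set_of s' ''best''))"
proof -
  let ?s = "upd s ''found'' 0 0"
  have s': "s' = sem (fors digits innerp) ?s" by (simp add: s'_def NEXTp_def)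
  have n0: "?s ''n'' 0 = n" using s by simp
  have inv0: "next_inv I K ?s" using s by (simp add: next_inv_def I_def K_def)
  have dist: "distinct digits" "set digits \<inter> writes innerp = {}" "''n'' \<notin> set digits \<union> writes innerp"
    by (simp_all add: digits_def innerW_def)
  have inv: "next_inv I K s'" unfolding s'
    by (rule fors_invariant[where N = "next_inv I K" and n = n])
      (use dist inv0 n0 in \<open>auto simp: next_upd sem_innerp\<close>)
  have le: "next_le c s'" if c: "c \<in> kids I K" for c
  proof -
    have mc: "maxirr c" "has_parent c" "parent c = I" using c by (auto simp: kids_def)
    note cc = child_candidate[OF mc(1,2), unfolded mc(3)]
    obtain v u and t f :: "nat \<Rightarrow> nat" where h: "v < n" "u < n" "\<And>j. t j < n" "\<And>j. f j < n" "t 0 = u"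
      "let P = pre (cand I u {(t 0, f 0), (t 1, f 1), (t 2, f 2), (t 3, f 3), (t 4, f 4)})
        (Suc (slot v (if u = v then n else u))) in irr (insert u P) \<and> LB P = c"
      by (rule cc) (rule that)
    define val where "val = (\<lambda>_. 0 :: nat)(''cv'' := v, ''cu'' := u, ''t1'' := t 1, ''t2'' := t 2, ''t3'' := t 3,
      ''t4'' := t 4, ''f0'' := f 0, ''f1'' := f 1, ''f2'' := f 2, ''f3'' := f 3, ''f4'' := f 4)"
    show ?thesis unfolding s'
    proof (rule fors_reach[where N = "next_inv I K" and E = "next_le c" and val = val and n = n])
      show "val x < n" if "x \<in> set digits" for x
        using that h by (auto simp: digits_def val_def)
      then have vd: "\<forall>x\<in>set digits. r x 0 < n" if "\<forall>x\<in>set digits. r x 0 = val x" for r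
        using that by simp
      show "next_le c (sem innerp r)" if r: "next_inv I K r" "\<forall>x\<in>set digits. r x 0 = val x" for r
      proof -
        have e: "r ''cv'' 0 = v" "r ''cu'' 0 = u" "pairs r = {(t 0, f 0), (t 1, f 1), (t 2, f 2), (t 3, f 3), (t 4, f 4)}"
          using r(2) h(5) by (simp_all add: digits_def val_def pairs_def)
        have vdr: "\<forall>x\<in>set digits. r x 0 < n" by (rule vd) (rule r(2))
        show ?thesis using sem_innerp(3)[OF r(1) vdr, of c] h(6) c unfolding e by (simp add: Let_def)
      qed
    qed (use dist inv0 n0 in \<open>auto simp: next_upd sem_innerp\<close>)
  qed
  show "has_graph s'" using inv by (simp add: next_inv_def)
  show "s' ''found'' 0 = 0 \<longleftrightarrow> kids I K = {}"
    using inv le unfolding next_inv_def next_le_def by blast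
  show "set_of s' ''best'' \<in> kids I K \<and> (\<forall>c\<in>kids I K. \<not> sless c (set_of s' ''best''))" if "kids I K \<noteq> {}"
    using inv le that unfolding next_inv_def next_le_def by blast
qed

end

section \<open>Traversal of a tree with bounded delay\<close>

text \<open>The strict order \<open>bet\<close> on a finite set excludes cycles of parent links. The
  linear order \<open>less\<close> serves only to run through siblings.\<close>

locale rooted_tree =
  fixes V :: "'a set" and root :: 'a and par :: "'a \<Rightarrow> 'a" and bet less :: "'a \<Rightarrow> 'a \<Rightarrow> bool"
  assumes fin: "finite V" and root: "root \<in> V"
    and par: "J \<in> V \<Longrightarrow> J \<noteq> root \<Longrightarrow> par J \<in> V \<and> bet (par J) J"
    and bet: "\<not> bet J J" "bet I J \<Longrightarrow> bet J K \<Longrightarrow> bet I K"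
    and less: "\<not> less J J" "less I J \<Longrightarrow> less J K \<Longrightarrow> less I K" "I \<noteq> J \<Longrightarrow> less I J \<or> less J I"
begin

definition kid :: "'a \<Rightarrow> 'a set" where
  "kid I = {c \<in> V. c \<noteq> root \<and> par c = I}"

definition is_min :: "'a set \<Rightarrow> 'a \<Rightarrow> bool" where
  "is_min C m \<longleftrightarrow> m \<in> C \<and> (\<forall>c\<in>C. \<not> less c m)"

text \<open>A configuration consists of a node, whether it is being left (rather than entered), and whether
  its depth is odd. Nodes of even depth are output when entered, nodes of odd depth when left.\<close>

inductive mv :: "'a \<times> bool \<times> bool \<Rightarrow> 'a \<times> bool \<times> bool \<Rightarrow> bool" where
  enter_some: "is_min (kid J) m \<Longrightarrow> mv (J, False, p) (m, False, \<not> p)"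
| enter_none: "kid J = {} \<Longrightarrow> mv (J, False, p) (J, True, p)"
| leave_some: "J \<noteq> root \<Longrightarrow> is_min {c \<in> kid (par J). less J c} m \<Longrightarrow> mv (J, True, p) (m, False, p)"
| leave_none: "J \<noteq> root \<Longrightarrow> {c \<in> kid (par J). less J c} = {} \<Longrightarrow> mv (J, True, p) (par J, True, \<not> p)"

fun out :: "'a \<times> bool \<times> bool \<Rightarrow> 'a list" where
  "out (J, d, p) = (if d = p then [J] else [])"

inductive tr :: "'a \<times> bool \<times> bool \<Rightarrow> 'a list \<Rightarrow> 'a \<times> bool \<times> bool \<Rightarrow> bool" where
  tr_refl: "tr c [] c"
| tr_step: "mv c d \<Longrightarrow> tr d ys e \<Longrightarrow> tr c (out c @ ys) e"

lemma tr_trans: "tr c xs d \<Longrightarrow> tr d ys e \<Longrightarrow> tr c (xs @ ys) e"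
  by (induction rule: tr.induct) (auto intro: tr.intros)

lemma is_min_unique: "is_min C m \<Longrightarrow> is_min C m' \<Longrightarrow> m = m'"
  using less(3) by (auto simp: is_min_def)

lemma is_min_nonempty: "is_min C m \<Longrightarrow> C \<noteq> {}"
  by (auto simp: is_min_def)

text \<open>The program is shown to make some legal move in each round; determinism identifies it
  with the move in the trace given by \<open>traverse\<close>.\<close>

lemma mv_det: "mv c d \<Longrightarrow> mv c d' \<Longrightarrow> d = d'"
  by (erule mv.cases; erule mv.cases) (auto dest: is_min_unique is_min_nonempty)

lemma mv_not_final: "\<not> mv (root, True, p) d"
  by (auto elim: mv.cases)

text \<open>Each move flips exactly one of the two flags, so their equality alternates, and with it
  the output.\<close>

lemma mv_out: "mv c d \<Longrightarrow> out c = [] \<Longrightarrow> out d \<noteq> []"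
  by (erule mv.cases) (auto split: if_splits)

lemma is_min_exists: "finite C \<Longrightarrow> C \<noteq> {} \<Longrightarrow> \<exists>m. is_min C m"
proof -
  assume C: "finite C" "C \<noteq> {}"
  have "\<exists>m\<in>C. \<forall>x\<in>C. x \<noteq> m \<longrightarrow> \<not> less x m"
  proof (rule Finite_Set.bex_min_element[OF C(1) _ _ C(2)])
    show "asymp_on C less" using less(1,2) by (intro asymp_onI) blast
    show "transp_on C less" using less(2) by (intro transp_onI) blast
  qed
  then show ?thesis unfolding is_min_def by (metis less(1))
qed

definition up :: "'a \<Rightarrow> 'a \<Rightarrow> bool" where
  "up K L \<longleftrightarrow> K \<in> V \<and> K \<noteq> root \<and> L = par K"

definition sub :: "'a \<Rightarrow> 'a set" where
  "sub J = {K \<in> V. up\<^sup>*\<^sup>* K J}"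

lemma up_bet: "up\<^sup>*\<^sup>* K J \<Longrightarrow> K = J \<or> bet J K"
proof (induction rule: rtranclp_induct)
  case (step y z)
  then show ?case using par[of y] bet(2) by (auto simp: up_def)
qed simp

lemma sub_self: "J \<in> V \<Longrightarrow> J \<in> sub J"
  by (simp add: sub_def)

lemma sub_kids: "J \<in> V \<Longrightarrow> sub J = insert J (\<Union> (sub ` kid J))"
proof
  show "sub J \<subseteq> insert J (\<Union> (sub ` kid J))"
  proof
    fix K assume K: "K \<in> sub J"
    then have "up\<^sup>*\<^sup>* K J" by (simp add: sub_def)
    then show "K \<in> insert J (\<Union> (sub ` kid J))"
    proof (cases rule: rtranclp.cases)
      case (rtrancl_into_rtrancl b)
      then have "b \<in> kid J" by (auto simp: kid_def up_def)
      moreover have "K \<in> sub b" using K rtrancl_into_rtrancl by (simp add: sub_def)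
      ultimately show ?thesis by blast
    qed simp
  qed
  assume "J \<in> V"
  then show "insert J (\<Union> (sub ` kid J)) \<subseteq> sub J"
    by (auto simp: sub_def kid_def up_def intro: rtranclp.rtrancl_into_rtrancl)
qed

text \<open>\<open>up\<close> is a partial function, so of two upward paths from \<open>K\<close>
  one extends the other.\<close>

lemma up_linear: "up\<^sup>*\<^sup>* K J \<Longrightarrow> up\<^sup>*\<^sup>* K L \<Longrightarrow> up\<^sup>*\<^sup>* J L \<or> up\<^sup>*\<^sup>* L J"
proof (induction rule: rtranclp_induct)
  case (step y z)
  then have "up\<^sup>*\<^sup>* y L \<or> up\<^sup>*\<^sup>* L y" by blast
  then show ?case
  proof
    assume "up\<^sup>*\<^sup>* y L"
    then show ?thesis
    proof (cases rule: converse_rtranclpE)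
      case (step w)
      then have "w = z" using \<open>up y z\<close> by (simp add: up_def)
      then show ?thesis using step by simp
    qed (use step in blast)
  next
    assume "up\<^sup>*\<^sup>* L y"
    then show ?thesis using step.hyps(2) by (meson rtranclp.rtrancl_into_rtrancl)
  qed
qed blast

lemma not_below_kid: "c \<in> kid J \<Longrightarrow> \<not> up\<^sup>*\<^sup>* J c"
  using up_bet[of J c] par[of c] bet(1)[of c] bet(2)[of c J c] by (auto simp: kid_def)

lemma sub_disjoint: "c \<in> kid J \<Longrightarrow> c' \<in> kid J \<Longrightarrow> c \<noteq> c' \<Longrightarrow> sub c \<inter> sub c' = {}"
proof -
  have *: False if "c \<in> kid J" "c' \<in> kid J" "c \<noteq> c'" "up\<^sup>*\<^sup>* c c'" for c c'
    using that(4)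
  proof (cases rule: converse_rtranclpE)
    case (step w)
    then have "w = J" using that(1) by (simp add: up_def kid_def)
    then show False using step not_below_kid[OF that(2)] by simp
  qed (use that in simp)
  assume "c \<in> kid J" "c' \<in> kid J" "c \<noteq> c'"
  then show ?thesis using *[of c c'] *[of c' c] up_linear by (auto simp: sub_def)
qed

text \<open>A trace does not include the output of its final configuration. For odd depth, when
  \<open>p\<close> holds, \<open>J\<close> is output only on being left, so it is still missing. The
  induction is on the number of nodes that \<open>J\<close> is better than.\<close>

lemma traverse_sub:
  "J \<in> V \<Longrightarrow> \<exists>xs. tr (J, False, p) xs (J, True, p) \<and> distinct xs \<and> set xs = (if p then sub J - {J} else sub J)"
proof (induction "card {K \<in> V. bet J K}" arbitrary: J p rule: less_induct)
  case less
  have IH: "\<exists>xs. tr (c, False, q) xs (c, True, q) \<and> distinct xs \<and> set xs = (if q then sub c - {c} else sub c)"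
    if "c \<in> kid J" for c q
  proof (rule less.hyps)
    show "c \<in> V" using that by (simp add: kid_def)
    have "bet J c" using that par by (auto simp: kid_def)
    then show "card {K \<in> V. bet c K} < card {K \<in> V. bet J K}"
    proof (intro psubset_card_mono psubsetI)
      show "{K \<in> V. bet c K} \<subseteq> {K \<in> V. bet J K}" using \<open>bet J c\<close> bet(2) by blast
      have "c \<in> {K \<in> V. bet J K}" "c \<notin> {K \<in> V. bet c K}" using \<open>bet J c\<close> \<open>c \<in> V\<close> bet(1) by auto
      then show "{K \<in> V. bet c K} \<noteq> {K \<in> V. bet J K}" by blast
    qed (use fin in simp)
  qed
  \<comment> \<open>Siblings are processed in increasing order; \<open>C\<close> is the final
    segment that begins with \<open>m\<close>.\<close>
  have chain: "\<exists>xs. tr (m, False, q) xs (J, True, \<not> q) \<and> distinct xs \<and> set xs = \<Union> (sub ` C)"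
    if "is_min C m" "C \<subseteq> kid J" "\<And>c c'. c \<in> C \<Longrightarrow> c' \<in> kid J \<Longrightarrow> less c c' \<Longrightarrow> c' \<in> C" for C m q
    using that
  proof (induction "card C" arbitrary: C m rule: less_induct)
    case (less C m)
    have finC: "finite C" using less.prems(2) fin finite_subset[of C V] by (auto simp: kid_def)
    have m: "m \<in> C" "m \<in> kid J" using less.prems by (auto simp: is_min_def)
    then have mV: "m \<in> V" "m \<noteq> root" "par m = J" by (auto simp: kid_def)
    define C' where "C' = {c \<in> kid (par m). less m c}"
    have C': "C' = C - {m}"
      unfolding C'_def mV using less.prems m rooted_tree.less(1,3)[OF rooted_tree_axioms]
      unfolding is_min_def by blast
    obtain xs where xs: "tr (m, False, q) xs (m, True, q)" "distinct xs" "set xs = (if q then sub m - {m} else sub m)"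
      using IH[OF m(2)] by blast
    \<comment> \<open>Leaving \<open>m\<close> adds its output exactly when \<open>q\<close> holds,
      which is when the inner trace lacks it.\<close>
    define ys where "ys = xs @ out (m, True, q)"
    have ys: "distinct ys" "set ys = sub m" using xs sub_self[OF mV(1)] by (auto simp: ys_def)
    have C_split: "\<Union> (sub ` C) = sub m \<union> \<Union> (sub ` C')" using m C' by auto
    show ?case
    proof (cases "C' = {}")
      case True
      have "mv (m, True, q) (J, True, \<not> q)"
        using leave_none[of m q] True mV by (simp add: C'_def)
      then have "tr (m, False, q) (xs @ out (m, True, q) @ []) (J, True, \<not> q)"
        by (intro tr_trans[OF xs(1) tr_step[OF _ tr_refl]])
      then show ?thesis using ys C_split True by (intro exI[of _ ys]) (simp add: ys_def)
    next
      case False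
      then obtain m' where m': "is_min C' m'" using is_min_exists finC C' by blast
      have "mv (m, True, q) (m', False, q)"
        using leave_some[of m m' q] m' mV by (simp add: C'_def)
      moreover have "\<exists>zs. tr (m', False, q) zs (J, True, \<not> q) \<and> distinct zs \<and> set zs = \<Union> (sub ` C')"
      proof (rule less.hyps[OF _ m'])
        show "card C' < card C" unfolding C' using finC m(1) by (intro psubset_card_mono) auto
        show "C' \<subseteq> kid J" by (auto simp: C'_def mV)
        show "c' \<in> C'" if "c \<in> C'" "c' \<in> kid J" "less c c'" for c c'
          using that rooted_tree.less(2)[OF rooted_tree_axioms] by (auto simp: C'_def mV)
      qed
      then obtain zs where zs: "tr (m', False, q) zs (J, True, \<not> q)" "distinct zs" "set zs = \<Union> (sub ` C')" by blast
      ultimately have "tr (m, False, q) (xs @ out (m, True, q) @ zs) (J, True, \<not> q)"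
        by (intro tr_trans[OF xs(1)] tr_step)
      then have "tr (m, False, q) (ys @ zs) (J, True, \<not> q)" by (simp add: ys_def)
      moreover have "sub m \<inter> sub c = {}" if "c \<in> C'" for c
        using sub_disjoint[OF m(2), of c] that C' less.prems(2) by auto
      then have "set ys \<inter> set zs = {}" using ys zs by auto
      moreover have "distinct (ys @ zs)" "set (ys @ zs) = \<Union> (sub ` C)"
        using ys zs C_split calculation(2) by auto
      ultimately show ?thesis by blast
    qed
  qed
  have J_notin: "J \<notin> \<Union> (sub ` kid J)" using not_below_kid by (auto simp: sub_def)
  show ?case
  proof (cases "kid J = {}")
    case True
    have "mv (J, False, p) (J, True, p)" using True by (rule enter_none)
    then have "tr (J, False, p) (out (J, False, p) @ []) (J, True, p)" by (rule tr_step[OF _ tr_refl])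
    then show ?thesis using sub_kids[OF less.prems] True by (intro exI[of _ "out (J, False, p)"]) auto
  next
    case False
    have "finite (kid J)" using fin by (simp add: kid_def)
    then obtain m where m: "is_min (kid J) m" using is_min_exists False by blast
    obtain xs where xs: "tr (m, False, \<not> p) xs (J, True, p)" "distinct xs" "set xs = \<Union> (sub ` kid J)"
      using chain[OF m, of "\<not> p"] by auto
    have "tr (J, False, p) (out (J, False, p) @ xs) (J, True, p)"
      using enter_some[OF m] xs(1) by (rule tr_step)
    then show ?thesis using xs J_notin sub_kids[OF less.prems]
      by (intro exI[of _ "out (J, False, p) @ xs"]) auto
  qed
qed

text \<open>Parents are strictly better and the node set is finite, so following parents must end,
  and it can end only at the root.\<close>

lemma sub_root: "sub root = V"
proof -
  have "up\<^sup>*\<^sup>* J root" if "J \<in> V" for J using that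
  proof (induction "card {K \<in> V. bet K J}" arbitrary: J rule: less_induct)
    case less
    show ?case
    proof (cases "J = root")
      case False
      then have p: "par J \<in> V" "bet (par J) J" using par less.prems by auto
      have "card {K \<in> V. bet K (par J)} < card {K \<in> V. bet K J}"
      proof (intro psubset_card_mono psubsetI)
        show "{K \<in> V. bet K (par J)} \<subseteq> {K \<in> V. bet K J}" using p bet(2) by blast
        have "par J \<in> {K \<in> V. bet K J}" "par J \<notin> {K \<in> V. bet K (par J)}" using p bet(1) by auto
        then show "{K \<in> V. bet K (par J)} \<noteq> {K \<in> V. bet K J}" by blast
      qed (use fin in simp)
      then have "up\<^sup>*\<^sup>* (par J) root" using less.hyps p by blast
      moreover have "up J (par J)" using False less.prems by (simp add: up_def)
      ultimately show ?thesis by (rule converse_rtranclp_into_rtranclp[rotated])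
    qed simp
  qed
  then show ?thesis by (auto simp: sub_def)
qed

lemma traverse: "\<exists>xs. tr (root, False, False) xs (root, True, False) \<and> distinct xs \<and> set xs = V"
  using traverse_sub[OF root, of False] sub_root by simp

lemma mv_V: "mv c d \<Longrightarrow> fst c \<in> V \<Longrightarrow> fst d \<in> V"
  by (erule mv.cases) (auto simp: is_min_def kid_def par)

end

section \<open>The enumeration loop\<close>

text \<open>A move looks for the least child of \<open>I\<close> above \<open>K\<close>. On entering
  \<open>J\<close> these are its own children without restriction; on leaving it they are the
  siblings after \<open>J\<close>, and the parent is recomputed because no stack is kept.\<close>

definition PRELp :: fcom where
  "PRELp = FIf (FEq (Var ''dir'') (Const 0)) (FSeq (copy ''J'' ''I'') (clear ''K''))
     (FSeq (PARp ''J'') (FSeq (copy ''par'' ''I'') (copy ''J'' ''K'')))"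

definition DECp :: fcom where
  "DECp = FIf (FEq (Var ''found'') (Const 0))
     (FIf (FEq (Var ''dir'') (Const 0)) (FSet ''dir'' (Const 0) (Const 1))
        (FSeq (copy ''I'' ''J'') (FSet ''odd'' (Const 0) (Sub (Const 1) (Var ''odd'')))))
     (FSeq (copy ''best'' ''J'')
        (FIf (FEq (Var ''dir'') (Const 0)) (FSet ''odd'' (Const 0) (Sub (Const 1) (Var ''odd'')))
           (FSet ''dir'' (Const 0) (Const 0))))"

definition BODYp :: fcom where
  "BODYp = FSeq PRELp
     (FIf (FAnd (FNot (FEq (Var ''dir'') (Const 0))) (FNot (FEq (Var ''root'') (Const 0))))
        (FSet ''fin'' (Const 0) (Const 1)) (FSeq NEXTp DECp))"

lemma writes_PRELp [simp]: "writes PRELp = {''i'', ''I'', ''K'', ''v'', ''u'', ''sk'', ''pl'', ''par'', ''root'', ''pv'', ''pu'', ''ps''}"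
  by (simp add: PRELp_def insert_commute)

lemma writes_NEXTp [simp]: "writes NEXTp = set digits \<union> innerW"
  by (auto simp: NEXTp_def innerW_def)

context strong_graph
begin

sublocale tree: rooted_tree "{c. maxirr c}" "LB {}" parent better sless
proof
  show "finite {c. maxirr c}" by (rule finite_subset[of _ "Pow {..<n}"]) (auto simp: maxirr_def)
  show "LB {} \<in> {c. maxirr c}" using maxirr_LB[OF irr_empty] by simp
  show "parent J \<in> {c. maxirr c} \<and> better (parent J) J" if "J \<in> {c. maxirr c}" "J \<noteq> LB {}" for J
    using that branch(6,7)[of J] has_parent_iff[of J] by auto
qed (use better_irrefl better_trans sless_irrefl sless_trans sless_linear in blast)+

text \<open>Only an empty child could be lost by the demand to lie above the empty set. If the empty
  set is maximal irredundant, no single vertex can be added, so it is the root.\<close>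

lemma kids_all: "kids I {} = tree.kid I"
proof -
  have "c \<noteq> {}" if c: "maxirr c" "c \<noteq> LB {}" for c
  proof
    assume e: "c = {}"
    have "u \<in> c" if "u \<in> LB {}" for u
    proof -
      have "irr (insert u {})" by (rule irr_mono[of "LB {}"]) (use that maxirr_LB[OF irr_empty] in \<open>auto simp: maxirr_def\<close>)
      then show ?thesis using c(1) that lb_less[of "n * Suc n" "{}"] e by (auto simp: maxirr_def)
    qed
    then show False using e c(2) by auto
  qed
  then show ?thesis unfolding kids_def tree.kid_def using has_parent_iff sless_empty by blast
qed

lemma kids_above: "kids I K = {c \<in> tree.kid I. sless K c}"
  unfolding kids_def tree.kid_def using has_parent_iff by blast

definition rep :: "nat set \<times> bool \<times> bool \<Rightarrow> state \<Rightarrow> bool" where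
  "rep c s \<longleftrightarrow> has_graph s \<and> set_of s ''J'' = fst c \<and> s ''dir'' 0 = of_bool (fst (snd c)) \<and>
     s ''odd'' 0 = of_bool (snd (snd c)) \<and> s ''fin'' 0 = 0"

lemma sem_BODYp:
  assumes r: "rep (J, d, p) s" and J: "maxirr J"
  shows "d \<and> J = LB {} \<Longrightarrow> sem BODYp s ''fin'' 0 = 1"
    "\<not> (d \<and> J = LB {}) \<Longrightarrow> \<exists>c. tree.mv (J, d, p) c \<and> rep c (sem BODYp s)"
proof -
  have G: "has_graph s" and sJ: "set_of s ''J'' = J" and dir: "s ''dir'' 0 = of_bool d"
    and odd: "s ''odd'' 0 = of_bool p" and fin: "s ''fin'' 0 = 0" using r by (auto simp: rep_def)
  let ?a = "sem PRELp s"
  have Ga: "has_graph ?a" by (rule has_graph_sem[OF G]) simp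
  have fra: "?a y = s y" if "y \<in> {''J'', ''dir'', ''odd'', ''fin''}" for y
    by (rule sem_other) (use that in auto)
  have sJa: "set_of ?a ''J'' = J" using sJ fra[of "''J''"] by (simp add: set_of_def)
  have root: "?a ''root'' 0 = (if J = LB {} then 1 else 0)" if d
    using that dir sem_PARp(1)[OF G, of "''J''"] sJ has_parent_iff[OF J] by (simp add: PRELp_def sem_other)
  have IK: "set_of ?a ''I'' = (if d then parent J else J) \<and> set_of ?a ''K'' = (if d then J else {})"
    if "\<not> (d \<and> J = LB {})"
  proof (cases d)
    case True
    let ?p = "sem (PARp ''J'') s"
    have Gp: "has_graph ?p" by (rule has_graph_sem[OF G]) simp
    have "has_parent J" using has_parent_iff[OF J] that True by blast
    then have "set_of ?p ''par'' = parent J" using sem_PARp(2)[OF G, of "''J''"] sJ by simp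
    moreover have "set_of ?p ''J'' = J" using set_of_sem[of "''J''" "PARp ''J''" s] sJ by simp
    ultimately show ?thesis
      using True dir sem_copy[of ?p "''I''" "''par''"] sem_copy[of "sem (copy ''par'' ''I'') ?p" "''K''" "''J''"] Gp
        has_graph_sem[OF Gp, of "copy ''par'' ''I''"]
        set_of_sem[of "''J''" "copy ''par'' ''I''" ?p] set_of_sem[of "''I''" "copy ''J'' ''K''" "sem (copy ''par'' ''I'') ?p"]
      by (simp add: PRELp_def)
  next
    case False
    then show ?thesis
      using dir sem_copy[of s "''I''" "''J''"] sem_clear[of "sem (copy ''J'' ''I'') s" "''K''"] G sJ
        has_graph_sem[OF G, of "copy ''J'' ''I''"]
        set_of_sem[of "''I''" "clear ''K''" "sem (copy ''J'' ''I'') s"]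
      by (simp add: PRELp_def)
  qed
  have dira: "?a ''dir'' 0 = of_bool d" using dir fra by simp
  show "sem BODYp s ''fin'' 0 = 1" if "d \<and> J = LB {}"
    using that dira root by (simp add: BODYp_def)
  assume nt: "\<not> (d \<and> J = LB {})"
  let ?b = "sem NEXTp ?a"
  have Gb: "has_graph ?b" by (rule has_graph_sem[OF Ga]) (simp add: digits_def innerW_def)
  have frb: "?b y = ?a y" if "y \<in> {''J'', ''dir'', ''odd'', ''fin'', ''I''}" for y
    by (rule sem_other) (use that in \<open>auto simp: digits_def innerW_def\<close>)
  let ?I = "if d then parent J else J" let ?K = "if d then J else {}"
  have found: "?b ''found'' 0 = 0 \<longleftrightarrow> kids ?I ?K = {}"
    and best: "kids ?I ?K \<noteq> {} \<Longrightarrow> set_of ?b ''best'' \<in> kids ?I ?K \<and> (\<forall>c\<in>kids ?I ?K. \<not> sless c (set_of ?b ''best''))"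
    using sem_NEXTp[OF Ga] IK[OF nt] by simp_all
  have bI: "set_of ?b ''I'' = ?I" using frb[of "''I''"] IK[OF nt] by (simp add: set_of_def)
  have bv: "?b ''dir'' 0 = of_bool d" "?b ''odd'' 0 = of_bool p" "?b ''fin'' 0 = 0" "set_of ?b ''J'' = J"
    using frb fra dir odd fin sJ by (simp_all add: set_of_def)
  have sem: "sem BODYp s = sem DECp ?b"
    using nt dira root by (auto simp: BODYp_def)
  have cp: "set_of (sem (copy X ''J'') ?b) ''J'' = set_of ?b X" "has_graph (sem (copy X ''J'') ?b)"
    if "X \<in> {''I'', ''best''}" for X
    using that sem_copy[of ?b "''J''" X] Gb has_graph_sem[OF Gb, of "copy X ''J''"] by auto
  have cp2: "sem (copy X ''J'') ?b y = ?b y" if "y \<in> {''dir'', ''odd'', ''fin''}" for X y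
    using that by (auto simp: sem_other)
  show "\<exists>c. tree.mv (J, d, p) c \<and> rep c (sem BODYp s)"
  proof (cases "kids ?I ?K = {}")
    case True
    show ?thesis
    proof (cases d)
      case d: True
      have "tree.mv (J, d, p) (parent J, True, \<not> p)"
        using tree.leave_none[of J p] True d nt kids_above by auto
      moreover have "rep (parent J, True, \<not> p) (sem BODYp s)"
        unfolding sem DECp_def using True d found bI bv cp[of "''I''"] cp2[of _ "''I''"] by (simp add: rep_def)
      ultimately show ?thesis by blast
    next
      case d: False
      have "tree.mv (J, d, p) (J, True, p)"
        using tree.enter_none[of J p] True d kids_all by auto
      moreover have "rep (J, True, p) (sem BODYp s)"
        unfolding sem DECp_def using True d found bv Gb by (simp add: rep_def)
      ultimately show ?thesis by blast
    qed
  next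
    case False
    let ?m = "set_of ?b ''best''"
    note m = best[OF False]
    show ?thesis
    proof (cases d)
      case d: True
      have "tree.mv (J, d, p) (?m, False, p)"
        using tree.leave_some[of J ?m p] m d nt unfolding kids_above by (auto simp: tree.is_min_def)
      moreover have "rep (?m, False, p) (sem BODYp s)"
        unfolding sem DECp_def using False d found bv cp[of "''best''"] cp2[of _ "''best''"] by (simp add: rep_def)
      ultimately show ?thesis by blast
    next
      case d: False
      have "tree.mv (J, d, p) (?m, False, \<not> p)"
        using tree.enter_some[of J ?m p] m d kids_all by (auto simp: tree.is_min_def)
      moreover have "rep (?m, False, \<not> p) (sem BODYp s)"
        unfolding sem DECp_def using False d found bv cp[of "''best''"] cp2[of _ "''best''"] by (simp add: rep_def)
      ultimately show ?thesis by blast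
    qed
  qed
qed

end

section \<open>Delay and space\<close>

definition chg :: "config \<Rightarrow> nat \<Rightarrow> bool" where
  "chg cg t \<longleftrightarrow> solutions ((step ^^ t) cg) \<noteq> solutions ((step ^^ (t - 1)) cg)"

text \<open>A delay bound that avoids the list of output times. Events are changes of the output and
  the end at \<open>T\<close>; in this form runs are easily concatenated.\<close>

definition good :: "nat \<Rightarrow> config \<Rightarrow> nat \<Rightarrow> bool" where
  "good D cg T \<longleftrightarrow> (\<forall>t0<T. \<exists>t. t0 < t \<and> t \<le> t0 + D \<and> t \<le> T \<and> (t = T \<or> chg cg t))"

text \<open>The waiting time for the first event, needed to bound the gap that arises when steps are
  put in front of a run.\<close>

definition soon :: "nat \<Rightarrow> config \<Rightarrow> nat \<Rightarrow> bool" where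
  "soon e cg T \<longleftrightarrow> (\<exists>t. 0 < t \<and> t \<le> e \<and> t \<le> T \<and> (t = T \<or> chg cg t))"

lemma chg_exists: "solutions cg \<noteq> solutions ((step ^^ k) cg) \<Longrightarrow> \<exists>t. 0 < t \<and> t \<le> k \<and> chg cg t"
proof (induction k)
  case (Suc k)
  show ?case
  proof (cases "solutions cg = solutions ((step ^^ k) cg)")
    case True
    then have "chg cg (Suc k)" using Suc.prems by (auto simp: chg_def)
    then show ?thesis by blast
  next
    case False
    then show ?thesis using Suc.IH le_SucI by blast
  qed
qed simp

lemma chg_shift: "0 < t \<Longrightarrow> chg ((step ^^ k) cg) t \<longleftrightarrow> chg cg (k + t)"
proof -
  assume "0 < t"
  then have "k + t - 1 = t - 1 + k" by simp
  then show ?thesis unfolding chg_def by (simp only: funpow_add comp_def add.commute[of k t])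
qed

lemma good_append:
  assumes k: "(step ^^ k) cg = cg'" and g: "good D cg' T" and s: "soon e cg' T" and "k + e \<le> D"
  shows "good D cg (k + T)"
  unfolding good_def
proof (intro allI impI)
  fix t0 assume t0: "t0 < k + T"
  show "\<exists>t. t0 < t \<and> t \<le> t0 + D \<and> t \<le> k + T \<and> (t = k + T \<or> chg cg t)"
  proof (cases "t0 < k")
    case True
    obtain t where "0 < t" "t \<le> e" "t \<le> T" "t = T \<or> chg cg' t" using s by (auto simp: soon_def)
    then show ?thesis using True assms(4) chg_shift[of t k cg] k by (intro exI[of _ "k + t"]) auto
  next
    case False
    then have "t0 - k < T" using t0 by simp
    then obtain t where "t0 - k < t" "t \<le> t0 - k + D" "t \<le> T" "t = T \<or> chg cg' t"
      using g by (auto simp: good_def)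
    then show ?thesis using False chg_shift[of t k cg] k by (intro exI[of _ "k + t"]) auto
  qed
qed

text \<open>The event that follows \<open>ts ! i\<close> is itself an entry of the sorted list
  \<open>ts\<close>, so the next entry comes no later.\<close>

lemma good_delay:
  assumes h: "halts_at c s T" and g: "good D (c, s, [], []) T"
  shows "delay_at_most c s D"
proof -
  define S where "S = {t \<in> {1..T}. solutions (run c s t) \<noteq> solutions (run c s (t - 1))}"
  define ts where "ts = 0 # output_times c s T @ [T]"
  have finS: "finite S" by (simp add: S_def)
  have set_ts: "set ts = insert 0 (insert T S)" "output_times c s T = sorted_list_of_set S"
    using finS by (auto simp: ts_def output_times_def S_def)
  have sorted: "sorted ts"
    unfolding ts_def set_ts(2) using finS by (auto simp: sorted_append S_def)
  have "ts ! Suc i - ts ! i \<le> D" if i: "Suc i < length ts" for i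
  proof (cases "ts ! i < T")
    case False
    have "ts ! Suc i \<in> set ts" using i by simp
    then have "ts ! Suc i \<le> T" using set_ts(1) by (auto simp: S_def)
    then show ?thesis using False by simp
  next
    case True
    then obtain t where t: "ts ! i < t" "t \<le> ts ! i + D" "t \<le> T" "t = T \<or> chg (c, s, [], []) t"
      using g by (auto simp: good_def)
    then have "t \<in> set ts" unfolding set_ts(1) by (auto simp: S_def chg_def run_def)
    then obtain j where j: "j < length ts" "ts ! j = t" by (auto simp: in_set_conv_nth)
    have "\<not> j \<le> i" using sorted_nth_mono[OF sorted, of j i] i j t(1) by auto
    then have "ts ! Suc i \<le> t" using sorted_nth_mono[OF sorted, of "Suc i" j] j by simp
    then show ?thesis using t(2) by simp
  qed
  then show ?thesis unfolding delay_at_most_def using h by (auto simp: ts_def Let_def)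
qed

lemma floorlog_le: "floorlog 2 x \<le> x"
  by (rule floorlog_leI) (auto simp: less_exp)

lemma memory_bits_bounded:
  assumes "finite X" "bounded X M s"
  shows "memory_bits s \<le> card X * (2 * M + 1) * (3 * M)"
proof -
  let ?S = "{(x, i). s x i \<noteq> 0}"
  have sub: "?S \<subseteq> X \<times> {..2 * M}" using assms(2) by (auto simp: bounded_def)
  have fin: "finite (X \<times> {..2 * M})" using assms(1) by simp
  have "memory_bits s \<le> (\<Sum>(x, i)\<in>?S. 3 * M)"
    unfolding memory_bits_def
  proof (rule sum_mono)
    \<comment> \<open>The crude bound \<open>floorlog_le\<close> charges at most
      \<open>2 * M\<close> bits for the index and \<open>M\<close> for the content.\<close>
    fix p assume "p \<in> ?S"
    then obtain x i where p: "p = (x, i)" "i \<le> 2 * M" "s x i \<le> M" using assms(2) by (auto simp: bounded_def)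
    then show "(case p of (x, i) \<Rightarrow> floorlog 2 i + floorlog 2 (s x i)) \<le> (case p of (x, i) \<Rightarrow> 3 * M)"
      using floorlog_le[of i] floorlog_le[of "s x i"] by simp
  qed
  also have "\<dots> = card ?S * (3 * M)" by (simp add: case_prod_unfold)
  also have "\<dots> \<le> card (X \<times> {..2 * M}) * (3 * M)" by (intro mult_le_mono1 card_mono fin sub)
  finally show ?thesis by (simp add: card_cartesian_product)
qed

lemma poly_mono_nat: "a \<le> b \<Longrightarrow> poly (p :: nat poly) a \<le> poly p b"
  by (induction p) (auto intro!: add_mono mult_mono)

lemma ex_Put: "P (s, D, c) \<Longrightarrow> P (s, D, c @ [aval a s]) \<Longrightarrow> ex P (Put a) (s, D, c) 1 (s, D, c @ [aval a s])"
  unfolding ex_def by (rule exI[of _ 1]) (auto intro!: reach.intros)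

lemma ex_Emit: "P (s, D, c) \<Longrightarrow> P (s, D @ [c], []) \<Longrightarrow> ex P Emit (s, D, c) 1 (s, D @ [c], [])"
  unfolding ex_def by (rule exI[of _ 1]) (auto intro!: reach.intros)

text \<open>\<open>J\<close> consists of labels, whereas solutions are to be written in the original
  vertices; so each original vertex is looked up through \<open>pos\<close>.\<close>

definition OUTc :: com where
  "OUTc = Seq (Assign ''o'' (Const 0) (Const 0))
     (Seq (While (Less (Var ''o'') (Var ''n''))
        (Seq (Cond (Less (Const 0) (Elem ''J'' (Elem ''pos'' (Var ''o'')))) (Put (Var ''o'')) Skip)
           (Assign ''o'' (Const 0) (Add (Var ''o'') (Const 1)))))
     (Seq (Assign ''o'' (Const 0) (Const 0)) Emit))"

definition LOOPc :: com where
  "LOOPc = While (Less (Var ''fin'') (Const 1))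
     (Seq (Cond (Conj (Neg (Less (Var ''dir'') (Var ''odd''))) (Neg (Less (Var ''odd'') (Var ''dir'')))) OUTc Skip)
        (cc BODYp))"

lemma ex_OUTc:
  assumes b: "bounded X M s" "''o'' \<in> X" and n: "s ''n'' 0 = n" "n \<le> M" and o: "s ''o'' 0 = 0"
  shows "ex (\<lambda>r. bounded X M (fst r)) OUTc (s, D, []) (6 * n + 10)
    (s, D @ [filter (\<lambda>x. 0 < s ''J'' (s ''pos'' x)) [0..<n]], [])"
proof -
  let ?P = "\<lambda>r :: state \<times> nat list list \<times> nat list. bounded X M (fst r)"
  let ?g = "\<lambda>x. 0 < s ''J'' (s ''pos'' x)"
  define f where "f i = (upd s ''o'' 0 i, D, filter ?g [0..<i])" for i
  have bf: "bounded X M (upd s ''o'' 0 i)" if "i \<le> n" for i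
    using bounded_upd[OF b] that n by auto
  have s0: "upd s ''o'' 0 0 = s" using o by (rule upd_id)
  have body: "ex ?P (Seq (Cond (Less (Const 0) (Elem ''J'' (Elem ''pos'' (Var ''o'')))) (Put (Var ''o'')) Skip)
           (Assign ''o'' (Const 0) (Add (Var ''o'') (Const 1)))) (f i) 4 (f (Suc i))" if i: "i < n" for i
  proof -
    let ?t = "upd s ''o'' 0 i"
    have bi: "bounded X M ?t" using bf i by simp
    have "ex ?P (Cond (Less (Const 0) (Elem ''J'' (Elem ''pos'' (Var ''o'')))) (Put (Var ''o'')) Skip) (f i) (1 + 1)
       (?t, D, filter ?g [0..<Suc i])"
    proof (rule ex_Cond, cases "?g i")
      case True
      then show "ex ?P (if bval (Less (Const 0) (Elem ''J'' (Elem ''pos'' (Var ''o'')))) (fst (f i)) then Put (Var ''o'') else Skip)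
         (f i) 1 (?t, D, filter ?g [0..<Suc i])"
        using ex_Put[of ?P ?t D "filter ?g [0..<i]" "Var ''o''"] bi by (simp add: f_def)
    next
      case False
      then show "ex ?P (if bval (Less (Const 0) (Elem ''J'' (Elem ''pos'' (Var ''o'')))) (fst (f i)) then Put (Var ''o'') else Skip)
         (f i) 1 (?t, D, filter ?g [0..<Suc i])"
        using ex_mono[OF ex_Skip[of ?P "(?t, D, filter ?g [0..<i])"], of 1] bi by (simp add: f_def)
    qed
    note 1 = this
    have 2: "ex ?P (Assign ''o'' (Const 0) (Add (Var ''o'') (Const 1))) (?t, D, filter ?g [0..<Suc i]) 1 (f (Suc i))"
      using ex_Assign[of ?P ?t "(D, filter ?g [0..<Suc i])" "''o''" "Const 0" "Add (Var ''o'') (Const 1)"]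
        bi bf[of "Suc i"] i by (simp add: f_def)
    show ?thesis by (rule ex_mono[OF ex_Seq[OF 1 2]]) simp
  qed
  have loop: "ex ?P (While (Less (Var ''o'') (Var ''n''))
        (Seq (Cond (Less (Const 0) (Elem ''J'' (Elem ''pos'' (Var ''o'')))) (Put (Var ''o'')) Skip)
           (Assign ''o'' (Const 0) (Add (Var ''o'') (Const 1))))) (f 0) ((n - 0) * (4 + 2) + 1) (f n)"
    by (rule ex_counting) (use body bf n in \<open>auto simp: f_def\<close>)
  have 1: "ex ?P (Assign ''o'' (Const 0) (Const 0)) (s, D, []) 1 (f 0)"
    using ex_Assign[of ?P s "(D, [])" "''o''" "Const 0" "Const 0"] b s0 by (simp add: f_def)
  have 2: "ex ?P (Assign ''o'' (Const 0) (Const 0)) (f n) 1 (s, D, filter ?g [0..<n])"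
    using ex_Assign[of ?P "upd s ''o'' 0 n" "(D, filter ?g [0..<n])" "''o''" "Const 0" "Const 0"] b bf[of n] s0
    by (simp add: f_def)
  have 3: "ex ?P Emit (s, D, filter ?g [0..<n]) 1 (s, D @ [filter ?g [0..<n]], [])"
    by (rule ex_Emit) (use b in auto)
  show ?thesis unfolding OUTc_def
    by (rule ex_mono[OF ex_Seq[OF 1 ex_Seq[OF loop ex_Seq[OF 2 3]]]]) simp
qed

lemma zfree [simp]: "c \<noteq> CHR ''z'' \<Longrightarrow> c # xs \<notin> range zv" "qv d \<notin> range zv"
  by auto

text \<open>Time of one round of the main loop. The linear term covers writing a solution, the
  constant the bookkeeping, with room for the final loop test.\<close>

definition "iter_poly = cost BODYp + [:16, 6:]"

context strong_graph
begin

definition rep2 :: "vname set \<Rightarrow> nat \<Rightarrow> (nat \<Rightarrow> nat) \<Rightarrow> nat set \<times> bool \<times> bool \<Rightarrow> state \<Rightarrow> bool" where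
  "rep2 X M ps c s \<longleftrightarrow> rep c s \<and> clean s \<and> bounded X M s \<and> s ''pos'' = ps \<and> s ''o'' 0 = 0"

definition sol :: "(nat \<Rightarrow> nat) \<Rightarrow> nat set \<Rightarrow> nat list" where
  "sol ps J = filter (\<lambda>x. ps x \<in> J) [0..<n]"

lemma wfc_BODYp: "wfc BODYp"
  by (simp add: BODYp_def PRELp_def DECp_def NEXTp_def digits_def innerp_def checkp_def PARp_def tryp_def
    LBp_def PREp_def CANDp_def copy_def clear_def irrF_def Let_def colF_def eqF_def lessF_def testF_def candF_def
    keepF_def isF_def doomedF_def innerW_def)

lemma iteration:
  assumes r: "rep2 X M ps c s" and X: "cwrites LOOPc \<subseteq> X" and M: "n + 1 \<le> M"
    and ps: "\<And>x. x < n \<Longrightarrow> ps x < n"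
  obtains k s' where "0 < k" "k + 2 \<le> poly iter_poly n"
    "reach (\<lambda>r. bounded X M (fst r)) (LOOPc, s, D, []) k (LOOPc, s', D @ map (sol ps) (tree.out c), [])"
    "s' = sem BODYp s" "clean s'" "bounded X M s'" "s' ''pos'' = ps" "s' ''o'' 0 = 0"
proof -
  let ?P = "\<lambda>r :: state \<times> nat list list \<times> nat list. bounded X M (fst r)"
  let ?C = "Cond (Conj (Neg (Less (Var ''dir'') (Var ''odd''))) (Neg (Less (Var ''odd'') (Var ''dir'')))) OUTc Skip"
  let ?D = "D @ map (sol ps) (tree.out c)"
  obtain J d p where c: "c = (J, d, p)" by (cases c) auto
  have s: "has_graph s" "set_of s ''J'' = J" "s ''dir'' 0 = of_bool d" "s ''odd'' 0 = of_bool p" "s ''fin'' 0 = 0"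
    "clean s" "bounded X M s" "s ''pos'' = ps" "s ''o'' 0 = 0"
    using r by (auto simp: rep2_def rep_def c)
  have n: "s ''n'' 0 = n" using s by simp
  have oX: "''o'' \<in> X" using X by (auto simp: LOOPc_def OUTc_def)
  have sol: "filter (\<lambda>x. 0 < s ''J'' (s ''pos'' x)) [0..<n] = sol ps J"
    unfolding sol_def by (rule filter_cong) (use s ps in \<open>auto simp: set_of_def\<close>)
  have out: "ex ?P ?C (s, D, []) (6 * n + 10 + 1) (s, ?D, [])"
  proof (rule ex_Cond, cases "d = p")
    case True
    then show "ex ?P (if bval (Conj (Neg (Less (Var ''dir'') (Var ''odd''))) (Neg (Less (Var ''odd'') (Var ''dir'')))) (fst (s, D, []))
       then OUTc else Skip) (s, D, []) (6 * n + 10) (s, ?D, [])"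
      using ex_OUTc[OF s(7) oX n _ s(9), of D] M s sol by (simp add: c)
  next
    case False
    then show "ex ?P (if bval (Conj (Neg (Less (Var ''dir'') (Var ''odd''))) (Neg (Less (Var ''odd'') (Var ''dir'')))) (fst (s, D, []))
       then OUTc else Skip) (s, D, []) (6 * n + 10) (s, ?D, [])"
      using ex_mono[OF ex_Skip[of ?P "(s, D, [])"], of "6 * n + 10"] s by (auto simp: c)
  qed
  have "ex (quiet X M (?D, [])) (cc BODYp) (s, ?D, []) (poly (cost BODYp) n) (sem BODYp s, ?D, [])"
    by (rule cc_correct[OF wfc_BODYp]) (use s n X M in \<open>auto simp: LOOPc_def\<close>)
  then have body: "ex ?P (cc BODYp) (s, ?D, []) (poly (cost BODYp) n) (sem BODYp s, ?D, [])"
    by (rule ex_Pmono) (auto simp: quiet_def)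
  from ex_Seq[OF out body] obtain k where k: "k \<le> 6 * n + 10 + 1 + poly (cost BODYp) n + 1"
    "reach ?P (Seq ?C (cc BODYp), s, D, []) k (Skip, sem BODYp s, ?D, [])" by (auto simp: ex_def)
  have b': "bounded X M (sem BODYp s)" using ex_end[OF body] by simp
  have "reach ?P (Seq (Seq ?C (cc BODYp)) LOOPc, s, D, []) k (Seq Skip LOOPc, sem BODYp s, ?D, [])"
    using reach_Seq[OF k(2), of LOOPc] by simp
  moreover have "reach ?P (Seq Skip LOOPc, sem BODYp s, ?D, []) 1 (LOOPc, sem BODYp s, ?D, [])"
    using b' by (auto intro!: reach.intros)
  ultimately have "reach ?P (Seq (Seq ?C (cc BODYp)) LOOPc, s, D, []) (k + 1) (LOOPc, sem BODYp s, ?D, [])"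
    by (rule reach_trans)
  moreover have "step (LOOPc, s, D, []) = (Seq (Seq ?C (cc BODYp)) LOOPc, s, D, [])"
    using s(5) by (simp add: LOOPc_def)
  ultimately have "reach ?P (LOOPc, s, D, []) (Suc (k + 1)) (LOOPc, sem BODYp s, ?D, [])"
    using s(7) by (intro reach_Suc) (auto simp: LOOPc_def)
  moreover have "sem BODYp s ''pos'' = ps" "sem BODYp s ''o'' = s ''o''"
    using s(8) by (auto simp: sem_other BODYp_def DECp_def digits_def innerW_def)
  ultimately show thesis
    using that[of "Suc (k + 1)" "sem BODYp s"] k(1) clean_sem[OF wfc_BODYp s(6)] b' s(9)
    by (simp add: iter_poly_def)
qed

text \<open>A round takes at most \<open>B\<close> steps and every second round writes a solution.
  So an event occurs within \<open>2 * B\<close> steps of a silent configuration and within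
  \<open>B\<close> steps of any other; one more round in front gives the delay
  \<open>3 * B\<close>.\<close>

lemma loop_run:
  assumes "tree.tr c xs e" "e = (LB {}, True, False)" "rep2 X M ps c s" "maxirr (fst c)"
    and X: "cwrites LOOPc \<subseteq> X" and M: "n + 1 \<le> M" and ps: "\<And>x. x < n \<Longrightarrow> ps x < n"
  defines "B \<equiv> poly iter_poly n"
  shows "\<exists>T s'. reach (\<lambda>r. bounded X M (fst r)) (LOOPc, s, D, []) T (Skip, s', D @ map (sol ps) xs, []) \<and>
     0 < T \<and> good (3 * B) (LOOPc, s, D, []) T \<and>
     soon (if tree.out c = [] then 2 * B else B) (LOOPc, s, D, []) T"
  using assms(1-4)
proof (induction arbitrary: s D rule: tree.tr.induct)
  case (tr_refl c)
  let ?P = "\<lambda>r :: state \<times> nat list list \<times> nat list. bounded X M (fst r)"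
  obtain k s' where k: "0 < k" "k + 2 \<le> B" "reach ?P (LOOPc, s, D, []) k (LOOPc, s', D @ map (sol ps) (tree.out c), [])"
      "s' = sem BODYp s" "bounded X M s'"
    unfolding B_def by (rule iteration[OF tr_refl(2) X M ps, of D]) (blast intro: that)
  have "rep c s" using tr_refl by (simp add: rep2_def)
  then have "s' ''fin'' 0 = 1" using sem_BODYp(1)[of "LB {}" True False s] tr_refl k(4) by simp
  then have "step (LOOPc, s', D, []) = (Skip, s', D, [])" by (simp add: LOOPc_def)
  then have "reach ?P (LOOPc, s', D, []) 1 (Skip, s', D, [])"
    using k(5) by (auto intro!: reach.intros simp: LOOPc_def)
  from reach_trans[OF _ this] k(3) tr_refl(1)
  have r: "reach ?P (LOOPc, s, D, []) (k + 1) (Skip, s', D, [])" by simp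
  moreover have "good (3 * B) (LOOPc, s, D, []) (k + 1)"
    unfolding good_def using k(2) by (intro allI impI exI[of _ "k + 1"]) auto
  moreover have "soon (if tree.out c = [] then 2 * B else B) (LOOPc, s, D, []) (k + 1)"
    unfolding soon_def using k(2) by (intro exI[of _ "k + 1"]) auto
  ultimately show ?case by (intro exI[of _ "k + 1"] exI[of _ s']) simp
next
  case (tr_step c d ys e)
  let ?P = "\<lambda>r :: state \<times> nat list list \<times> nat list. bounded X M (fst r)"
  let ?D = "D @ map (sol ps) (tree.out c)"
  obtain k s' where k: "0 < k" "k + 2 \<le> B" "reach ?P (LOOPc, s, D, []) k (LOOPc, s', ?D, [])"
      "s' = sem BODYp s" "clean s'" "bounded X M s'" "s' ''pos'' = ps" "s' ''o'' 0 = 0"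
    unfolding B_def by (rule iteration[OF tr_step.prems(2) X M ps, of D]) (blast intro: that)
  obtain J dr p where c: "c = (J, dr, p)" by (cases c) auto
  have r: "rep (J, dr, p) s" "maxirr J" using tr_step.prems by (auto simp: rep2_def c)
  have "\<not> (dr \<and> J = LB {})" using tr_step.hyps(1) tree.mv_not_final unfolding c by (metis (full_types))
  then obtain d' where d': "tree.mv c d'" "rep d' s'" using sem_BODYp(2)[OF r] k(4) unfolding c by blast
  have "d' = d" using tree.mv_det[OF d'(1) tr_step.hyps(1)] .
  then have rd: "rep2 X M ps d s'" using d' k by (simp add: rep2_def)
  have "maxirr (fst d)" using tree.mv_V[OF tr_step.hyps(1)] tr_step.prems(3) by simp
  from tr_step.IH[OF tr_step.prems(1) rd this, of ?D] obtain T s'' where T: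
    "reach ?P (LOOPc, s', ?D, []) T (Skip, s'', ?D @ map (sol ps) ys, [])" "0 < T"
    "good (3 * B) (LOOPc, s', ?D, []) T" "soon (if tree.out d = [] then 2 * B else B) (LOOPc, s', ?D, []) T"
    by blast
  have kf: "(step ^^ k) (LOOPc, s, D, []) = (LOOPc, s', ?D, [])" using reach_final[OF k(3)] .
  have "good (3 * B) (LOOPc, s, D, []) (k + T)"
    by (rule good_append[OF kf T(3,4)]) (use k(2) in auto)
  moreover have "soon (if tree.out c = [] then 2 * B else B) (LOOPc, s, D, []) (k + T)"
  proof (cases "tree.out c = []")
    case True
    then have "tree.out d \<noteq> []" using tree.mv_out tr_step.hyps(1) by blast
    then obtain t where t: "0 < t" "t \<le> B" "t \<le> T" "t = T \<or> chg (LOOPc, s', ?D, []) t"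
      using T(4) by (auto simp: soon_def)
    then show ?thesis unfolding soon_def using True k(2) chg_shift[of t k "(LOOPc, s, D, [])"] kf
      by (intro exI[of _ "k + t"]) auto
  next
    case False
    have "solutions (LOOPc, s, D, []) \<noteq> solutions ((step ^^ k) (LOOPc, s, D, []))"
      unfolding kf using False by (simp add: solutions_def)
    then obtain t where "0 < t" "t \<le> k" "chg (LOOPc, s, D, []) t" using chg_exists by blast
    then show ?thesis unfolding soon_def using False k(2) by (intro exI[of _ t]) auto
  qed
  moreover have "reach ?P (LOOPc, s, D, []) (k + T) (Skip, s'', D @ map (sol ps) (tree.out c @ ys), [])"
    using reach_trans[OF k(3) T(1)] by simp
  ultimately show ?case using T(2) by (intro exI[of _ "k + T"] exI[of _ s'']) simp
qed

end

section \<open>Initialisation\<close>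

definition vicF :: "aexp \<Rightarrow> aexp \<Rightarrow> fm" where
  "vicF a b = FAll (FImp (FAnd (FNot (memF ''U'' (Q (Suc (Suc 0))))) (adjF ''A'' a (Q (Suc (Suc 0)))))
     (FOr (FEq (Q (Suc (Suc 0))) b) (adjF ''A'' b (Q (Suc (Suc 0))))))"

definition qsF :: fm where
  "qsF = FAll (FAll (FImp (FAnd (FNot (memF ''U'' (Q 0))) (FAnd (FNot (memF ''U'' (Q (Suc 0))))
      (FAnd (adjF ''A'' (Var ''y'') (Q 0)) (FAnd (adjF ''A'' (Var ''y'') (Q (Suc 0))) (FNot (FEq (Q 0) (Q (Suc 0))))))))
    (FOr (vicF (Q 0) (Q (Suc 0))) (vicF (Q (Suc 0)) (Q 0)))))"

definition orderF :: fm where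
  "orderF = FAll (FAll (FAll (FImp (FAnd (memF ''U'' (Q 0)) (FAnd (FNot (memF ''U'' (Q (Suc 0))))
      (FAnd (FNot (FEq (Q (Suc 0)) (Var ''y''))) (FAnd (adjF ''A'' (Q 0) (Var ''y'')) (FAnd (adjF ''A'' (Q 0) (Q (Suc 0)))
      (FAnd (adjF ''A'' (Var ''y'') (Q (Suc (Suc 0))))
        (FNot (FLess (Elem ''pos'' (Q 0)) (Elem ''pos'' (Q (Suc (Suc 0))))))))))))
    (FOr (FEq (Q (Suc 0)) (Q (Suc (Suc 0)))) (adjF ''A'' (Q (Suc 0)) (Q (Suc (Suc 0))))))))"

definition eligF :: fm where
  "eligF = FAnd (FNot (memF ''U'' (Var ''y''))) (FAnd qsF orderF)"

text \<open>Round \<open>x\<close> gives the label \<open>n - 1 - x\<close> to the first eligible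
  vertex met, so labels decrease in the order of elimination; \<open>found\<close> makes the rest of
  the round idle.\<close>

definition pickp :: fcom where
  "pickp = FIf (FAnd (FEq (Var ''found'') (Const 0)) eligF)
     (FSeq (FSet ''pos'' (Var ''y'') (Sub (Sub (Var ''n'') (Const 1)) (Var ''x'')))
     (FSeq (FSet ''U'' (Var ''y'') (Const 1)) (FSet ''found'' (Const 0) (Const 1)))) FSkip"

definition ORDERp :: fcom where
  "ORDERp = FFor ''x'' (FSeq (FSet ''found'' (Const 0) (Const 0)) (FFor ''y'' pickp))"

definition RELp :: fcom where
  "RELp = FFor ''x'' (FFor ''y'' (FSet ''B'' (Add (Elem ''rows'' (Elem ''pos'' (Var ''x''))) (Elem ''pos'' (Var ''y'')))
     (Elem ''A'' (Add (Elem ''rows'' (Var ''x'')) (Var ''y'')))))"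

text \<open>\<open>K\<close> has not been written yet and denotes the empty set, so \<open>J\<close>
  becomes the root \<open>LB {}\<close>.\<close>

definition INITp :: fcom where
  "INITp = FSeq ORDERp (FSeq RELp (LBp ''K'' ''J''))"

lemma writes_pickp [simp]: "writes pickp = {''pos'', ''U'', ''found'', ''sk''}"
  by (auto simp: pickp_def)

lemma writes_ORDERp [simp]: "writes ORDERp = {''x'', ''y'', ''pos'', ''U'', ''found'', ''sk''}"
  by (simp add: ORDERp_def insert_commute)

lemma writes_RELp [simp]: "writes RELp = {''x'', ''y'', ''B''}"
  by (auto simp: RELp_def)

lemma wfc_INITp: "wfc INITp"
  by (simp add: INITp_def ORDERp_def pickp_def RELp_def eligF_def qsF_def vicF_def orderF_def LBp_def clear_def
      irrF_def Let_def colF_def)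

lemma upd_fun: "upd s x i k x = (s x)(i := k)"
  by (simp add: upd_def)

context graph
begin

definition has_input :: "state \<Rightarrow> bool" where
  "has_input s \<longleftrightarrow> s ''n'' 0 = n \<and> (\<forall>a<n. \<forall>b<n. 0 < s ''A'' (s ''rows'' a + b) \<longleftrightarrow> adj a b)"

lemma has_input_adj:
  "has_input s \<Longrightarrow> a < n \<Longrightarrow> b < n \<Longrightarrow> 0 < s ''A'' (s ''rows'' a + b) \<longleftrightarrow> adj a b"
  by (simp add: has_input_def)

lemma fval_eligF:
  assumes s: "has_input s" and y: "s ''y'' 0 < n"
  shows "fval 0 eligF s \<longleftrightarrow> eligible (set_of s ''U'') (s ''pos'') (s ''y'' 0)"
proof -
  have n: "s ''n'' 0 = n" using s by (simp add: has_input_def)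
  let ?U = "set_of s ''U''" let ?y = "s ''y'' 0"
  have U: "c \<in> {..<n} - ?U \<longleftrightarrow> c < n \<and> s ''U'' c = 0" for c by (auto simp: set_of_def)
  have vic_iff: "vic ({..<n} - ?U) a b \<longleftrightarrow> (\<forall>c<n. s ''U'' c = 0 \<and> adj a c \<longrightarrow> c = b \<or> adj b c)" for a b
    unfolding vic_def Ball_def U by blast
  have vic: "fval (Suc (Suc 0)) (vicF (Q 0) (Q (Suc 0))) (upd (upd s (qv 0) 0 a) (qv (Suc 0)) 0 b) \<longleftrightarrow> vic ({..<n} - ?U) a b"
    "fval (Suc (Suc 0)) (vicF (Q (Suc 0)) (Q 0)) (upd (upd s (qv 0) 0 a) (qv (Suc 0)) 0 b) \<longleftrightarrow> vic ({..<n} - ?U) b a"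
    if "a < n" "b < n" for a b
    unfolding vic_iff using that n by (simp_all add: vicF_def has_input_adj[OF s])
  have 1: "fval 0 qsF s \<longleftrightarrow> qs ({..<n} - ?U) ?y"
  proof -
    have "fval 0 qsF s \<longleftrightarrow> (\<forall>a<n. \<forall>b<n. a \<notin> ?U \<and> b \<notin> ?U \<and> adj ?y a \<and> adj ?y b \<and> a \<noteq> b \<longrightarrow>
        vic ({..<n} - ?U) a b \<or> vic ({..<n} - ?U) b a)"
      using n y vic
      by (simp add: qsF_def set_of_def has_input_adj[OF s])
    then show ?thesis by (simp add: qs_def) blast
  qed
  have 2: "fval 0 orderF s \<longleftrightarrow> (\<forall>j<n. \<forall>a<n. \<forall>b<n. j \<in> ?U \<longrightarrow> a \<notin> ?U \<longrightarrow> a \<noteq> ?y \<longrightarrow> adj j ?y \<longrightarrow> adj j a \<longrightarrow>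
      adj ?y b \<longrightarrow> s ''pos'' b \<le> s ''pos'' j \<longrightarrow> cadj a b)"
    using n y by (simp add: orderF_def set_of_def has_input_adj[OF s] cadj_def not_less) blast
  have 3: "fval 0 (memF ''U'' (Var ''y'')) s \<longleftrightarrow> ?y \<in> ?U" using y by (simp add: set_of_def)
  show ?thesis unfolding eligF_def eligible_def using 1 2 3 by simp
qed

lemma has_input_frame: "has_input s \<Longrightarrow> \<forall>y. y \<notin> W \<longrightarrow> t y = s y \<Longrightarrow> {''n'', ''A'', ''rows''} \<inter> W = {} \<Longrightarrow> has_input t"
proof -
  assume h: "has_input s" "\<forall>y. y \<notin> W \<longrightarrow> t y = s y" "{''n'', ''A'', ''rows''} \<inter> W = {}"
  then have "t ''n'' = s ''n''" "t ''A'' = s ''A''" "t ''rows'' = s ''rows''" by blast+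
  then show ?thesis using h(1) by (metis has_input_def)
qed

lemma sem_ORDERp:
  assumes s: "has_input s" "s ''U'' = (\<lambda>_. 0)" "s ''pos'' = (\<lambda>_. 0)"
    and qs: "\<And>W. W \<subseteq> {..<n} \<Longrightarrow> W \<noteq> {} \<Longrightarrow> \<exists>v\<in>W. qs W v"
  shows "labelling {..<n} (sem ORDERp s ''pos'')"
proof -
  let ?body = "FSeq (FSet ''found'' (Const 0) (Const 0)) (FFor ''y'' pickp)"
  let ?I = "\<lambda>i t. labelling (set_of t ''U'') (t ''pos'') \<and> card (set_of t ''U'') = i"
  have n: "s ''n'' 0 = n" using s by (simp add: has_input_def)
  show ?thesis unfolding ORDERp_def
  proof (rule sem_For[where I = ?I and n = n and I' = "\<lambda>t. labelling {..<n} (t ''pos'')"])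
    have "set_of s ''U'' = {}" using s by (simp add: set_of_def)
    then show "?I 0 s" using s by (simp add: labelling_def bij_betw_def)
    show "labelling {..<n} (upd t ''x'' 0 0 ''pos'')" if "?I n t" for t
    proof -
      have "set_of t ''U'' = {..<n}" by (rule card_subset_eq) (use that set_of_less in auto)
      then show ?thesis using that by simp
    qed
    fix i t assume i: "i < n" "?I i t" and fr: "\<forall>y. y \<notin> insert ''x'' (writes ?body) \<longrightarrow> t y = s y"
    let ?R = "set_of t ''U''" let ?p = "t ''pos''"
    let ?t = "upd (upd t ''x'' 0 i) ''found'' 0 0"
    have G: "has_input t" by (rule has_input_frame[OF s(1) fr]) simp
    have Gt: "has_input ?t" by (rule has_input_frame[OF G, of "{''x'', ''found''}"]) simp_all
    have R: "?R \<subset> {..<n}" using i(1,2) set_of_less[of t "''U''"] by (metis card_lessThan nat_neq_iff psubsetI)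
    obtain v where v: "v < n" "eligible ?R ?p v" using eligible_exists[OF _ R qs] i(2) by blast
    \<comment> \<open>As long as nothing is found, the old labelling is intact and all vertices
      tried so far are ineligible; ending that way would contradict the existence of
      \<open>v\<close>.\<close>
    let ?K = "\<lambda>j r. r ''x'' 0 = i \<and> (if r ''found'' 0 = 0
       then set_of r ''U'' = ?R \<and> r ''pos'' = ?p \<and> (\<forall>y<j. \<not> eligible ?R ?p y) else ?I (Suc i) r)"
    have "?K n (sem (FFor ''y'' pickp) ?t)"
    proof (rule sem_For[where I = ?K and n = n and I' = "?K n"])
      show "?t ''n'' 0 = n" using Gt by (simp add: has_input_def)
      show "?K 0 ?t" by simp
      fix j r assume j: "j < n" "?K j r" and fr2: "\<forall>y. y \<notin> insert ''y'' (writes pickp) \<longrightarrow> r y = ?t y"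
      let ?r = "upd r ''y'' 0 j"
      have Gr: "has_input r" by (rule has_input_frame[OF Gt fr2]) simp
      have Gy: "has_input ?r" by (rule has_input_frame[OF Gr, of "{''y''}"]) simp_all
      have rn: "r ''n'' 0 = n" using Gr by (simp add: has_input_def)
      have el: "fval 0 eligF ?r \<longleftrightarrow> eligible (set_of r ''U'') (r ''pos'') j"
        using fval_eligF[OF Gy] j(1) by simp
      show "?K (Suc j) (sem pickp ?r)"
      proof (cases "r ''found'' 0 = 0 \<and> eligible (set_of r ''U'') (r ''pos'') j")
        case True
        then have e: "eligible ?R ?p j" "set_of r ''U'' = ?R" "r ''pos'' = ?p" "r ''x'' 0 = i" using j(2) by simp_all
        have cR: "card ?R = i" "labelling ?R ?p" "j \<notin> ?R" "finite ?R"
          using i(2) e(1) finite_subset[OF set_of_less] by (auto simp: eligible_def)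
        have "labelling (insert j ?R) (?p(j := n - 1 - i))"
          using labelling_step[OF cR(2) e(1) j(1)] cR(1) by simp
        moreover have "sem pickp ?r = upd (upd (upd ?r ''pos'' j (n - 1 - i)) ''U'' j 1) ''found'' 0 1"
          using True el e(4) rn by (simp add: pickp_def)
        ultimately show ?thesis using e cR j(1) by (simp add: upd_fun fun_upd_def)
      next
        case False
        then have "sem pickp ?r = upd ?r ''sk'' 0 0" using el by (auto simp: pickp_def)
        then show ?thesis using False j(2) by (auto simp: less_Suc_eq)
      qed
    qed simp_all
    then show "?I (Suc i) (sem ?body (upd t ''x'' 0 i))" using v by (auto split: if_splits)
  qed (use n in simp_all)
qed

end

context labelled_graph
begin

lemma sem_RELp:
  assumes s: "has_input s" "s ''pos'' = pos" "\<And>k. k < n \<Longrightarrow> s ''rows'' k = k * n"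
  shows "H.has_graph (sem RELp s)"
proof -
  have n: "s ''n'' 0 = n" using s by (simp add: has_input_def)
  let ?eq = "\<lambda>t a b. t ''B'' (pos a * n + pos b) = s ''A'' (a * n + b)"
  let ?set = "FSet ''B'' (Add (Elem ''rows'' (Elem ''pos'' (Var ''x''))) (Elem ''pos'' (Var ''y'')))
     (Elem ''A'' (Add (Elem ''rows'' (Var ''x'')) (Var ''y'')))"
  have inj: "pos a * n + pos b = pos a' * n + pos b' \<longleftrightarrow> a = a' \<and> b = b'" if "a < n" "b < n" "a' < n" "b' < n" for a b a' b'
  proof
    assume e: "pos a * n + pos b = pos a' * n + pos b'"
    have "pos b < n" "pos b' < n" using that pos_less by auto
    then have "pos a = pos a'" "pos b = pos b'"
      using arg_cong[OF e, of "\<lambda>x. x div n"] arg_cong[OF e, of "\<lambda>x. x mod n"] by simp_all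
    then show "a = a' \<and> b = b'" using pos_inj that by blast
  qed simp
  have B: "\<forall>a<n. \<forall>b<n. ?eq (sem RELp s) a b"
    unfolding RELp_def
  proof (rule sem_For[where I = "\<lambda>i t. \<forall>a<i. \<forall>b<n. ?eq t a b" and n = n and I' = "\<lambda>t. \<forall>a<n. \<forall>b<n. ?eq t a b"])
    fix i t assume i: "i < n" "\<forall>a<i. \<forall>b<n. ?eq t a b" and fr: "\<forall>y. y \<notin> insert ''x'' (writes (FFor ''y'' ?set)) \<longrightarrow> t y = s y"
    let ?t = "upd t ''x'' 0 i"
    let ?I = "\<lambda>j r. r ''x'' 0 = i \<and> (\<forall>a<n. \<forall>b<n. a < i \<or> (a = i \<and> b < j) \<longrightarrow> ?eq r a b)"
    have "?I n (sem (FFor ''y'' ?set) ?t)"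
    proof (rule sem_For[where I = ?I and n = n and I' = "?I n"])
      show "?t ''n'' 0 = n" using fr n by simp
      show "?I 0 ?t" using i by simp
      fix j r assume j: "j < n" "?I j r" and fr2: "\<forall>y. y \<notin> insert ''y'' (writes ?set) \<longrightarrow> r y = ?t y"
      have e: "r ''rows'' = s ''rows''" "r ''pos'' = pos" "r ''A'' = s ''A''" using fr fr2 s(2) by simp_all
      have "sem ?set (upd r ''y'' 0 j) = upd (upd r ''y'' 0 j) ''B'' (pos i * n + pos j) (s ''A'' (i * n + j))"
        using j(2) e s(3)[OF i(1)] s(3)[OF pos_less[OF i(1)]] by simp
      moreover have "?eq (upd (upd r ''y'' 0 j) ''B'' (pos i * n + pos j) (s ''A'' (i * n + j))) a b"
        if "a < n" "b < n" "a < i \<or> (a = i \<and> b < Suc j)" for a b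
      proof (cases "a = i \<and> b = j")
        case False
        then have "pos a * n + pos b \<noteq> pos i * n + pos j" using inj[OF that(1,2) i(1) j(1)] by simp
        moreover have "?eq r a b" using j(2) that False by (auto simp: less_Suc_eq)
        ultimately show ?thesis by simp
      qed simp
      ultimately show "?I (Suc j) (sem ?set (upd r ''y'' 0 j))" using j(2) by simp
    next
      show "?I n (upd r ''y'' 0 0)" if "?I n r" for r using that by simp
    qed simp
    then show "\<forall>a<Suc i. \<forall>b<n. ?eq (sem (FFor ''y'' ?set) ?t) a b" using i(1) by (auto simp: less_Suc_eq)
  qed (use n in simp_all)
  have fr: "sem RELp s ''rows'' = s ''rows''" "sem RELp s ''n'' = s ''n''" by (simp_all add: sem_other)
  show ?thesis unfolding H.has_graph_def
  proof (intro conjI allI impI)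
    show "sem RELp s ''n'' 0 = n" using fr n by simp
    fix i j assume ij: "i < n" "j < n"
    then obtain a b where ab: "a < n" "b < n" "i = pos a" "j = pos b"
      using pos_bij by (auto simp: bij_betw_def) (metis imageE lessThan_iff)
    have "0 < sem RELp s ''B'' (sem RELp s ''rows'' i + j) \<longleftrightarrow> 0 < s ''A'' (a * n + b)"
      using B ab fr s(3)[OF pos_less[OF ab(1)]] by simp
    also have "\<dots> \<longleftrightarrow> relabel pos i j"
      using has_input_adj[OF s(1) ab(1,2)] s(3)[OF ab(1)] relabel_pos ab by simp
    finally show "0 < sem RELp s ''B'' (sem RELp s ''rows'' i + j) \<longleftrightarrow> relabel pos i j" .
  qed
qed

end

text \<open>The machine cannot multiply, so row offsets are accumulated by addition. Storing a sum
  violates \<open>vsafe\<close>, which is why this loop is written directly in the machine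
  language.\<close>

definition ROWSc :: com where
  "ROWSc = Seq (While (Less (Var ''x'') (Var ''n''))
     (Seq (Assign ''rows'' (Add (Var ''x'') (Const 1)) (Add (Elem ''rows'' (Var ''x'')) (Var ''n'')))
        (Assign ''x'' (Const 0) (Add (Var ''x'') (Const 1)))))
     (Assign ''x'' (Const 0) (Const 0))"

definition PROG :: com where
  "PROG = Seq ROWSc (Seq (cc INITp) LOOPc)"

definition "prog_names = insert ''n'' (insert ''A'' (cwrites PROG))"

text \<open>Serves as the memory bound: it covers the row offsets up to \<open>n * n\<close> as well
  as the counters.\<close>

definition "size_poly = ([:1, 1, 1:] :: nat poly)"

lemma poly_size: "poly size_poly n = n * n + n + 1"
  by (simp add: size_poly_def algebra_simps)

definition "init_poly = cost INITp + [:8, 5:]"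

context input_graph
begin

definition rows_state :: "nat \<Rightarrow> state" where
  "rows_state i = upd ((graph_input n E)(''rows'' := (\<lambda>k. if k \<le> i then k * n else 0))) ''x'' 0 i"

abbreviation "M \<equiv> n * n + n + 1"

lemma rows_state_0: "rows_state 0 = graph_input n E"
  unfolding rows_state_def by (auto simp: fun_eq_iff upd_def graph_input_def)

lemma rows_state_simps [simp]:
  "rows_state i ''n'' 0 = n" "rows_state i ''x'' 0 = i" "rows_state i ''rows'' k = (if k \<le> i then k * n else 0)"
  "rows_state i ''A'' = graph_input n E ''A''"
  "x \<notin> {''n'', ''A'', ''rows'', ''x''} \<Longrightarrow> rows_state i x = (\<lambda>_. 0)"
  by (auto simp: rows_state_def graph_input_def)

lemma rows_state_bounded: "i \<le> n \<Longrightarrow> bounded prog_names M (rows_state i)"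
proof -
  assume i: "i \<le> n"
  have nm: "{''n'', ''A'', ''rows'', ''x''} \<subseteq> prog_names"
    by (auto simp: prog_names_def PROG_def ROWSc_def)
  show ?thesis unfolding bounded_def
  proof (intro allI impI)
    fix x k assume nz: "rows_state i x k \<noteq> 0"
    then have x: "x \<in> {''n'', ''A'', ''rows'', ''x''}" using rows_state_simps(5) by metis
    have "k \<le> 2 * M \<and> rows_state i x k \<le> M"
    proof -
      consider "x = ''n''" | "x = ''A''" | "x = ''rows''" | "x = ''x''" using x by blast
      then show ?thesis
      proof cases
        case 1
        then have "k = 0" using nz by (auto simp: rows_state_def graph_input_def split: if_splits)
        then show ?thesis using 1 by simp
      next
        case 2
        then show ?thesis using nz by (auto simp: graph_input_def split: if_splits)
      next
        case 3
        then have "k \<le> n" using nz i by (auto split: if_splits)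
        moreover have "k * n \<le> n * n" using \<open>k \<le> n\<close> by simp
        ultimately have "k * n \<le> n * n + n + 1" by linarith
        moreover have "k \<le> 2 * M" using \<open>k \<le> n\<close> by (simp add: trans_le_add2)
        ultimately show ?thesis using 3 by simp
      next
        case 4
        then have "k = 0" using nz by (auto simp: rows_state_def graph_input_def upd_def split: if_splits)
        then show ?thesis using 4 i by simp
      qed
    qed
    then show "x \<in> prog_names \<and> k \<le> 2 * M \<and> rows_state i x k \<le> M" using x nm by blast
  qed
qed

definition start :: state where
  "start = upd (rows_state n) ''x'' 0 0"

lemma start_bounded: "bounded prog_names M start"
  unfolding start_def by (rule bounded_upd[OF rows_state_bounded])
    (auto simp: prog_names_def PROG_def ROWSc_def)

lemma ex_ROWSc: "ex (\<lambda>r. bounded prog_names M (fst r)) ROWSc (graph_input n E, [], []) (5 * n + 3) (start, [], [])"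
proof -
  let ?P = "\<lambda>r :: state \<times> nat list list \<times> nat list. bounded prog_names M (fst r)"
  let ?f = "\<lambda>i. (rows_state i, [] :: nat list list, [] :: nat list)"
  have body: "ex ?P (Seq (Assign ''rows'' (Add (Var ''x'') (Const 1)) (Add (Elem ''rows'' (Var ''x'')) (Var ''n'')))
        (Assign ''x'' (Const 0) (Add (Var ''x'') (Const 1)))) (?f i) 3 (?f (Suc i))" if i: "i < n" for i
  proof -
    let ?t = "upd (rows_state i) ''rows'' (Suc i) (Suc i * n)"
    have t: "upd ?t ''x'' 0 (Suc i) = rows_state (Suc i)"
      by (auto simp: rows_state_def upd_def fun_eq_iff)
    have "?t = upd (rows_state (Suc i)) ''x'' 0 i"
      by (auto simp: rows_state_def upd_def fun_eq_iff)
    moreover have "bounded prog_names M (upd (rows_state (Suc i)) ''x'' 0 i)"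
      by (rule bounded_upd[OF rows_state_bounded]) (use i in \<open>auto simp: prog_names_def PROG_def ROWSc_def\<close>)
    ultimately have bt: "bounded prog_names M ?t" by simp
    have 1: "ex ?P (Assign ''rows'' (Add (Var ''x'') (Const 1)) (Add (Elem ''rows'' (Var ''x'')) (Var ''n''))) (?f i) 1 (?t, [], [])"
      using ex_Assign[of ?P "rows_state i" "([], [])" "''rows''" "Add (Var ''x'') (Const 1)" "Add (Elem ''rows'' (Var ''x'')) (Var ''n'')"]
        bt rows_state_bounded[of i] i by (simp add: add.commute)
    have 2: "ex ?P (Assign ''x'' (Const 0) (Add (Var ''x'') (Const 1))) (?t, [], []) 1 (?f (Suc i))"
      using ex_Assign[of ?P ?t "([], [])" "''x''" "Const 0" "Add (Var ''x'') (Const 1)"] bt t rows_state_bounded[of "Suc i"] i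
      by simp
    show ?thesis by (rule ex_mono[OF ex_Seq[OF 1 2]]) simp
  qed
  have loop: "ex ?P (While (Less (Var ''x'') (Var ''n''))
     (Seq (Assign ''rows'' (Add (Var ''x'') (Const 1)) (Add (Elem ''rows'' (Var ''x'')) (Var ''n'')))
        (Assign ''x'' (Const 0) (Add (Var ''x'') (Const 1))))) (?f 0) ((n - 0) * (3 + 2) + 1) (?f n)"
    by (rule ex_counting[where f = ?f]) (use body rows_state_bounded in auto)
  have "ex ?P (Assign ''x'' (Const 0) (Const 0)) (?f n) 1 (start, [], [])"
    using ex_Assign[of ?P "rows_state n" "([], [])" "''x''" "Const 0" "Const 0"] rows_state_bounded[of n] start_bounded
    by (simp add: start_def)
  from ex_Seq[OF loop this] have "ex ?P ROWSc (?f 0) (5 * n + 3) (start, [], [])"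
    unfolding ROWSc_def by (rule ex_mono) simp
  then show ?thesis unfolding rows_state_0 .
qed

end

lemma good_mono: "good D c T \<Longrightarrow> D \<le> D' \<Longrightarrow> good D' c T"
  unfolding good_def by (meson add_left_mono le_trans)

text \<open>The first output also waits for the initialisation; between later events three rounds
  suffice.\<close>

definition "delay_poly = init_poly + 3 * iter_poly"

definition "space_poly = [:card prog_names:] * (2 * size_poly + 1) * (3 * size_poly)"

context labelled_graph
begin

definition decode :: "nat set \<Rightarrow> nat set" where
  "decode J = {x. x < n \<and> pos x \<in> J}"

lemma set_sol: "set (H.sol pos J) = decode J"
  by (auto simp: H.sol_def decode_def)

lemma pos_decode: "J \<subseteq> {..<n} \<Longrightarrow> pos ` decode J = J"
proof
  assume J: "J \<subseteq> {..<n}"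
  show "J \<subseteq> pos ` decode J"
  proof
    fix j assume "j \<in> J"
    then have "j \<in> pos ` {..<n}" using J pos_bij by (auto simp: bij_betw_def)
    then show "j \<in> pos ` decode J" using \<open>j \<in> J\<close> by (auto simp: decode_def)
  qed
qed (auto simp: decode_def)

lemma decode_pos: "I \<subseteq> {..<n} \<Longrightarrow> decode (pos ` I) = I"
  using pos_inj by (auto simp: decode_def subset_iff)

lemma decode_maxirr: "decode ` {J. H.maxirr J} = {I. maxirr I}"
proof
  show "decode ` {J. H.maxirr J} \<subseteq> {I. maxirr I}"
  proof clarify
    fix J assume J: "H.maxirr J"
    have "decode J \<subseteq> {..<n}" by (auto simp: decode_def)
    moreover have "pos ` decode J = J" using pos_decode J by (simp add: H.maxirr_def)
    ultimately show "maxirr (decode J)" using maxirr_pos J by metis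
  qed
  show "{I. maxirr I} \<subseteq> decode ` {J. H.maxirr J}"
  proof clarify
    fix I assume I: "maxirr I"
    then have "I \<subseteq> {..<n}" by (simp add: maxirr_def)
    then show "I \<in> decode ` {J. H.maxirr J}"
      using maxirr_pos[of I] decode_pos[of I] I by (metis image_eqI mem_Collect_eq)
  qed
qed

lemma decode_inj: "inj_on decode {J. H.maxirr J}"
  by (rule inj_on_inverseI[where g = "image pos"]) (auto simp: H.maxirr_def pos_decode)

end

context input_graph
begin

lemma start_simps: "start ''n'' 0 = n" "k \<le> n \<Longrightarrow> start ''rows'' k = k * n" "start ''A'' = graph_input n E ''A''"
  "x \<notin> {''n'', ''A'', ''rows'', ''x''} \<Longrightarrow> start x = (\<lambda>_. 0)"
  by (simp_all add: start_def)

lemma start_input: "has_input start"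
proof -
  have "0 < graph_input n E ''A'' (a * n + b) \<longleftrightarrow> {a, b} \<in> E" if "a < n" "b < n" for a b
  proof -
    have "a * n + b < Suc a * n" using that by simp
    also have "\<dots> \<le> n * n" using that by (intro mult_le_mono1) simp
    finally show ?thesis using that by (simp add: graph_input_def)
  qed
  then show ?thesis using start_simps by (simp add: has_input_def)
qed

lemma start_clean: "clean start"
proof -
  have "x \<notin> {''n'', ''A'', ''rows'', ''x''}" if "tmp x" for x using that by auto
  then show ?thesis using start_simps(4) by (simp add: clean_def)
qed

lemma enumeration:
  assumes so: "strongly_orderable {..<n} E"
  shows "lists_without_repetition PROG (graph_input n E) (MaxIrr {..<n} E)"
    "delay_at_most PROG (graph_input n E) (poly delay_poly n)"
    "space_at_most PROG (graph_input n E) (poly space_poly n)"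
proof -
  let ?P = "\<lambda>r :: state \<times> nat list list \<times> nat list. bounded prog_names M (fst r)"
  let ?g = "graph_input n E"
  define s1 s2 s3 where "s1 = sem ORDERp start" and "s2 = sem RELp s1" and "s3 = sem (LBp ''K'' ''J'') s2"
  define pos where "pos = s1 ''pos''"
  have lab: "labelling {..<n} pos" unfolding pos_def s1_def
    by (rule sem_ORDERp[OF start_input _ _ quasi_simple_exists[OF so]]) (simp_all add: start_simps)
  interpret L: labelled_graph n "\<lambda>a b. {a, b} \<in> E" pos
    by unfold_locales (rule lab)
  have in1: "has_input s1"
    by (rule has_input_frame[OF start_input, of "writes ORDERp"]) (auto simp: s1_def sem_other simp del: writes_ORDERp, auto)
  have rows1: "s1 ''rows'' k = k * n" if "k < n" for k
    using that start_simps(2)[of k] by (simp add: s1_def sem_other)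
  have G2: "L.H.has_graph s2" unfolding s2_def
    by (rule L.sem_RELp[OF in1 _ rows1]) (simp add: pos_def)
  have zero2: "s2 x = (\<lambda>_. 0)" if "x \<in> {''K'', ''dir'', ''odd'', ''fin'', ''o''}" for x
    using that start_simps(4)[of x] by (auto simp: s1_def s2_def sem_other)
  have J3: "L.H.set_of s3 ''J'' = L.H.lb {} (n * Suc n)"
  proof -
    have "L.H.set_of s2 ''K'' = {}" using zero2[of "''K''"] by (simp add: L.H.set_of_def)
    then show ?thesis unfolding s3_def using L.H.sem_LBp[OF G2, of "''K''" "''J''"] by simp
  qed
  have G3: "L.H.has_graph s3" unfolding s3_def by (rule L.H.has_graph_sem[OF G2]) simp
  have s3: "s3 = sem INITp start" by (simp add: s1_def s2_def s3_def INITp_def)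
  have pos3: "s3 ''pos'' = pos" by (simp add: s3_def s2_def pos_def sem_other)
  have zero3: "s3 ''dir'' 0 = 0" "s3 ''odd'' 0 = 0" "s3 ''fin'' 0 = 0" "s3 ''o'' 0 = 0"
    using zero2 by (simp_all add: s3_def sem_other)
  have X: "cwrites (cc INITp) \<subseteq> prog_names" "cwrites LOOPc \<subseteq> prog_names"
    by (auto simp: prog_names_def PROG_def)
  have "ex (quiet prog_names M ([], [])) (cc INITp) (start, [], []) (poly (cost INITp) n) (s3, [], [])"
    unfolding s3 by (rule cc_correct[OF wfc_INITp start_clean X(1) start_bounded start_simps(1)]) simp
  then have init: "ex ?P (cc INITp) (start, [], []) (poly (cost INITp) n) (s3, [], [])"
    by (rule ex_Pmono) (auto simp: quiet_def)
  obtain k1 where k1: "k1 \<le> 5 * n + 3" "reach ?P (ROWSc, ?g, [], []) k1 (Skip, start, [], [])"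
    using ex_ROWSc by (auto simp: ex_def)
  obtain k2 where k2: "k2 \<le> poly (cost INITp) n" "reach ?P (cc INITp, start, [], []) k2 (Skip, s3, [], [])"
    using init by (auto simp: ex_def)
  have b3: "bounded prog_names M s3" using ex_end[OF init] by simp
  have r1: "reach ?P (PROG, ?g, [], []) k1 (Seq Skip (Seq (cc INITp) LOOPc), start, [], [])"
    using reach_Seq[OF k1(2), of "Seq (cc INITp) LOOPc"] by (simp add: PROG_def)
  have r2: "reach ?P (Seq Skip (Seq (cc INITp) LOOPc), start, [], []) 1 (Seq (cc INITp) LOOPc, start, [], [])"
    using start_bounded by (auto intro!: reach.intros)
  have r3: "reach ?P (Seq (cc INITp) LOOPc, start, [], []) k2 (Seq Skip LOOPc, s3, [], [])"
    using reach_Seq[OF k2(2), of LOOPc] by simp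
  have r4: "reach ?P (Seq Skip LOOPc, s3, [], []) 1 (LOOPc, s3, [], [])"
    using b3 by (auto intro!: reach.intros)
  define k where "k = k1 + 1 + (k2 + 1)"
  have r: "reach ?P (PROG, ?g, [], []) k (LOOPc, s3, [], [])"
    unfolding k_def by (rule reach_trans[OF reach_trans[OF r1 r2] reach_trans[OF r3 r4]])
  have k: "k \<le> poly init_poly n" using k1(1) k2(1) by (simp add: k_def init_poly_def)
  obtain xs where xs: "L.H.tree.tr (L.H.lb {} (n * Suc n), False, False) xs (L.H.lb {} (n * Suc n), True, False)"
    "distinct xs" "set xs = {c. L.H.maxirr c}" using L.H.tree.traverse by blast
  have rep: "L.H.rep2 prog_names M pos (L.H.lb {} (n * Suc n), False, False) s3"
    unfolding L.H.rep2_def L.H.rep_def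
    using G3 J3 zero3 pos3 b3 clean_sem[OF wfc_INITp start_clean] s3 by simp
  have root: "L.H.maxirr (fst (L.H.lb {} (n * Suc n), False, False))"
    using L.H.tree.root by simp
  obtain T s' where T: "reach ?P (LOOPc, s3, [], []) T (Skip, s', map (L.H.sol pos) xs, [])" "0 < T"
    "good (3 * poly iter_poly n) (LOOPc, s3, [], []) T" "soon (poly iter_poly n) (LOOPc, s3, [], []) T"
    using L.H.loop_run[OF xs(1) refl rep root X(2) _ L.pos_less, of "[]"] by auto
  have R: "reach ?P (PROG, ?g, [], []) (k + T) (Skip, s', map (L.H.sol pos) xs, [])"
    by (rule reach_trans[OF r T(1)])
  have final: "run PROG ?g (k + T) = (Skip, s', map (L.H.sol pos) xs, [])"
    using reach_final[OF R] by (simp add: run_def)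
  have halt: "halts_at PROG ?g (k + T)"
    unfolding halts_at_def using final reach_not_Skip[OF R] by (auto simp: remaining_def run_def)
  have "good (poly delay_poly n) (LOOPc, s3, [], []) T"
    by (rule good_mono[OF T(3)]) (simp add: delay_poly_def)
  from good_append[OF reach_final[OF r] this T(4)] k
  show "delay_at_most PROG ?g (poly delay_poly n)"
    by (intro good_delay[OF halt]) (simp add: delay_poly_def)
  have sols: "solutions (run PROG ?g (k + T)) = map (L.H.sol pos) xs" using final by (simp add: solutions_def)
  have sets: "map set (map (L.H.sol pos) xs) = map L.decode xs" by (simp add: L.set_sol)
  show "lists_without_repetition PROG ?g (MaxIrr {..<n} E)"
    unfolding lists_without_repetition_def
  proof (intro exI conjI)
    show "halts_at PROG ?g (k + T)" by (rule halt)
    show "unfinished (run PROG ?g (k + T)) = []" using final by (simp add: unfinished_def)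
    show "\<forall>ys\<in>set (solutions (run PROG ?g (k + T))). distinct ys"
      unfolding sols by (auto simp: L.H.sol_def)
    show "distinct (map set (solutions (run PROG ?g (k + T))))"
      unfolding sols sets distinct_map using xs L.decode_inj by simp
    have "set ` set (map (L.H.sol pos) xs) = L.decode ` set xs"
      by (simp add: image_image L.set_sol)
    also have "\<dots> = {I. maxirr I}" using L.decode_maxirr xs by simp
    also have "\<dots> = MaxIrr {..<n} E" using MaxIrr_iff by blast
    finally show "set ` set (solutions (run PROG ?g (k + T))) = MaxIrr {..<n} E" unfolding sols .
  qed
  show "space_at_most PROG ?g (poly space_poly n)"
    unfolding space_at_most_def
  proof
    fix t
    have "bounded prog_names M (memory (run PROG ?g t))"
    proof (cases "t \<le> k + T")
      case True
      then show ?thesis using reach_between[OF R True] by (simp add: memory_def run_def)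
    next
      case False
      define j where "j = t - (k + T)"
      \<comment> \<open>The space bound concerns all times, and a halted configuration repeats
        forever.\<close>
      have "(step ^^ j) (Skip, s', map (L.H.sol pos) xs, []) = (Skip, s', map (L.H.sol pos) xs, [])"
        by (induction j) auto
      moreover have "t = j + (k + T)" using False by (simp add: j_def)
      ultimately have "run PROG ?g t = run PROG ?g (k + T)"
        using final by (simp add: run_def funpow_add)
      then show ?thesis using reach_between[OF R order_refl] by (simp add: memory_def run_def)
    qed
    moreover have "finite prog_names" by (simp add: prog_names_def finite_cwrites)
    ultimately have "memory_bits (memory (run PROG ?g t)) \<le> card prog_names * (2 * M + 1) * (3 * M)"
      by (rule memory_bits_bounded[rotated])
    then show "memory_bits (memory (run PROG ?g t)) \<le> poly space_poly n"
      by (simp add: space_poly_def poly_size algebra_simps)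
  qed
qed

end

theorem theorem4:
  "\<exists>(c :: com) (p :: nat poly) (q :: nat poly).
     \<forall>(n :: nat) (E :: nat set set).
       simple_graph {..<n} E \<and> strongly_orderable {..<n} E \<longrightarrow>
         lists_without_repetition c (graph_input n E) (MaxIrr {..<n} E) \<and>
         delay_at_most c (graph_input n E) (poly p (graph_size n E)) \<and>
         space_at_most c (graph_input n E) (poly q (graph_size n E))"
proof (intro exI allI impI)
  fix n :: nat and E :: "nat set set"
  assume a: "simple_graph {..<n} E \<and> strongly_orderable {..<n} E"
  then interpret input_graph n E by unfold_locales simp
  note e = enumeration[OF conjunct2[OF a]]
  \<comment> \<open>The bounds are polynomials in \<open>n\<close> alone; natural coefficients make
    them monotone, so \<open>graph_size\<close> may replace \<open>n\<close>.\<close>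
  have size: "poly r n \<le> poly r (graph_size n E)" for r :: "nat poly"
    by (rule poly_mono_nat) (simp add: graph_size_def)
  have "delay_at_most PROG (graph_input n E) (poly delay_poly (graph_size n E))"
    using e(2) size[of delay_poly] unfolding delay_at_most_def Let_def by (meson le_trans)
  moreover have "space_at_most PROG (graph_input n E) (poly space_poly (graph_size n E))"
    using e(3) size[of space_poly] unfolding space_at_most_def by (meson le_trans)
  ultimately show "lists_without_repetition PROG (graph_input n E) (MaxIrr {..<n} E) \<and>
         delay_at_most PROG (graph_input n E) (poly delay_poly (graph_size n E)) \<and>
         space_at_most PROG (graph_input n E) (poly space_poly (graph_size n E))"
    using e(1) by blast
qed

end
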